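(* For each $n$ let $(d_i)_{i=1}^n=(d_i^{(n)})_{i=1}^n$ be a sequence of nonnegative integers for which at least one simple graph on vertex set $\{1,\dots,n\}$ with $\deg(i)=d_i$ for all $i$ exists, and let $G(n,(d_i)_1^n)$ be a uniformly random simple graph with this degree sequence. Let $\mathcal{C}_1$ be the largest component of $G(n,(d_i)_1^n)$ and $|\mathcal{C}_1|$ its number of vertices. Let $D_n$, $\mu_n$, $\nu_n$ be as defined in the context, and let $\Delta_n:=\max_{1\le i\le n} d_i$ be the maximum degree. Suppose that $\mu_n\to\mu_\infty$ and $\nu_n\to\nu_\infty$ as $n\to\infty$, where $\mu_\infty>0$ and $\nu_\infty<1$ are real constants. Suppose further that for some $\gamma>3$, $$\mathbb{P}(D_n\ge k)=O(k^{1-\gamma})$$ uniformly in $n$ and $k\ge 1$ (i.e. there is a constant $C$ such that $\mathbb{P}(D_n\ge k)\le Ck^{1-\gamma}$ for all $n$ and all integers $k\ge1$). Then $$|\mathcal{C}_1|=\frac{\Delta_n}{1-\nu_n}+o_p\bigl(n^{1/(\gamma-1)}\bigr)\qquad\text{as } n\to\infty.$$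
   Context: The degree sequence $(d_i)_1^n$ is deterministic and may depend on $n$ (the dependence is suppressed in the notation). $D_n$ is the degree of a uniformly randomly chosen vertex, so $\mathbb{P}(D_n=k)=n_k/n$ with $n_k:=|\{i\le n: d_i=k\}|$. The parameters are $$\mu_n:=\mathbb{E}D_n=\frac1n\sum_{i=1}^n d_i,\qquad \nu_n:=\frac{1}{n\mu_n}\sum_{i=1}^n d_i(d_i-1).$$ ($\nu_n$ is defined whenever $\mu_n>0$, hence for all large $n$ when $\mu_n\to\mu_\infty>0$; likewise $\nu_n<1$ for all large $n$ when $\nu_n\to\nu_\infty<1$.) If there are several largest components, $\mathcal{C}_1$ is any of them. For random variables $X_n$ and positive numbers $a_n$, $X_n=o_p(a_n)$ means that $\mathbb{P}(|X_n|>\varepsilon a_n)\to0$ as $n\to\infty$ for every $\varepsilon>0$. *)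

theory Defs
  imports "HOL-Probability.Probability"
begin

text \<open>
  A simple graph on a fixed vertex set is represented by its set of edges, each edge being
  a two-element set of vertices.
\<close>

definition simple_graphs :: "'a set \<Rightarrow> 'a set set set" where
  "simple_graphs V = {E. \<forall>e\<in>E. e \<subseteq> V \<and> card e = 2}"

definition vertex_degree :: "'a set set \<Rightarrow> 'a \<Rightarrow> nat" where
  "vertex_degree E v = card {e \<in> E. v \<in> e}"

definition adjacency :: "'a set set \<Rightarrow> ('a \<times> 'a) set" where
  "adjacency E = {(u, v). {u, v} \<in> E}"

definition components :: "'a set \<Rightarrow> 'a set set \<Rightarrow> 'a set set" where
  "components V E = {{v \<in> V. (u, v) \<in> (adjacency E)\<^sup>*} | u. u \<in> V}"

definition is_largest_component :: "'a set \<Rightarrow> 'a set set \<Rightarrow> 'a set \<Rightarrow> bool" where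
  "is_largest_component V E C \<longleftrightarrow>
     C \<in> components V E \<and> (\<forall>C'\<in>components V E. card C' \<le> card C)"


text \<open>
  A degree sequence of length \<open>n\<close> is a function \<open>d\<close> of which only the values on \<open>{1..n}\<close> matter.
\<close>

definition graphs_with_degrees :: "nat \<Rightarrow> (nat \<Rightarrow> nat) \<Rightarrow> nat set set set" where
  "graphs_with_degrees n d =
     {E \<in> simple_graphs {1..n}. \<forall>i\<in>{1..n}. vertex_degree E i = d i}"

text \<open>
  Since \<^const>\<open>pmf_of_set\<close> is only meaningful on finite nonempty sets, the next two
  definitions need a realizable degree sequence and \<open>n \<ge> 1\<close>, respectively.
\<close>

definition random_graph :: "nat \<Rightarrow> (nat \<Rightarrow> nat) \<Rightarrow> nat set set pmf" where
  "random_graph n d = pmf_of_set (graphs_with_degrees n d)"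

definition degree_pmf :: "nat \<Rightarrow> (nat \<Rightarrow> nat) \<Rightarrow> nat pmf" where
  "degree_pmf n d = map_pmf d (pmf_of_set {1..n})"

definition mean_degree :: "nat \<Rightarrow> (nat \<Rightarrow> nat) \<Rightarrow> real" where
  "mean_degree n d = measure_pmf.expectation (degree_pmf n d) real"

definition nu :: "nat \<Rightarrow> (nat \<Rightarrow> nat) \<Rightarrow> real" where
  "nu n d = (1 / (real n * mean_degree n d)) * (\<Sum>i=1..n. real (d i) * (real (d i) - 1))"

definition max_degree :: "nat \<Rightarrow> (nat \<Rightarrow> nat) \<Rightarrow> nat" where
  "max_degree n d = Max (d ` {1..n})"

definition small_o_p ::
  "(nat \<Rightarrow> 'a measure) \<Rightarrow> (nat \<Rightarrow> 'a \<Rightarrow> real) \<Rightarrow> (nat \<Rightarrow> real) \<Rightarrow> bool" where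
  "small_o_p M X a \<longleftrightarrow>
     (\<forall>\<epsilon>>0. (\<lambda>n. measure (M n) {\<omega> \<in> space (M n). \<bar>X n \<omega>\<bar> > \<epsilon> * a n}) \<longlonglongrightarrow> 0)"


lemma finite_graphs_with_degrees: "finite (graphs_with_degrees n d)"
proof (rule finite_subset)
  show "graphs_with_degrees n d \<subseteq> Pow (Pow {1..n})"
    by (auto simp: graphs_with_degrees_def simple_graphs_def)
qed simp

lemma mean_degree_eq_sum:
  assumes "n \<ge> 1"
  shows "mean_degree n d = (1 / real n) * (\<Sum>i=1..n. real (d i))"
  using assms by (simp add: mean_degree_def degree_pmf_def integral_pmf_of_set)

lemma pmf_degree_pmf:
  assumes "n \<ge> 1"
  shows "pmf (degree_pmf n d) k = real (card {i \<in> {1..n}. d i = k}) / real n"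
proof -
  have "{1..n} \<inter> d -` {k} = {i \<in> {1..n}. d i = k}" by auto
  then show ?thesis
    using assms by (simp add: degree_pmf_def pmf_map measure_pmf_of_set)
qed

end

theory Submission
  imports Defs
begin

text \<open>
  The uniform simple graph is explored one vertex at a time. Given the neighbourhood \<open>S\<close> of \<open>u\<close>, the
  graph without \<open>u\<close> is again uniform for the degrees lowered by one on \<open>S\<close>, and a switching shows that
  \<open>S\<close> lies in the neighbourhood of \<open>u\<close> with probability at most
  \<open>d u * (d u - 1) * \<dots> * (\<Prod>y\<in>S. d y / Q)\<close>, where \<open>Q\<close> is asymptotically the number of half-edges. Hence
  \<open>exp (s * explored) * (\<Prod>active a. exp s * (1 + \<eta>) ^ d a)\<close> is a supermartingale for
  \<open>\<eta>\<close> slightly larger than \<open>s / (1 - \<nu>)\<close>, provided that \<open>\<eta>\<^sup>2 * (\<Sum>d\<^sup>3 exp (\<eta> d))\<close> is small compared with \<open>\<eta> n\<close>.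

  Let \<open>N = n powr (1 / (\<gamma> - 1))\<close>. For \<open>s\<close> of order \<open>ln n / N\<close> this excludes components of order \<open>N\<close> that avoid
  all vertices of degree at least \<open>\<epsilon> N\<close>, of which there are boundedly many. For \<open>s = 1 / N\<close>, together with a lower bound
  on the mean obtained from the submartingale \<open>explored + |active| + h * (\<Sum>active a. d a)\<close> with \<open>h\<close> slightly smaller than
  \<open>1 / (1 - \<nu>)\<close>, it shows that the component of each single vertex \<open>v\<close> has size
  \<open>d v / (1 - \<nu>) + o(N)\<close> with high probability.
\<close>

section \<open>Switchings\<close>

text \<open>The slope 1 / (1 - \<nu>) is the balance point of the potential: a half-edge of
  \<open>u\<close> spends \<open>h\<close>, finds about one new vertex, and that vertex brings about
  \<nu> further half-edges, so the drift per half-edge is about 1 - h + h * \<nu>. A slightly larger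
  or smaller slope leaves a margin for the errors. One error is that the switching loses 2 *
  \<Delta> * (\<Delta> + 1) half-edges and each revealed vertex up to 2 * \<Delta> more; as \<Delta>
  = O(N) and only O(N) vertices are revealed, both are O(N^2), which is o(n) because \<gamma> > 3.
  The same gap gives a bounded moment of order 2 + \<beta>, so the cubes of the degrees sum to O(n *
  N^(1 - \<beta>)); this controls the quadratic term for \<eta> of order 1 / N, and even ln n / N
  once the heavy vertices are left out. Concentration of a single component comes without a rate and
  cannot survive a union over n vertices. Hence the split: a largest component is either light,
  where the failure probability is n^(-2) per vertex, or it contains one of boundedly many heavy
  vertices.\<close>

definition degree_graphs :: "'a set \<Rightarrow> ('a \<Rightarrow> nat) \<Rightarrow> 'a set set set" where
  "degree_graphs V d = {E \<in> simple_graphs V. \<forall>i\<in>V. vertex_degree E i = d i}"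

definition nbrs :: "'a set set \<Rightarrow> 'a \<Rightarrow> 'a set" where
  "nbrs E u = {y. {u, y} \<in> E}"

lemma graphs_with_degrees_eq: "graphs_with_degrees n d = degree_graphs {1..n} d"
  by (simp add: graphs_with_degrees_def degree_graphs_def)

lemma simple_graphs_edgeD:
  assumes "E \<in> simple_graphs V" "{u, y} \<in> E"
  shows "u \<in> V" "y \<in> V" "u \<noteq> y"
  using assms by (auto simp: simple_graphs_def)

lemma simple_graphs_edgeE:
  assumes "E \<in> simple_graphs V" "e \<in> E"
  obtains u y where "e = {u, y}" "u \<noteq> y" "u \<in> V" "y \<in> V"
proof -
  from assms have "card e = 2" "e \<subseteq> V" by (auto simp: simple_graphs_def)
  then show thesis using that by (auto simp: card_2_iff)
qed

lemma finite_simple_graph: "finite V \<Longrightarrow> E \<in> simple_graphs V \<Longrightarrow> finite E"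
  by (rule finite_subset[of _ "Pow V"]) (auto simp: simple_graphs_def)

lemma finite_degree_graphs: "finite V \<Longrightarrow> finite (degree_graphs V d)"
  by (rule finite_subset[of _ "Pow (Pow V)"]) (auto simp: degree_graphs_def simple_graphs_def)

lemma degree_graphs_simple: "G \<in> degree_graphs V d \<Longrightarrow> G \<in> simple_graphs V"
  by (simp add: degree_graphs_def)

lemma nbrs_subset: "E \<in> simple_graphs V \<Longrightarrow> nbrs E u \<subseteq> V - {u}"
  by (auto simp: nbrs_def dest: simple_graphs_edgeD)

lemma finite_nbrs: "finite V \<Longrightarrow> E \<in> simple_graphs V \<Longrightarrow> finite (nbrs E u)"
  by (meson finite_Diff finite_subset nbrs_subset)

lemma nbrs_sym: "y \<in> nbrs E u \<longleftrightarrow> u \<in> nbrs E y"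
  by (simp add: nbrs_def insert_commute)

lemma card_nbrs:
  assumes "E \<in> simple_graphs V"
  shows "card (nbrs E u) = vertex_degree E u"
proof -
  have "bij_betw (\<lambda>y. {u, y}) (nbrs E u) {e \<in> E. u \<in> e}"
    unfolding bij_betw_def
  proof
    show "inj_on (\<lambda>y. {u, y}) (nbrs E u)"
      by (auto simp: inj_on_def doubleton_eq_iff)
    show "(\<lambda>y. {u, y}) ` nbrs E u = {e \<in> E. u \<in> e}"
    proof (intro set_eqI iffI)
      fix e assume "e \<in> {e \<in> E. u \<in> e}"
      then have e: "e \<in> E" "u \<in> e" by auto
      from simple_graphs_edgeE[OF assms e(1)] obtain a b where "e = {a, b}" by metis
      with e show "e \<in> (\<lambda>y. {u, y}) ` nbrs E u"
        by (auto simp: nbrs_def insert_commute)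
    qed (auto simp: nbrs_def)
  qed
  then show ?thesis unfolding vertex_degree_def by (rule bij_betw_same_card)
qed

lemma card_nbrs_degree:
  assumes "G \<in> degree_graphs V d" "u \<in> V"
  shows "card (nbrs G u) = d u"
  using assms card_nbrs[of G V u] by (auto simp: degree_graphs_def)

lemma adjacency_Sigma:
  assumes "E \<in> simple_graphs V"
  shows "adjacency E = Sigma V (nbrs E)"
  using simple_graphs_edgeD[OF assms] by (auto simp: adjacency_def nbrs_def)

lemma card_adjacency:
  assumes "finite V" "G \<in> degree_graphs V d"
  shows "card (adjacency G) = (\<Sum>v\<in>V. d v)"
proof -
  note s = degree_graphs_simple[OF assms(2)]
  show ?thesis
    unfolding adjacency_Sigma[OF s]
    using assms finite_nbrs[OF assms(1) s] by (simp add: card_nbrs_degree)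
qed

lemma vertex_degree_insert:
  assumes "finite E" "e \<notin> E"
  shows "vertex_degree (insert e E) i = vertex_degree E i + of_bool (i \<in> e)"
proof -
  have "{e' \<in> insert e E. i \<in> e'} = (if i \<in> e then insert e {e' \<in> E. i \<in> e'} else {e' \<in> E. i \<in> e'})"
    by auto
  then show ?thesis using assms by (simp add: vertex_degree_def)
qed

definition switch :: "'a \<Rightarrow> 'a \<Rightarrow> 'a \<Rightarrow> 'a \<Rightarrow> 'a set set \<Rightarrow> 'a set set" where
  "switch u v x y G = insert {u, x} (insert {v, y} (G - {{u, v}, {x, y}}))"

text \<open>Each of the four vertices loses one edge and gains one, so degrees survive if the four
  are distinct and the two new edges are really new. The exclusions give just this: v is adjacent to
  u, so avoiding the closed neighbourhood of u also forces x \<noteq> v, and likewise y \<noteq> u.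
  The second conclusion undoes the switch from u, v, x, y alone, which yields injectivity
  later.\<close>

lemma switch_degree_graphs:
  assumes V: "finite V" and G: "G \<in> degree_graphs V d"
    and uv: "v \<in> nbrs G u" and xy: "(x, y) \<in> adjacency G"
    and x: "x \<notin> insert u (nbrs G u)" and y: "y \<notin> insert v (nbrs G v)"
  shows "switch u v x y G \<in> degree_graphs V d"
    and "G = insert {u, v} (insert {x, y} (switch u v x y G - {{u, x}, {v, y}}))"
proof -
  note s = degree_graphs_simple[OF G]
  define E0 where "E0 = G - {{u, v}, {x, y}}"
  have eq: "G = insert {u, v} (insert {x, y} E0)"
    using uv xy by (auto simp: nbrs_def adjacency_def E0_def)
  have sw: "switch u v x y G = insert {u, x} (insert {v, y} E0)"
    by (simp add: switch_def E0_def)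
  have memb: "{u, v} \<in> G" "{x, y} \<in> G" "{u, x} \<notin> G" "{v, y} \<notin> G"
    using uv xy x y by (auto simp: nbrs_def adjacency_def)
  have d: "u \<in> V" "v \<in> V" "x \<in> V" "y \<in> V" "u \<noteq> v" "x \<noteq> y"
    using simple_graphs_edgeD[OF s] memb by auto
  have d': "u \<noteq> x" "v \<noteq> y" using x y by auto
  have d'': "x \<noteq> v" "y \<noteq> u"
    using uv x y nbrs_sym[of v G u] by auto
  have fin: "finite E0" using finite_simple_graph[OF V s] by (simp add: E0_def)
  have "{u, x} \<notin> insert {v, y} E0" "{v, y} \<notin> E0" "{u, v} \<notin> insert {x, y} E0" "{x, y} \<notin> E0"
    using memb d d' d'' by (auto simp: E0_def doubleton_eq_iff)
  then have "vertex_degree (switch u v x y G) i = vertex_degree G i" for i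
    unfolding sw using d d' d'' fin by (subst eq) (auto simp: vertex_degree_insert)
  moreover have "switch u v x y G \<in> simple_graphs V"
    using s d d' d'' by (auto simp: simple_graphs_def sw E0_def)
  ultimately show "switch u v x y G \<in> degree_graphs V d"
    using G by (simp add: degree_graphs_def)
  show "G = insert {u, v} (insert {x, y} (switch u v x y G - {{u, x}, {v, y}}))"
    using memb d d' d'' unfolding switch_def by (auto simp: doubleton_eq_iff)
qed

text \<open>\<open>adjacency G\<close> has one arc per half-edge. At most \<Delta> * (\<Delta> + 1)
  arcs start in the closed neighbourhood of u, and reversing arcs gives the same bound for those
  that end in that of v; this is the loss 2 * \<Delta> * (\<Delta> + 1) built into Q.\<close>

lemma card_switchable_arcs:
  fixes d :: "'a \<Rightarrow> nat" and Q :: real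
  assumes V: "finite V" and \<Delta>: "\<And>y. y \<in> V \<Longrightarrow> d y \<le> \<Delta>"
    and Q: "Q + 2 * real \<Delta> * (real \<Delta> + 1) \<le> (\<Sum>y\<in>V. real (d y))"
    and uv: "u \<in> V" "v \<in> V" and G: "G \<in> degree_graphs V d"
  shows "Q \<le> card {(x, y) \<in> adjacency G. x \<notin> insert u (nbrs G u) \<and> y \<notin> insert v (nbrs G v)}"
    (is "Q \<le> card ?P")
proof -
  note s = degree_graphs_simple[OF G]
  have finadj: "finite (adjacency G)"
    unfolding adjacency_Sigma[OF s] using V finite_nbrs[OF V s] by auto
  have bad: "finite {(x, y) \<in> adjacency G. x \<in> insert w (nbrs G w)}
      \<and> card {(x, y) \<in> adjacency G. x \<in> insert w (nbrs G w)} \<le> \<Delta> * (\<Delta> + 1)"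
    if w: "w \<in> V" for w
  proof -
    let ?W = "insert w (nbrs G w)"
    have W: "?W \<subseteq> V" "finite ?W" using nbrs_subset[OF s, of w] w finite_nbrs[OF V s] by auto
    have cW: "card ?W \<le> \<Delta> + 1"
      using card_nbrs_degree[OF G w] \<Delta>[OF w] finite_nbrs[OF V s, of w]
      by (simp add: card_insert_if)
    have eq: "{(x, y) \<in> adjacency G. x \<in> ?W} = Sigma ?W (nbrs G)"
      unfolding adjacency_Sigma[OF s] using W by auto
    have "card (Sigma ?W (nbrs G)) = (\<Sum>x\<in>?W. card (nbrs G x))"
      using W finite_nbrs[OF V s] by simp
    also have "\<dots> \<le> (\<Sum>x\<in>?W. \<Delta>)"
      using W card_nbrs_degree[OF G] \<Delta> by (intro sum_mono) (metis subsetD)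
    also have "\<dots> \<le> \<Delta> * (\<Delta> + 1)" using mult_le_mono2[OF cW, of \<Delta>] by (simp only: sum_constant mult.commute of_nat_id)
    finally show ?thesis unfolding eq using W finite_nbrs[OF V s] by auto
  qed
  have swap: "{(x, y) \<in> adjacency G. y \<in> insert v (nbrs G v)} =
      prod.swap ` {(x, y) \<in> adjacency G. x \<in> insert v (nbrs G v)}"
    by (auto simp: adjacency_def insert_commute image_iff)
  have "adjacency G \<subseteq> ?P \<union> {(x, y) \<in> adjacency G. x \<in> insert u (nbrs G u)}
      \<union> {(x, y) \<in> adjacency G. y \<in> insert v (nbrs G v)}" by auto
  then have "card (adjacency G) \<le> card (?P \<union> {(x, y) \<in> adjacency G. x \<in> insert u (nbrs G u)}
      \<union> {(x, y) \<in> adjacency G. y \<in> insert v (nbrs G v)})"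
    by (intro card_mono) (auto intro: finite_subset[OF _ finadj])
  also have "\<dots> \<le> card ?P + \<Delta> * (\<Delta> + 1) + \<Delta> * (\<Delta> + 1)"
    using bad[OF uv(1)] bad[OF uv(2)] card_image_le[of _ prod.swap]
    unfolding swap by (intro order_trans[OF card_Un_le] add_mono) (auto intro: order_trans)
  finally have "(\<Sum>y\<in>V. d y) \<le> card ?P + 2 * \<Delta> * (\<Delta> + 1)"
    using card_adjacency[OF V G] by (simp add: algebra_simps)
  then have "real (\<Sum>y\<in>V. d y) \<le> real (card ?P) + real (2 * \<Delta> * (\<Delta> + 1))"
    unfolding of_nat_add[symmetric] of_nat_le_iff .
  then show ?thesis using Q by (simp add: algebra_simps)
qed

text \<open>Double counting of the switches that break the edge u v. Every graph on the left has at
  least Q admissible arcs, and the switched graph together with (x, y) determines the original,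
  where x is a neighbour of u outside S and y a neighbour of v. Divided by Q, this bounds the
  conditional probability that v is adjacent to u, given S, by (d u - |S|) * d v / Q.\<close>

lemma star_switching:
  fixes d :: "'a \<Rightarrow> nat" and Q :: real
  assumes V: "finite V" and \<Delta>: "\<And>y. y \<in> V \<Longrightarrow> d y \<le> \<Delta>"
    and Q: "Q + 2 * real \<Delta> * (real \<Delta> + 1) \<le> (\<Sum>y\<in>V. real (d y))"
    and uv: "u \<in> V" "v \<in> V" "v \<notin> S"
  shows "Q * card {G \<in> degree_graphs V d. insert v S \<subseteq> nbrs G u}
    \<le> real (d u - card S) * d v * card {G \<in> degree_graphs V d. S \<subseteq> nbrs G u}"
proof -
  let ?L = "{G \<in> degree_graphs V d. insert v S \<subseteq> nbrs G u}"
  let ?R = "{G \<in> degree_graphs V d. S \<subseteq> nbrs G u}"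
  define P where "P G = {(x, y) \<in> adjacency G. x \<notin> insert u (nbrs G u) \<and> y \<notin> insert v (nbrs G v)}" for G
  define \<phi> where "\<phi> = (\<lambda>(G, (x, y)). (switch u v x y G, (x, y)))"
  have finG: "finite (degree_graphs V d)" by (rule finite_degree_graphs[OF V])
  have finP: "finite (P G)" if "G \<in> degree_graphs V d" for G
  proof (rule finite_subset)
    show "P G \<subseteq> Sigma V (nbrs G)"
      unfolding P_def adjacency_Sigma[OF degree_graphs_simple[OF that]] by blast
    show "finite (Sigma V (nbrs G))"
      using V finite_nbrs[OF V degree_graphs_simple[OF that]] by (intro finite_SigmaI)
  qed
  have inj: "inj_on \<phi> (Sigma ?L P)"
  proof (rule inj_onI, clarsimp simp: \<phi>_def)
    fix G H x y
    assume *: "G \<in> degree_graphs V d" "v \<in> nbrs G u" "(x, y) \<in> P G"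
      "H \<in> degree_graphs V d" "v \<in> nbrs H u" "(x, y) \<in> P H" "switch u v x y G = switch u v x y H"
    have rev: "insert {u, v} (insert {x, y} (switch u v x y G' - {{u, x}, {v, y}})) = G'"
      if "G' \<in> degree_graphs V d" "v \<in> nbrs G' u" "(x, y) \<in> P G'" for G'
      using that(3) by (intro switch_degree_graphs(2)[OF V that(1,2), symmetric]) (simp_all add: P_def)
    have "G = insert {u, v} (insert {x, y} (switch u v x y G - {{u, x}, {v, y}}))"
      by (rule rev[symmetric]) (fact *)+
    also have "\<dots> = insert {u, v} (insert {x, y} (switch u v x y H - {{u, x}, {v, y}}))"
      by (simp only: *(7))
    also have "\<dots> = H" by (rule rev) (fact *)+
    finally show "G = H" .
  qed
  have img: "\<phi> ` Sigma ?L P \<subseteq> Sigma ?R (\<lambda>G. (nbrs G u - S) \<times> nbrs G v)"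
  proof (clarsimp simp: \<phi>_def)
    fix G x y
    assume *: "G \<in> degree_graphs V d" "v \<in> nbrs G u" "S \<subseteq> nbrs G u" "(x, y) \<in> P G"
    then have P: "(x, y) \<in> adjacency G" "x \<notin> insert u (nbrs G u)" "y \<notin> insert v (nbrs G v)"
      by (auto simp: P_def)
    \<comment> \<open>With x \<noteq> u this keeps the removed edge x y away from u, so no edge from
      u to S is lost.\<close>
    have "y \<noteq> u" using P(3) *(2) nbrs_sym[of v G u] by auto
    then have "S \<subseteq> nbrs (switch u v x y G) u"
      using *(3) P uv(3) by (auto simp: switch_def nbrs_def doubleton_eq_iff)
    moreover have "x \<in> nbrs (switch u v x y G) u" "y \<in> nbrs (switch u v x y G) v"
      by (auto simp: switch_def nbrs_def)
    ultimately show "switch u v x y G \<in> degree_graphs V d \<and> S \<subseteq> nbrs (switch u v x y G) u \<and>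
          x \<in> nbrs (switch u v x y G) u \<and> x \<notin> S \<and> y \<in> nbrs (switch u v x y G) v"
      using switch_degree_graphs(1)[OF V *(1,2) P] P *(3) by auto
  qed
  have "Q * card ?L \<le> (\<Sum>G\<in>?L. real (card (P G)))"
  proof -
    have "(\<Sum>G\<in>?L. Q) \<le> (\<Sum>G\<in>?L. real (card (P G)))"
      unfolding P_def using card_switchable_arcs[OF V \<Delta> Q uv(1,2)] by (intro sum_mono) auto
    then show ?thesis by (simp add: mult.commute)
  qed
  also have "\<dots> = real (card (Sigma ?L P))"
    using finP finG by (subst card_SigmaI) auto
  also have "\<dots> \<le> real (card (Sigma ?R (\<lambda>G. (nbrs G u - S) \<times> nbrs G v)))"
    unfolding of_nat_le_iff
  proof (rule card_inj_on_le[OF inj img], rule finite_SigmaI)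
    show "finite ?R" using finG by simp
    show "finite ((nbrs G u - S) \<times> nbrs G v)" if "G \<in> ?R" for G
      using that finite_nbrs[OF V degree_graphs_simple] by (intro finite_cartesian_product) auto
  qed
  also have "\<dots> = (\<Sum>G\<in>?R. real (card (nbrs G u - S) * card (nbrs G v)))"
  proof (subst card_SigmaI)
    show "finite ?R" using finG by simp
    show "\<forall>G\<in>?R. finite ((nbrs G u - S) \<times> nbrs G v)"
      using finite_nbrs[OF V degree_graphs_simple] by auto
  qed (simp add: card_cartesian_product)
  also have "\<dots> = (\<Sum>G\<in>?R. real (d u - card S) * d v)"
  proof (rule sum.cong[OF refl])
    fix G assume "G \<in> ?R"
    then have G: "G \<in> degree_graphs V d" "S \<subseteq> nbrs G u" by auto
    have "finite S" using G finite_nbrs[OF V degree_graphs_simple] finite_subset by metis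
    then show "real (card (nbrs G u - S) * card (nbrs G v)) = real (d u - card S) * d v"
      using G card_nbrs_degree[OF G(1)] uv by (simp add: card_Diff_subset)
  qed
  also have "\<dots> = real (d u - card S) * d v * card ?R" by simp
  finally show ?thesis .
qed

section \<open>Exploring a component\<close>

text \<open>\<open>W k\<close> is the sum over all graphs of the k-th elementary symmetric
  polynomial of g on the neighbourhood of u. Marking one element v of a set of size k + 1 and
  splitting it off turns \<open>Suc k * W (Suc k)\<close> into a sum over pairs (S, v), and the
  switching bound applies to each pair.\<close>

lemma weighted_star_count_Suc_le:
  fixes d :: "'a \<Rightarrow> nat" and g :: "'a \<Rightarrow> real" and Q :: real
  assumes V: "finite V" and \<Delta>: "\<And>y. y \<in> V \<Longrightarrow> d y \<le> \<Delta>"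
    and Q: "Q + 2 * real \<Delta> * (real \<Delta> + 1) \<le> (\<Sum>y\<in>V. real (d y))" "Q > 0"
    and u: "u \<in> V" and g: "\<And>y. y \<in> V \<Longrightarrow> g y \<ge> 0"
  defines "c S \<equiv> real (card {G \<in> degree_graphs V d. S \<subseteq> nbrs G u})"
    and "W k \<equiv> \<Sum>S | S \<subseteq> V \<and> card S = k. real (card {G \<in> degree_graphs V d. S \<subseteq> nbrs G u}) * prod g S"
  shows "real (Suc k) * W (Suc k) \<le> real (d u - k) * ((\<Sum>y\<in>V. d y * g y) / Q) * W k"
proof -
  let ?S = "\<lambda>k. {S. S \<subseteq> V \<and> card S = k}"
  have fin: "finite (?S j)" for j using V by simp
  have finS: "finite S" if "S \<in> ?S j" for S j using that V finite_subset by auto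
  have "real (Suc k) * W (Suc k) = (\<Sum>S\<in>?S (Suc k). \<Sum>v\<in>S. c S * prod g S)"
    unfolding W_def c_def sum_distrib_left by (intro sum.cong) auto
  also have "\<dots> = (\<Sum>(S, v)\<in>Sigma (?S (Suc k)) (\<lambda>S. S). c S * prod g S)"
    using finS by (intro sum.Sigma fin) blast
  also have "\<dots> = (\<Sum>(S, v)\<in>Sigma (?S k) (\<lambda>S. V - S). c (insert v S) * (prod g S * g v))"
  proof (rule sum.reindex_bij_witness[where j = "\<lambda>(S, v). (S - {v}, v)" and i = "\<lambda>(S, v). (insert v S, v)"])
    fix a assume a: "a \<in> Sigma (?S (Suc k)) (\<lambda>S. S)"
    obtain S v where [simp]: "a = (S, v)" by (cases a)
    from a have *: "S \<subseteq> V" "card S = Suc k" "v \<in> S" by auto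
    then have S: "finite S" using V finite_subset by auto
    show "(case case a of (S, v) \<Rightarrow> (S - {v}, v) of (S, v) \<Rightarrow> c (insert v S) * (prod g S * g v)) = (case a of (S, v) \<Rightarrow> c S * prod g S)"
      using * S prod.remove[OF S *(3), of g] by (simp add: insert_absorb mult.commute)
    show "(case a of (S, v) \<Rightarrow> (S - {v}, v)) \<in> Sigma (?S k) (\<lambda>S. V - S)"
      using * S by auto
    show "(case case a of (S, v) \<Rightarrow> (S - {v}, v) of (S, v) \<Rightarrow> (insert v S, v)) = a"
      using * by auto
  next
    fix b assume b: "b \<in> Sigma (?S k) (\<lambda>S. V - S)"
    obtain S v where [simp]: "b = (S, v)" by (cases b)
    from b have *: "S \<subseteq> V" "card S = k" "v \<in> V" "v \<notin> S" by auto
    then have S: "finite S" using V finite_subset by auto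
    show "(case case b of (S, v) \<Rightarrow> (insert v S, v) of (S, v) \<Rightarrow> (S - {v}, v)) = b"
      using * by auto
    show "(case b of (S, v) \<Rightarrow> (insert v S, v)) \<in> Sigma (?S (Suc k)) (\<lambda>S. S)"
      using * S by auto
  qed
  also have "\<dots> = (\<Sum>S\<in>?S k. \<Sum>v\<in>V - S. c (insert v S) * (prod g S * g v))"
    using V by (intro sum.Sigma[symmetric] fin) auto
  also have "\<dots> \<le> (\<Sum>S\<in>?S k. \<Sum>v\<in>V. c S * prod g S * real (d u - k) * (d v * g v) / Q)"
  proof (rule sum_mono)
    fix S assume S: "S \<in> ?S k"
    then have gS: "prod g S \<ge> 0" using g by (intro prod_nonneg) auto
    have "(\<Sum>v\<in>V - S. c (insert v S) * (prod g S * g v))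
        \<le> (\<Sum>v\<in>V - S. c S * prod g S * real (d u - k) * (d v * g v) / Q)"
    proof (rule sum_mono)
      fix v assume v: "v \<in> V - S"
      have "Q * c (insert v S) \<le> real (d u - k) * d v * c S"
        using star_switching[OF V \<Delta> Q(1) u, of v S] v S unfolding c_def by auto
      then have "c (insert v S) \<le> real (d u - k) * d v * c S / Q"
        using Q(2) by (simp add: field_simps)
      then have "c (insert v S) * (prod g S * g v) \<le> (real (d u - k) * d v * c S / Q) * (prod g S * g v)"
        using gS g v by (intro mult_right_mono) auto
      then show "c (insert v S) * (prod g S * g v) \<le> c S * prod g S * real (d u - k) * (d v * g v) / Q"
        by (simp add: mult_ac)
    qed
    also have "\<dots> \<le> (\<Sum>v\<in>V. c S * prod g S * real (d u - k) * (d v * g v) / Q)"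
      using V g gS Q(2) by (intro sum_mono2) (auto simp: c_def)
    finally show "(\<Sum>v\<in>V - S. c (insert v S) * (prod g S * g v))
        \<le> (\<Sum>v\<in>V. c S * prod g S * real (d u - k) * (d v * g v) / Q)" .
  qed
  also have "\<dots> = real (d u - k) * ((\<Sum>y\<in>V. d y * g y) / Q) * W k"
    unfolding W_def c_def[symmetric] sum_divide_distrib sum_distrib_left sum_distrib_right
    by (intro sum.cong refl) (simp add: mult_ac)
  finally show ?thesis .
qed

text \<open>Expanding the product over subsets of the neighbourhood gives the sum of all
  \<open>W k\<close>. Iterating the recursion bounds \<open>W k\<close> by the k-th binomial term,
  so this generating function is dominated by that of d u independent choices with weights d y /
  Q.\<close>

lemma sum_prod_nbrs_le:
  fixes d :: "'a \<Rightarrow> nat" and g :: "'a \<Rightarrow> real" and Q :: real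
  assumes V: "finite V" and \<Delta>: "\<And>y. y \<in> V \<Longrightarrow> d y \<le> \<Delta>"
    and Q: "Q + 2 * real \<Delta> * (real \<Delta> + 1) \<le> (\<Sum>y\<in>V. real (d y))" "Q > 0"
    and u: "u \<in> V" and g: "\<And>y. y \<in> V \<Longrightarrow> g y \<ge> 0"
  shows "(\<Sum>G\<in>degree_graphs V d. \<Prod>y\<in>nbrs G u. 1 + g y)
    \<le> card (degree_graphs V d) * (1 + (\<Sum>y\<in>V. d y * g y) / Q) ^ d u"
proof -
  let ?G = "degree_graphs V d"
  define a where "a = (\<Sum>y\<in>V. d y * g y) / Q"
  define W where "W k = (\<Sum>S | S \<subseteq> V \<and> card S = k. real (card {G \<in> ?G. S \<subseteq> nbrs G u}) * prod g S)" for k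
  have finG: "finite ?G" by (rule finite_degree_graphs[OF V])
  have a0: "a \<ge> 0" unfolding a_def using g Q(2) by (intro divide_nonneg_pos sum_nonneg) auto
  have W: "W k \<le> card ?G * real (d u choose k) * a ^ k" for k
  proof (induction k)
    case 0
    have "{S. S \<subseteq> V \<and> card S = 0} = {{}}"
      using V by (auto dest: finite_subset)
    then show ?case by (simp add: W_def)
  next
    case (Suc k)
    have "real (Suc k) * W (Suc k) \<le> real (d u - k) * a * W k"
      using weighted_star_count_Suc_le[OF V \<Delta> Q u g, where k = k] by (simp add: W_def a_def)
    also have "\<dots> \<le> real (d u - k) * a * (card ?G * real (d u choose k) * a ^ k)"
      using Suc a0 by (intro mult_left_mono) auto
    also have "\<dots> = card ?G * real ((d u - k) * (d u choose k)) * a ^ Suc k" by simp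
    also have "(d u - k) * (d u choose k) = Suc k * (d u choose Suc k)"
      by (simp only: binomial_absorb_comp binomial_absorption)
    also have "card ?G * real (Suc k * (d u choose Suc k)) * a ^ Suc k
        = real (Suc k) * (card ?G * real (d u choose Suc k) * a ^ Suc k)" by (simp only: of_nat_mult mult_ac)
    finally show ?case by (subst (asm) mult_le_cancel_left_pos) auto
  qed
  have "(\<Sum>G\<in>?G. \<Prod>y\<in>nbrs G u. 1 + g y) = (\<Sum>G\<in>?G. \<Sum>S | S \<in> Pow V \<and> S \<subseteq> nbrs G u. prod g S)"
  proof (rule sum.cong[OF refl])
    fix G assume G: "G \<in> ?G"
    have "(\<Prod>y\<in>nbrs G u. 1 + g y) = (\<Prod>y\<in>nbrs G u. g y + 1)" by (simp add: add.commute)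
    also have "\<dots> = (\<Sum>S\<in>Pow (nbrs G u). prod g S)"
      by (subst prod_add) (auto intro: finite_nbrs[OF V degree_graphs_simple[OF G]])
    also have "Pow (nbrs G u) = {S. S \<in> Pow V \<and> S \<subseteq> nbrs G u}"
      using nbrs_subset[OF degree_graphs_simple[OF G], of u] by auto
    finally show "(\<Prod>y\<in>nbrs G u. 1 + g y) = (\<Sum>S | S \<in> Pow V \<and> S \<subseteq> nbrs G u. prod g S)" .
  qed
  also have "\<dots> = (\<Sum>S\<in>Pow V. \<Sum>G | G \<in> ?G \<and> S \<subseteq> nbrs G u. prod g S)"
    using V finG by (intro sum.swap_restrict) auto
  also have "\<dots> = (\<Sum>S\<in>Pow V. real (card {G \<in> ?G. S \<subseteq> nbrs G u}) * prod g S)"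
    by simp
  also have "\<dots> = (\<Sum>k\<in>{..card V}. \<Sum>S | S \<in> Pow V \<and> card S = k. real (card {G \<in> ?G. S \<subseteq> nbrs G u}) * prod g S)"
    using V card_mono[OF V] by (intro sum.group[symmetric]) auto
  also have "\<dots> = (\<Sum>k\<le>card V. W k)" by (simp add: W_def)
  also have "\<dots> \<le> (\<Sum>k\<le>card V. card ?G * real (d u choose k) * a ^ k)"
    by (intro sum_mono W)
  \<comment> \<open>The enlarged range covers both \<open>card V\<close> and \<open>d u\<close>,
    whichever is larger; terms with k > d u vanish with the binomial coefficient.\<close>
  also have "\<dots> \<le> (\<Sum>k\<le>card V + d u. card ?G * real (d u choose k) * a ^ k)"
    using a0 by (intro sum_mono2) auto
  also have "\<dots> = (\<Sum>k\<le>d u. card ?G * real (d u choose k) * a ^ k)"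
    by (intro sum.mono_neutral_right) auto
  also have "\<dots> = card ?G * (a + 1) ^ d u"
    by (simp add: binomial_ring sum_distrib_left mult_ac)
  finally show ?thesis by (simp add: a_def add.commute)
qed

section \<open>Removing an explored vertex together with its edges\<close>

definition del_vertex :: "'a set set \<Rightarrow> 'a \<Rightarrow> 'a set set" where
  "del_vertex E u = {e \<in> E. u \<notin> e}"

definition lower_degrees :: "('a \<Rightarrow> nat) \<Rightarrow> 'a set \<Rightarrow> 'a \<Rightarrow> nat" where
  "lower_degrees d S y = (if y \<in> S then d y - 1 else d y)"

definition star :: "'a \<Rightarrow> 'a set \<Rightarrow> 'a set set" where
  "star u S = (\<lambda>y. {u, y}) ` S"

lemma vertex_degree_split:
  assumes E: "finite E"
  shows "vertex_degree E i = vertex_degree (del_vertex E u) i + card {e \<in> E. u \<in> e \<and> i \<in> e}"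
proof -
  have "{e \<in> E. i \<in> e} = {e \<in> del_vertex E u. i \<in> e} \<union> {e \<in> E. u \<in> e \<and> i \<in> e}"
    by (auto simp: del_vertex_def)
  then show ?thesis unfolding vertex_degree_def
    by (simp only:) (subst card_Un_disjoint, use E in \<open>auto simp: del_vertex_def\<close>)
qed

lemma card_common_edges:
  assumes E: "E \<in> simple_graphs V" and i: "i \<noteq> u"
  shows "card {e \<in> E. u \<in> e \<and> i \<in> e} = of_bool (i \<in> nbrs E u)"
proof -
  have eq: "{e \<in> E. u \<in> e \<and> i \<in> e} = E \<inter> {{u, i}}"
  proof
    show "{e \<in> E. u \<in> e \<and> i \<in> e} \<subseteq> E \<inter> {{u, i}}"
    proof
      fix e assume "e \<in> {e \<in> E. u \<in> e \<and> i \<in> e}"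
      then have e: "e \<in> E" "u \<in> e" "i \<in> e" by auto
      obtain a b where "e = {a, b}" using simple_graphs_edgeE[OF E e(1)] by metis
      then show "e \<in> E \<inter> {{u, i}}" using e i by auto
    qed
  qed auto
  show ?thesis unfolding eq by (cases "{u, i} \<in> E") (simp_all add: nbrs_def)
qed

text \<open>A graph in which u has neighbourhood S is the graph on the other vertices plus the star
  at u. Nonemptiness certifies that S lies in V - {u}, has d u elements and only positive degrees,
  so that \<open>d y - 1\<close> is true subtraction.\<close>

lemma bij_betw_del_vertex:
  assumes V: "finite V" and u: "u \<in> V" and ne: "{G \<in> degree_graphs V d. nbrs G u = S} \<noteq> {}"
  shows "bij_betw (\<lambda>G. del_vertex G u) {G \<in> degree_graphs V d. nbrs G u = S}
    (degree_graphs (V - {u}) (lower_degrees d S))"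
proof (rule bij_betw_byWitness[where f' = "\<lambda>H. H \<union> star u S"])
  from ne obtain G0 where G0: "G0 \<in> degree_graphs V d" "nbrs G0 u = S" by auto
  note s0 = degree_graphs_simple[OF G0(1)]
  have S: "S \<subseteq> V - {u}" "finite S" "card S = d u"
    using nbrs_subset[OF s0, of u] finite_nbrs[OF V s0, of u] card_nbrs_degree[OF G0(1) u] G0(2) by simp_all
  have pos: "d y > 0" if "y \<in> S" for y
  proof -
    have "u \<in> nbrs G0 y" "y \<in> V" using that G0 nbrs_sym[of y G0 u] S by auto
    then show ?thesis
      using card_nbrs_degree[OF G0(1), of y] finite_nbrs[OF V degree_graphs_simple[OF G0(1)], of y]
      by (metis card_gt_0_iff empty_iff)
  qed
  have un: "u \<notin> e" if "H \<in> degree_graphs (V - {u}) (lower_degrees d S)" "e \<in> H" for H e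
    using that by (auto simp: degree_graphs_def simple_graphs_def)
  show "\<forall>G\<in>{G \<in> degree_graphs V d. nbrs G u = S}. del_vertex G u \<union> star u S = G"
  proof clarify
    fix G assume G: "G \<in> degree_graphs V d" "S = nbrs G u"
    show "del_vertex G u \<union> star u (nbrs G u) = G"
    proof
      show "G \<subseteq> del_vertex G u \<union> star u (nbrs G u)"
      proof
        fix e assume e: "e \<in> G"
        obtain a b where "e = {a, b}"
          using simple_graphs_edgeE[OF degree_graphs_simple[OF G(1)] e] by metis
        then show "e \<in> del_vertex G u \<union> star u (nbrs G u)"
          using e by (auto simp: del_vertex_def star_def nbrs_def insert_commute)
      qed
    qed (auto simp: del_vertex_def star_def nbrs_def)
  qed
  show "\<forall>H\<in>degree_graphs (V - {u}) (lower_degrees d S). del_vertex (H \<union> star u S) u = H"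
    using un by (auto simp: del_vertex_def star_def)
  show "(\<lambda>G. del_vertex G u) ` {G \<in> degree_graphs V d. nbrs G u = S}
      \<subseteq> degree_graphs (V - {u}) (lower_degrees d S)"
  proof clarify
    fix G assume G: "G \<in> degree_graphs V d" "S = nbrs G u"
    note s = degree_graphs_simple[OF G(1)]
    have "vertex_degree (del_vertex G u) i = lower_degrees d (nbrs G u) i" if "i \<in> V - {u}" for i
      using vertex_degree_split[OF finite_simple_graph[OF V s], of i u] card_common_edges[OF s, of i u] that G(1)
      by (auto simp: lower_degrees_def degree_graphs_def)
    moreover have "del_vertex G u \<in> simple_graphs (V - {u})"
      using s by (auto simp: simple_graphs_def del_vertex_def)
    ultimately show "del_vertex G u \<in> degree_graphs (V - {u}) (lower_degrees d (nbrs G u))"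
      by (simp add: degree_graphs_def)
  qed
  show "(\<lambda>H. H \<union> star u S) ` degree_graphs (V - {u}) (lower_degrees d S)
      \<subseteq> {G \<in> degree_graphs V d. nbrs G u = S}"
  proof clarify
    fix H assume H: "H \<in> degree_graphs (V - {u}) (lower_degrees d S)"
    let ?G = "H \<union> star u S"
    note s = degree_graphs_simple[OF H]
    have sG: "?G \<in> simple_graphs V"
      using s S u by (auto simp: simple_graphs_def star_def card_insert_if)
    have nb: "nbrs ?G u = S"
      using un[OF H] by (auto simp: nbrs_def star_def doubleton_eq_iff)
    have del: "del_vertex ?G u = H" using un[OF H] by (auto simp: del_vertex_def star_def)
    have "vertex_degree ?G i = d i" if i: "i \<in> V" for i
    proof (cases "i = u")
      case True then show ?thesis using card_nbrs[OF sG, of u] nb S by simp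
    next
      case False
      then show ?thesis
        using vertex_degree_split[OF finite_simple_graph[OF V sG], of i u] card_common_edges[OF sG, of i u]
          i H pos[of i] unfolding del nb
        by (auto simp: degree_graphs_def lower_degrees_def)
    qed
    then show "?G \<in> degree_graphs V d \<and> nbrs ?G u = S"
      using sG nb by (simp add: degree_graphs_def)
  qed
qed

text \<open>Revealing the neighbourhood of \<open>u\<close> leaves a uniformly random graph with the residual degrees.\<close>

lemma sum_reveal_le:
  fixes F :: "'a set \<Rightarrow> 'a set set \<Rightarrow> real" and \<phi> :: "'a set \<Rightarrow> real"
  assumes V: "finite V" and u: "u \<in> V"
    and le: "\<And>G S. G \<in> degree_graphs V d \<Longrightarrow> S = nbrs G u \<Longrightarrow>
      (\<Sum>H\<in>degree_graphs (V - {u}) (lower_degrees d S). F S H)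
        \<le> card (degree_graphs (V - {u}) (lower_degrees d S)) * \<phi> S"
  shows "(\<Sum>G\<in>degree_graphs V d. F (nbrs G u) (del_vertex G u)) \<le> (\<Sum>G\<in>degree_graphs V d. \<phi> (nbrs G u))"
proof -
  let ?G = "degree_graphs V d"
  have fin: "finite ?G" by (rule finite_degree_graphs[OF V])
  have img: "(\<lambda>G. nbrs G u) ` ?G \<subseteq> Pow V"
    using nbrs_subset[OF degree_graphs_simple] by fast
  have "(\<Sum>G\<in>?G. F (nbrs G u) (del_vertex G u)) =
      (\<Sum>S\<in>Pow V. \<Sum>G | G \<in> ?G \<and> nbrs G u = S. F (nbrs G u) (del_vertex G u))"
    using V by (intro sum.group[symmetric] fin img) auto
  also have "\<dots> \<le> (\<Sum>S\<in>Pow V. \<Sum>G | G \<in> ?G \<and> nbrs G u = S. \<phi> (nbrs G u))"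
  proof (rule sum_mono)
    fix S
    let ?C = "{G. G \<in> ?G \<and> nbrs G u = S}"
    show "(\<Sum>G\<in>?C. F (nbrs G u) (del_vertex G u)) \<le> (\<Sum>G\<in>?C. \<phi> (nbrs G u))"
    proof (cases "?C = {}")
      case False
      note bij = bij_betw_del_vertex[OF V u False]
      from False obtain G where G: "G \<in> ?G" "S = nbrs G u" by auto
      have "(\<Sum>G\<in>?C. F (nbrs G u) (del_vertex G u)) = (\<Sum>G\<in>?C. F S (del_vertex G u))" by simp
      also have "\<dots> = (\<Sum>H\<in>degree_graphs (V - {u}) (lower_degrees d S). F S H)"
        by (rule sum.reindex_bij_betw[OF bij])
      also have "\<dots> \<le> card (degree_graphs (V - {u}) (lower_degrees d S)) * \<phi> S" by (rule le[OF G])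
      also have "\<dots> = (\<Sum>G\<in>?C. \<phi> (nbrs G u))" using bij_betw_same_card[OF bij] by simp
      finally show ?thesis .
    next
      case True
      then show ?thesis by (simp only: sum.empty order.refl)
    qed
  qed
  also have "\<dots> = (\<Sum>G\<in>?G. \<phi> (nbrs G u))"
    using V by (intro sum.group fin img) auto
  finally show ?thesis .
qed

section \<open>Components as sets reached from the active vertices\<close>

definition reach :: "'a set set \<Rightarrow> 'a set \<Rightarrow> 'a set" where
  "reach E A = {w. \<exists>a\<in>A. (a, w) \<in> (adjacency E)\<^sup>*}"

lemma subset_reach: "A \<subseteq> reach E A"
  by (auto simp: reach_def)

lemma reach_empty [simp]: "reach E {} = {}"
  by (simp add: reach_def)

lemma reach_subset:
  assumes "E \<in> simple_graphs V" "A \<subseteq> V"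
  shows "reach E A \<subseteq> V"
proof
  fix w assume "w \<in> reach E A"
  then obtain a where a: "a \<in> A" "(a, w) \<in> (adjacency E)\<^sup>*" by (auto simp: reach_def)
  from a(2) show "w \<in> V"
    by (cases rule: rtranclE) (use a(1) assms in \<open>auto simp: adjacency_def dest: simple_graphs_edgeD\<close>)
qed

text \<open>Cut a walk at its last visit to u: what follows avoids u and starts at a neighbour of u,
  while a walk that never visits u survives the deletion. That u is not reached again makes the
  count grow by exactly one.\<close>

lemma reach_step:
  assumes E: "E \<in> simple_graphs V" and u: "u \<in> A"
  shows "reach E A = insert u (reach (del_vertex E u) (A - {u} \<union> nbrs E u))"
    and "u \<notin> reach (del_vertex E u) (A - {u} \<union> nbrs E u)"
proof -
  let ?A = "A - {u} \<union> nbrs E u" and ?E = "del_vertex E u"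
  have sub: "(adjacency ?E)\<^sup>* \<subseteq> (adjacency E)\<^sup>*"
    by (rule rtrancl_mono) (auto simp: adjacency_def del_vertex_def)
  have "insert u (reach ?E ?A) \<subseteq> reach E A"
  proof
    fix w assume "w \<in> insert u (reach ?E ?A)"
    then consider "w = u" | a where "a \<in> ?A" "(a, w) \<in> (adjacency E)\<^sup>*"
      using sub by (auto simp: reach_def)
    then show "w \<in> reach E A"
    proof cases
      case 2
      show ?thesis
      proof (cases "a \<in> A")
        case False
        then have "(u, a) \<in> adjacency E" using 2 by (auto simp: nbrs_def adjacency_def)
        then show ?thesis using 2(2) u by (auto simp: reach_def intro: converse_rtrancl_into_rtrancl)
      qed (use 2 in \<open>auto simp: reach_def\<close>)
    qed (use u in \<open>auto simp: reach_def\<close>)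
  qed
  moreover have "w \<in> insert u (reach ?E ?A)" if "(a, w) \<in> (adjacency E)\<^sup>*" "a \<in> A" for a w
    using that(1)
  proof (induction rule: rtrancl_induct)
    case base
    then show ?case using that(2) by (auto simp: reach_def)
  next
    case (step y z)
    show ?case
    proof (cases "y = u \<or> z = u")
      case True
      then show ?thesis using step(2) by (auto simp: reach_def adjacency_def nbrs_def)
    next
      case False
      then have "(y, z) \<in> adjacency ?E" using step(2) by (auto simp: adjacency_def del_vertex_def)
      then show ?thesis using step(3) False by (auto simp: reach_def intro: rtrancl_into_rtrancl)
    qed
  qed
  ultimately show "reach E A = insert u (reach ?E ?A)" by (auto simp: reach_def)
  show "u \<notin> reach ?E ?A"
  proof
    assume "u \<in> reach ?E ?A"
    then obtain a where a: "a \<in> ?A" "(a, u) \<in> (adjacency ?E)\<^sup>*" by (auto simp: reach_def)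
    have "a \<noteq> u" using a(1) nbrs_subset[OF E, of u] by auto
    with a(2) show False
      by (cases rule: rtranclE) (auto simp: adjacency_def del_vertex_def)
  qed
qed

lemma card_reach_step:
  assumes V: "finite V" and E: "E \<in> simple_graphs V" and u: "u \<in> A" and A: "A \<subseteq> V"
  shows "card (reach E A) = Suc (card (reach (del_vertex E u) (A - {u} \<union> nbrs E u)))"
proof -
  note r = reach_step[OF E u]
  have "finite (reach (del_vertex E u) (A - {u} \<union> nbrs E u))"
    using finite_subset[OF reach_subset[OF E A] V] r(1) by simp
  then show ?thesis using r by simp
qed

section \<open>Exponential moments\<close>

lemma degree_pos_of_nbr:
  assumes V: "finite V" and G: "G \<in> degree_graphs V d" and y: "y \<in> nbrs G u"
  shows "d y > 0"
proof -
  note s = degree_graphs_simple[OF G]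
  have "u \<in> nbrs G y" "y \<in> V" using y nbrs_sym[of y G u] nbrs_subset[OF s, of u] by auto
  then have "card (nbrs G y) > 0" using finite_nbrs[OF V s, of y] by (auto simp: card_gt_0_iff)
  then show ?thesis using card_nbrs_degree[OF G \<open>y \<in> V\<close>] by simp
qed

lemma sum_lower_degrees:
  assumes V: "finite V" and G: "G \<in> degree_graphs V d" and u: "u \<in> V"
  shows "(\<Sum>y\<in>V - {u}. real (lower_degrees d (nbrs G u) y)) = (\<Sum>y\<in>V. real (d y)) - 2 * real (d u)"
proof -
  let ?N = "nbrs G u"
  note s = degree_graphs_simple[OF G]
  have "(\<Sum>y\<in>V - {u}. real (lower_degrees d ?N y)) = (\<Sum>y\<in>V - {u}. real (d y) - of_bool (y \<in> ?N))"
  proof (rule sum.cong[OF refl])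
    fix y
    show "real (lower_degrees d ?N y) = real (d y) - of_bool (y \<in> ?N)"
      using degree_pos_of_nbr[OF V G, of y u] by (cases "y \<in> ?N") (simp_all add: lower_degrees_def of_nat_diff)
  qed
  also have "\<dots> = (\<Sum>y\<in>V - {u}. real (d y)) - (\<Sum>y\<in>V - {u}. of_bool (y \<in> ?N))"
    by (rule sum_subtractf)
  also have "(\<Sum>y\<in>V - {u}. of_bool (y \<in> ?N) :: real) = real (card ((V - {u}) \<inter> ?N))"
    using V by (simp add: of_bool_def sum.If_cases Int_def)
  also have "(V - {u}) \<inter> ?N = ?N" using nbrs_subset[OF s, of u] by auto
  also have "(\<Sum>y\<in>V - {u}. real (d y)) = (\<Sum>y\<in>V. real (d y)) - real (d u)"
    using sum.remove[OF V u, of "\<lambda>y. real (d y)"] by linarith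
  finally show ?thesis using card_nbrs_degree[OF G u] by simp
qed

definition exp_weight :: "real \<Rightarrow> real \<Rightarrow> 'a set \<Rightarrow> ('a \<Rightarrow> nat) \<Rightarrow> 'a \<Rightarrow> real" where
  "exp_weight s \<eta> B d a = (if a \<in> B then 0 else exp s * (1 + \<eta>) ^ d a)"

lemma exp_weight_nonneg: "\<eta> \<ge> 0 \<Longrightarrow> exp_weight s \<eta> B d a \<ge> 0"
  by (simp add: exp_weight_def)

lemma prod_exp_weight_empty:
  "finite A \<Longrightarrow> (\<Prod>a\<in>A. exp_weight s \<eta> {} d a) = exp (s * card A) * (1 + \<eta>) ^ (\<Sum>a\<in>A. d a)"
  by (simp add: exp_weight_def prod.distrib power_sum exp_of_nat2_mult)

text \<open>For a newcomer outside B, 1 + g y is exactly its weight after losing the half-edge to u;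
  in B the weight is 0 \<le> 1. A neighbour that was already active only loses a half-edge, so its
  old weight is an upper bound, and the surplus factor 1 + g y \<ge> 1 does no harm.\<close>

lemma prod_exp_weight_step:
  fixes \<eta> s :: real and d :: "'a \<Rightarrow> nat" and B :: "'a set"
  assumes V: "finite V" and A: "A \<subseteq> V" and \<eta>: "\<eta> \<ge> 0" and s: "s \<ge> 0" and N: "finite N"
  defines "g \<equiv> \<lambda>y. if y \<in> B then 0 else exp s * (1 + \<eta>) ^ (d y - 1) - 1"
  shows "(\<Prod>a\<in>A - {u} \<union> N. exp_weight s \<eta> B (lower_degrees d N) a)
    \<le> (\<Prod>a\<in>A - {u}. exp_weight s \<eta> B d a) * (\<Prod>y\<in>N. 1 + g y)"
proof -
  have fin: "finite (A - {u})" using A V finite_subset by auto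
  have g0: "g y \<ge> 0" for y
    using mult_mono[of 1 "exp s" 1 "(1 + \<eta>) ^ (d y - 1)"] s \<eta> by (simp add: g_def)
  have "(\<Prod>a\<in>A - {u} \<union> N. exp_weight s \<eta> B (lower_degrees d N) a)
    = (\<Prod>a\<in>A - {u}. exp_weight s \<eta> B (lower_degrees d N) a)
      * (\<Prod>a\<in>N - (A - {u}). exp_weight s \<eta> B (lower_degrees d N) a)"
    using fin N by (subst prod.union_disjoint[symmetric]) (auto intro: prod.cong)
  also have "\<dots> \<le> (\<Prod>a\<in>A - {u}. exp_weight s \<eta> B d a) * (\<Prod>y\<in>N - (A - {u}). 1 + g y)"
  proof (intro mult_mono prod_mono conjI prod_nonneg exp_weight_nonneg \<eta>)
    fix a
    show "exp_weight s \<eta> B (lower_degrees d N) a \<le> exp_weight s \<eta> B d a"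
      using \<eta> by (auto simp: exp_weight_def lower_degrees_def intro!: power_increasing)
  next
    fix a assume "a \<in> N - (A - {u})"
    then show "exp_weight s \<eta> B (lower_degrees d N) a \<le> 1 + g a"
      by (simp add: exp_weight_def g_def lower_degrees_def)
  qed
  also have "\<dots> \<le> (\<Prod>a\<in>A - {u}. exp_weight s \<eta> B d a) * (\<Prod>y\<in>N. 1 + g y)"
    using N g0 by (intro mult_left_mono prod_mono2 prod_nonneg exp_weight_nonneg[OF \<eta>]) auto
  finally show ?thesis .
qed

text \<open>One supermartingale step. The generating function of the neighbourhood contributes at
  most (1 + \<eta>) ^ d u, and together with the factor exp s for counting u this is exactly the
  weight of u that leaves the product. The drift condition refers to the original D on V0; as
  degrees and vertex set only shrink, it serves at every stage.\<close>

lemma sum_exp_weight_reveal_le: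
  fixes D d :: "'a \<Rightarrow> nat" and s \<eta> Q :: real
  assumes V0: "finite V0" and \<Delta>: "\<And>y. y \<in> V0 \<Longrightarrow> D y \<le> \<Delta>" and s: "s \<ge> 0" and \<eta>: "\<eta> \<ge> 0" and Q: "Q > 0"
    and drift: "(\<Sum>y\<in>V0 - B. real (D y) * (exp s * (1 + \<eta>) ^ (D y - 1) - 1)) \<le> \<eta> * Q"
    and V: "V \<subseteq> V0" and d: "\<And>y. y \<in> V \<Longrightarrow> d y \<le> D y" and A: "A \<subseteq> V"
    and M: "Q + 2 * real \<Delta> * (real \<Delta> + 1) \<le> (\<Sum>y\<in>V. real (d y))"
    and u: "u \<in> A" "u \<notin> B"
  shows "(\<Sum>G\<in>degree_graphs V d. exp s *
      (\<Prod>a\<in>A - {u} \<union> nbrs G u. exp_weight s \<eta> B (lower_degrees d (nbrs G u)) a))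
    \<le> card (degree_graphs V d) * (\<Prod>a\<in>A. exp_weight s \<eta> B d a)"
proof -
  let ?G = "degree_graphs V d"
  define g where "g = (\<lambda>y. if y \<in> B then 0 else exp s * (1 + \<eta>) ^ (d y - 1) - 1)"
  let ?w = "\<Prod>a\<in>A - {u}. exp_weight s \<eta> B d a"
  have finV: "finite V" using V V0 finite_subset by blast
  have finA: "finite A" using A finV finite_subset by blast
  have ge1: "exp s * (1 + \<eta>) ^ k \<ge> 1" for k
    using mult_mono[of 1 "exp s" 1 "(1 + \<eta>) ^ k"] s \<eta> by simp
  have g0: "g y \<ge> 0" for y using ge1 by (simp add: g_def)
  have w0: "?w \<ge> 0" by (intro prod_nonneg) (simp add: exp_weight_nonneg[OF \<eta>])
  have d\<Delta>: "d y \<le> \<Delta>" if "y \<in> V" for y using d[OF that] \<Delta>[of y] that V by fastforce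
  have "(\<Sum>y\<in>V. d y * g y) \<le> (\<Sum>y\<in>V0. if y \<in> B then 0 else real (D y) * (exp s * (1 + \<eta>) ^ (D y - 1) - 1))"
  proof (rule order_trans[OF sum_mono sum_mono2[OF V0 V]])
    fix y assume y: "y \<in> V"
    have "real (d y) * (exp s * (1 + \<eta>) ^ (d y - 1) - 1) \<le> real (D y) * (exp s * (1 + \<eta>) ^ (D y - 1) - 1)"
      using d[OF y] \<eta> s ge1[of "d y - 1"]
      by (intro mult_mono diff_mono mult_left_mono power_increasing) auto
    then show "d y * g y \<le> (if y \<in> B then 0 else real (D y) * (exp s * (1 + \<eta>) ^ (D y - 1) - 1))"
      by (simp add: g_def)
  next
    fix y
    show "0 \<le> (if y \<in> B then 0 else real (D y) * (exp s * (1 + \<eta>) ^ (D y - 1) - 1))"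
      using ge1[of "D y - 1"] by simp
  qed
  also have "\<dots> = (\<Sum>y\<in>V0 - B. real (D y) * (exp s * (1 + \<eta>) ^ (D y - 1) - 1))"
    using V0 by (simp add: sum.If_cases Diff_eq Collect_neg_eq[symmetric])
  also note drift
  finally have a: "(\<Sum>y\<in>V. d y * g y) / Q \<le> \<eta>" using Q by (simp add: field_simps)
  have a0: "(\<Sum>y\<in>V. d y * g y) / Q \<ge> 0" using Q g0 by (intro divide_nonneg_pos sum_nonneg) auto
  have "(\<Sum>G\<in>?G. exp s * (\<Prod>a\<in>A - {u} \<union> nbrs G u. exp_weight s \<eta> B (lower_degrees d (nbrs G u)) a))
      \<le> (\<Sum>G\<in>?G. exp s * (?w * (\<Prod>y\<in>nbrs G u. 1 + g y)))"
    unfolding g_def using finite_nbrs[OF finV degree_graphs_simple]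
    by (intro sum_mono mult_left_mono prod_exp_weight_step[OF finV A \<eta> s]) auto
  also have "\<dots> = exp s * ?w * (\<Sum>G\<in>?G. \<Prod>y\<in>nbrs G u. 1 + g y)"
    by (simp add: sum_distrib_left mult.assoc)
  also have "\<dots> \<le> exp s * ?w * (card ?G * (1 + (\<Sum>y\<in>V. d y * g y) / Q) ^ d u)"
    using w0 u A by (intro mult_left_mono sum_prod_nbrs_le[OF finV d\<Delta> M Q] g0) auto
  also have "\<dots> \<le> exp s * ?w * (card ?G * (1 + \<eta>) ^ d u)"
    using w0 a a0 by (intro mult_left_mono power_mono) auto
  also have "\<dots> = card ?G * (\<Prod>a\<in>A. exp_weight s \<eta> B d a)"
    using u by (subst prod.remove[OF finA u(1)]) (simp add: exp_weight_def)
  finally show ?thesis .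
qed

text \<open>
  Truncating at \<open>T\<close> vertices keeps the number of half-edges of every residual graph above \<open>Q\<close>
  throughout the exploration.
\<close>

lemma exp_reach_le:
  fixes D d :: "'a \<Rightarrow> nat" and s \<eta> Q :: real
  assumes V0: "finite V0" and \<Delta>: "\<And>y. y \<in> V0 \<Longrightarrow> D y \<le> \<Delta>" and s: "s \<ge> 0" and \<eta>: "\<eta> \<ge> 0" and Q: "Q > 0"
    and drift: "(\<Sum>y\<in>V0 - B. real (D y) * (exp s * (1 + \<eta>) ^ (D y - 1) - 1)) \<le> \<eta> * Q"
    and "V \<subseteq> V0" and "\<And>y. y \<in> V \<Longrightarrow> d y \<le> D y" and "A \<subseteq> V"
    and "Q + 2 * real \<Delta> * (real \<Delta> + 1) + 2 * real \<Delta> * real T \<le> (\<Sum>y\<in>V. real (d y))"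
  shows "(\<Sum>G\<in>degree_graphs V d. of_bool (reach G A \<inter> B = {}) * exp (s * min (card (reach G A)) T))
    \<le> card (degree_graphs V d) * (\<Prod>a\<in>A. exp_weight s \<eta> B d a)"
  using assms(7-)
proof (induction T arbitrary: V d A)
  case (0 V d A)
  have finA: "finite A" by (rule finite_subset[OF 0(3) finite_subset[OF 0(1) V0]])
  have "of_bool (reach G A \<inter> B = {}) \<le> (\<Prod>a\<in>A. exp_weight s \<eta> B d a)" for G
  proof (cases "A \<inter> B = {}")
    case True
    have "1 \<le> exp_weight s \<eta> B d a" if "a \<in> A" for a
      using mult_mono[of 1 "exp s" 1 "(1 + \<eta>) ^ d a"] s \<eta> True that by (auto simp: exp_weight_def)
    then have "1 \<le> (\<Prod>a\<in>A. exp_weight s \<eta> B d a)" by (intro prod_ge_1)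
    then show ?thesis by (auto simp: of_bool_def)
  next
    case False
    then have "reach G A \<inter> B \<noteq> {}" using subset_reach[of A G] by auto
    moreover have "0 \<le> (\<Prod>a\<in>A. exp_weight s \<eta> B d a)"
      by (intro prod_nonneg ballI exp_weight_nonneg[OF \<eta>])
    ultimately show ?thesis by simp
  qed
  then have "(\<Sum>G\<in>degree_graphs V d. of_bool (reach G A \<inter> B = {}))
      \<le> card (degree_graphs V d) * (\<Prod>a\<in>A. exp_weight s \<eta> B d a)"
    by (rule sum_bounded_above)
  then show ?case by simp
next
  case (Suc T V d A)
  let ?G = "degree_graphs V d"
  have finV: "finite V" by (rule finite_subset[OF Suc.prems(1) V0])
  have p0: "0 \<le> card ?G * (\<Prod>a\<in>A. exp_weight s \<eta> B d a)"
    by (intro mult_nonneg_nonneg prod_nonneg) (auto simp: exp_weight_nonneg[OF \<eta>])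
  consider "A = {}" | u where "u \<in> A" "u \<in> B" | u where "u \<in> A" "u \<notin> B" by auto
  then show ?case
  proof cases
    case 1 then show ?thesis by simp
  next
    case 2
    then have "reach G A \<inter> B \<noteq> {}" for G using subset_reach[of A G] by auto
    then show ?thesis using p0 by simp
  next
    case (3 u)
    have uV: "u \<in> V" using 3 Suc.prems(3) by auto
    have du: "d u \<le> \<Delta>" using Suc.prems(2)[OF uV] \<Delta>[of u] Suc.prems(1) uV by fastforce
    have M: "Q + 2 * real \<Delta> * (real \<Delta> + 1) \<le> (\<Sum>y\<in>V. real (d y))"
      using Suc.prems(4) mult_nonneg_nonneg[of "real \<Delta>" "real (Suc T)"] by linarith
    define F where "F S H = exp s * (of_bool (reach H (A - {u} \<union> S) \<inter> B = {})
        * exp (s * min (card (reach H (A - {u} \<union> S))) T))" for S H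
    have "(\<Sum>G\<in>?G. of_bool (reach G A \<inter> B = {}) * exp (s * min (card (reach G A)) (Suc T)))
       = (\<Sum>G\<in>?G. F (nbrs G u) (del_vertex G u))"
    proof (rule sum.cong[OF refl])
      fix G assume "G \<in> ?G"
      note sG = degree_graphs_simple[OF this]
      have "reach G A \<inter> B = {} \<longleftrightarrow> reach (del_vertex G u) (A - {u} \<union> nbrs G u) \<inter> B = {}"
        using reach_step(1)[OF sG 3(1)] 3(2) by auto
      moreover have "real (min (card (reach G A)) (Suc T))
          = 1 + real (min (card (reach (del_vertex G u) (A - {u} \<union> nbrs G u))) T)"
        using card_reach_step[OF finV sG 3(1) Suc.prems(3)] by simp
      ultimately show "of_bool (reach G A \<inter> B = {}) * exp (s * min (card (reach G A)) (Suc T))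
          = F (nbrs G u) (del_vertex G u)"
        by (simp only: F_def distrib_left mult_1_right mult_1_left exp_add mult_ac)
    qed
    also have "\<dots> \<le> (\<Sum>G\<in>?G. exp s * (\<Prod>a\<in>A - {u} \<union> nbrs G u. exp_weight s \<eta> B (lower_degrees d (nbrs G u)) a))"
    proof (rule sum_reveal_le[OF finV uV])
      fix G S assume G: "G \<in> ?G" and S: "S = nbrs G u"
      have "S \<subseteq> V - {u}" using nbrs_subset[OF degree_graphs_simple[OF G]] S by simp
      then have "A - {u} \<union> S \<subseteq> V - {u}" using Suc.prems(3) by auto
      moreover have "lower_degrees d S y \<le> D y" if "y \<in> V - {u}" for y
        using Suc.prems(2)[of y] that by (auto simp: lower_degrees_def)
      \<comment> \<open>Deleting u removes 2 * d u \<le> 2 * \<Delta> half-edges, paid for by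
        lowering T by one.\<close>
      moreover have "Q + 2 * real \<Delta> * (real \<Delta> + 1) + 2 * real \<Delta> * real T
          \<le> (\<Sum>y\<in>V - {u}. real (lower_degrees d S y))"
        unfolding S sum_lower_degrees[OF finV G uV] using Suc.prems(4) du by (simp add: algebra_simps)
      ultimately have "(\<Sum>H\<in>degree_graphs (V - {u}) (lower_degrees d S).
            of_bool (reach H (A - {u} \<union> S) \<inter> B = {}) * exp (s * min (card (reach H (A - {u} \<union> S))) T))
          \<le> card (degree_graphs (V - {u}) (lower_degrees d S))
            * (\<Prod>a\<in>A - {u} \<union> S. exp_weight s \<eta> B (lower_degrees d S) a)"
        using Suc.prems(1) by (intro Suc.IH) auto
      then have "exp s * (\<Sum>H\<in>degree_graphs (V - {u}) (lower_degrees d S).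
            of_bool (reach H (A - {u} \<union> S) \<inter> B = {}) * exp (s * min (card (reach H (A - {u} \<union> S))) T))
          \<le> exp s * (card (degree_graphs (V - {u}) (lower_degrees d S))
            * (\<Prod>a\<in>A - {u} \<union> S. exp_weight s \<eta> B (lower_degrees d S) a))"
        by (rule mult_left_mono) simp
      then show "(\<Sum>H\<in>degree_graphs (V - {u}) (lower_degrees d S). F S H)
          \<le> card (degree_graphs (V - {u}) (lower_degrees d S))
            * (exp s * (\<Prod>a\<in>A - {u} \<union> S. exp_weight s \<eta> B (lower_degrees d S) a))"
        by (simp only: F_def sum_distrib_left mult_ac)
    qed
    also have "\<dots> \<le> card ?G * (\<Prod>a\<in>A. exp_weight s \<eta> B d a)"
      using Suc.prems(1-3) 3 M
      by (intro sum_exp_weight_reveal_le[OF V0 \<Delta> s \<eta> Q drift]) auto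
    finally show ?thesis .
  qed
qed

section \<open>First moments\<close>

lemma sum_nbrs_eq:
  fixes f :: "'a \<Rightarrow> real"
  assumes V: "finite V" and X: "X \<subseteq> V"
  shows "(\<Sum>G\<in>degree_graphs V d. \<Sum>y\<in>nbrs G u \<inter> X. f y)
    = (\<Sum>y\<in>X. real (card {G \<in> degree_graphs V d. y \<in> nbrs G u}) * f y)"
proof -
  have finX: "finite X" using X V finite_subset by blast
  have eq: "nbrs G u \<inter> X = {y. y \<in> X \<and> y \<in> nbrs G u}" for G by auto
  show ?thesis
    unfolding eq by (subst sum.swap_restrict[OF finite_degree_graphs[OF V] finX]) simp
qed

text \<open>The cut-off D y \<le> K makes d * (d - 1) Lipschitz: each half-edge lost since the start
  costs at most 2 * K, and leaving out an active vertex costs at most K for each of its half-edges.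
  Without the cut-off the estimate would carry the maximal degree in place of K.\<close>

lemma sum_degree_weight_diff_le:
  fixes D d :: "'a \<Rightarrow> nat"
  assumes V0: "finite V0" and V: "V \<subseteq> V0" and d: "\<And>y. y \<in> V \<Longrightarrow> d y \<le> D y" and A: "A \<subseteq> V"
  shows "(\<Sum>y | y \<in> V0 \<and> D y \<le> K. real (D y) * (real (D y) - 1))
      - 2 * real K * ((\<Sum>y\<in>V0. real (D y)) - (\<Sum>y\<in>V. real (d y))) - real K * (\<Sum>y\<in>A. real (d y))
    \<le> (\<Sum>y | y \<in> V - A \<and> D y \<le> K. real (d y) * (real (d y) - 1))"
proof -
  have finV: "finite V" using V V0 finite_subset by blast
  define d0 where "d0 y = (if y \<in> V then real (d y) else 0)" for y
  define dA where "dA y = (if y \<in> A then real (d y) else 0)" for y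
  define L where "L y = (if D y \<le> K then real (D y) * (real (D y) - 1) else 0)
      - 2 * real K * (real (D y) - d0 y) - real K * dA y" for y
  have "L y \<le> (if y \<in> V - A \<and> D y \<le> K then real (d y) * (real (d y) - 1) else 0)" if y: "y \<in> V0" for y
  proof -
    have d0: "0 \<le> d0 y" "d0 y \<le> real (D y)" using d[of y] by (auto simp: d0_def)
    have KdA: "0 \<le> real K * dA y" by (simp add: dA_def)
    have K0: "0 \<le> 2 * real K * (real (D y) - d0 y)" using d0 by simp
    show ?thesis
    proof (cases "D y \<le> K")
      case False then show ?thesis using KdA K0 by (simp add: L_def)
    next
      case True
      \<comment> \<open>D * (D - 1) - d0 * (d0 - 1) factors as (D - d0) * (D + d0 - 1), also when
        the vertex is gone and d0 = 0.\<close>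
      have "(real (D y) - d0 y) * (real (D y) + d0 y - 1) \<le> (real (D y) - d0 y) * (2 * real K)"
        using d0 True by (intro mult_left_mono) auto
      then have *: "real (D y) * (real (D y) - 1) - 2 * real K * (real (D y) - d0 y) \<le> d0 y * (d0 y - 1)"
        by (simp add: algebra_simps)
      show ?thesis
      proof (cases "y \<in> A")
        case yA: True
        have yV: "y \<in> V" using yA A by auto
        have "d0 y * (d0 y - 1) \<le> d0 y * real K" using d0 True by (intro mult_left_mono) auto
        then show ?thesis using * True yA yV by (simp add: L_def dA_def d0_def mult.commute)
      next
        case yA: False
        show ?thesis
        proof (cases "y \<in> V")
          case True then show ?thesis using * yA \<open>D y \<le> K\<close> by (simp add: L_def dA_def d0_def)
        next
          case False then show ?thesis using * yA \<open>D y \<le> K\<close> by (simp add: L_def dA_def d0_def)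
        qed
      qed
    qed
  qed
  then have "(\<Sum>y\<in>V0. L y) \<le> (\<Sum>y\<in>V0. if y \<in> V - A \<and> D y \<le> K then real (d y) * (real (d y) - 1) else 0)"
    by (rule sum_mono)
  also have "\<dots> = (\<Sum>y | y \<in> V0 \<and> (y \<in> V - A \<and> D y \<le> K). real (d y) * (real (d y) - 1))"
    by (rule sum.inter_filter[symmetric, OF V0])
  also have "{y. y \<in> V0 \<and> (y \<in> V - A \<and> D y \<le> K)} = {y. y \<in> V - A \<and> D y \<le> K}" using V by auto
  also have "(\<Sum>y\<in>V0. L y) = (\<Sum>y\<in>V0. if D y \<le> K then real (D y) * (real (D y) - 1) else 0)
      - 2 * real K * ((\<Sum>y\<in>V0. real (D y)) - (\<Sum>y\<in>V0. d0 y)) - real K * (\<Sum>y\<in>V0. dA y)"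
    by (simp add: L_def sum_subtractf sum_distrib_left[symmetric])
  also have "(\<Sum>y\<in>V0. if D y \<le> K then real (D y) * (real (D y) - 1) else 0)
      = (\<Sum>y | y \<in> V0 \<and> D y \<le> K. real (D y) * (real (D y) - 1))"
    by (rule sum.inter_filter[symmetric, OF V0])
  also have "(\<Sum>y\<in>V0. d0 y) = (\<Sum>y\<in>V. real (d y))"
    unfolding d0_def using V V0 by (subst sum.inter_filter[symmetric, OF V0]) (intro sum.cong, auto)
  also have "(\<Sum>y\<in>V0. dA y) = (\<Sum>y\<in>A. real (d y))"
    unfolding dA_def using V A V0 by (subst sum.inter_filter[symmetric, OF V0]) (intro sum.cong, auto)
  finally show ?thesis .
qed

text \<open>
  The deficits \<open>d u * d y / Q - P(y \<in> nbrs G u)\<close> are nonnegative and add up to a small multiple of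
  \<open>d u\<close>, because the neighbourhood of \<open>u\<close> has exactly \<open>d u\<close> elements; this gives lower bounds
  without a second switching argument.
\<close>

lemma drift_nonneg:
  fixes D d :: "'a \<Rightarrow> nat" and h Q R :: real
  assumes V0: "finite V0" and \<Delta>: "\<And>y. y \<in> V0 \<Longrightarrow> D y \<le> \<Delta>" and Q: "Q > 0" and h: "h \<ge> 0"
    and drift: "(h - 1) * Q + (1 + h) * R \<le> h * ((\<Sum>y | y \<in> V0 \<and> D y \<le> K. real (D y) * (real (D y) - 1))
        - 3 * real K * ((\<Sum>y\<in>V0. real (D y)) - Q) - real K * R)"
    and V: "V \<subseteq> V0" and d: "\<And>y. y \<in> V \<Longrightarrow> d y \<le> D y" and A: "A \<subseteq> V"
    and M: "Q + 2 * real \<Delta> * (real \<Delta> + 1) \<le> (\<Sum>y\<in>V. real (d y))"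
    and R: "(\<Sum>y\<in>A. real (d y)) \<le> R" and u: "u \<in> V"
  shows "0 \<le> (\<Sum>G\<in>degree_graphs V d. (1 - h) * d u - (1 + h) * card (nbrs G u \<inter> A)
    + h * (\<Sum>y\<in>nbrs G u - A. real (d y) - 1))"
proof -
  let ?G = "degree_graphs V d"
  define p where "p y = real (card {G \<in> ?G. y \<in> nbrs G u})" for y
  define q where "q = real (card ?G) * real (d u) / Q"
  have finV: "finite V" using V V0 finite_subset by blast
  have finA: "finite A" using A finV finite_subset by blast
  have finG: "finite ?G" by (rule finite_degree_graphs[OF finV])
  have d\<Delta>: "d y \<le> \<Delta>" if "y \<in> V" for y using d[OF that] \<Delta>[of y] that V by fastforce
  have q0: "q \<ge> 0" using Q by (simp add: q_def)
  have qQ: "q * Q = card ?G * d u" using Q by (simp add: q_def)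
  have p_le: "p y \<le> q * d y" if "y \<in> V" for y
  proof -
    have "Q * p y \<le> real (d u) * real (d y) * real (card ?G)"
      using star_switching[OF finV d\<Delta> M u that, of "{}"] by (simp add: p_def)
    then show ?thesis using Q by (simp add: q_def field_simps)
  qed
  have M_le: "(\<Sum>y\<in>V. real (d y)) \<le> (\<Sum>y\<in>V0. real (D y))"
    using d by (intro order_trans[OF sum_mono sum_mono2[OF V0 V]]) auto
  have QM: "Q \<le> (\<Sum>y\<in>V. real (d y))"
  proof -
    have "0 \<le> 2 * real \<Delta> * (real \<Delta> + 1)" by simp
    then show ?thesis using M by linarith
  qed
  have sum_p: "(\<Sum>y\<in>V. p y) = card ?G * d u"
  proof -
    have "(\<Sum>y\<in>V. p y) = (\<Sum>G\<in>?G. \<Sum>y\<in>nbrs G u \<inter> V. 1 :: real)"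
      using sum_nbrs_eq[OF finV order.refl, where d = d and u = u and f = "\<lambda>_. 1"] by (simp add: p_def)
    also have "\<dots> = (\<Sum>G\<in>?G. real (d u))"
    proof (rule sum.cong[OF refl])
      fix G assume G: "G \<in> ?G"
      have "nbrs G u \<inter> V = nbrs G u" using nbrs_subset[OF degree_graphs_simple[OF G], of u] by auto
      then show "(\<Sum>y\<in>nbrs G u \<inter> V. 1 :: real) = real (d u)" using card_nbrs_degree[OF G u] by simp
    qed
    finally show ?thesis by simp
  qed
  have coll: "(\<Sum>G\<in>?G. real (card (nbrs G u \<inter> A))) \<le> q * R"
  proof -
    have "(\<Sum>G\<in>?G. real (card (nbrs G u \<inter> A))) = (\<Sum>y\<in>A. p y)"
      using sum_nbrs_eq[OF finV A, where d = d and u = u and f = "\<lambda>_. 1"] by (simp add: p_def)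
    also have "\<dots> \<le> (\<Sum>y\<in>A. q * d y)" using A by (intro sum_mono p_le) auto
    also have "\<dots> = q * (\<Sum>y\<in>A. real (d y))" by (simp add: sum_distrib_left)
    also have "\<dots> \<le> q * R" using R q0 by (intro mult_left_mono)
    finally show ?thesis .
  qed
  define Y where "Y = {y. y \<in> V - A \<and> D y \<le> K}"
  have Y: "Y \<subseteq> V" "finite Y" using finV by (auto simp: Y_def)
  define S where "S = (\<Sum>y | y \<in> V0 \<and> D y \<le> K. real (D y) * (real (D y) - 1))"
  define M0 where "M0 = (\<Sum>y\<in>V0. real (D y))"
  have off: "q * (S - 3 * real K * (M0 - Q) - real K * R) \<le> (\<Sum>G\<in>?G. \<Sum>y\<in>nbrs G u - A. real (d y) - 1)"
  proof -
    have "S - 2 * real K * (M0 - Q) - real K * R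
        \<le> S - 2 * real K * (M0 - (\<Sum>y\<in>V. real (d y))) - real K * (\<Sum>y\<in>A. real (d y))"
      using QM R by (intro diff_mono mult_left_mono) auto
    also have "\<dots> \<le> (\<Sum>y\<in>Y. real (d y) * (real (d y) - 1))"
      using sum_degree_weight_diff_le[OF V0 V d A, where K = K] by (simp add: S_def M0_def Y_def)
    finally have 1: "q * (S - 2 * real K * (M0 - Q) - real K * R) \<le> q * (\<Sum>y\<in>Y. real (d y) * (real (d y) - 1))"
      using q0 by (rule mult_left_mono)
    \<comment> \<open>Two of the three copies of K * (M0 - Q) came from the residual degrees. The
      third pays for the deficits: their coefficients d y - 1 are at most K by the cut-off, and
      their total over V is at most q * (M0 - Q).\<close>
    have "(\<Sum>y\<in>Y. (q * d y - p y) * (real (d y) - 1)) \<le> (\<Sum>y\<in>Y. (q * d y - p y) * real K)"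
    proof (intro sum_mono mult_left_mono)
      fix y assume y: "y \<in> Y"
      then have "d y \<le> D y" "D y \<le> K" using d by (auto simp: Y_def)
      then show "real (d y) - 1 \<le> real K" by simp
      show "0 \<le> q * d y - p y" using p_le[of y] y Y by auto
    qed
    also have "\<dots> \<le> (\<Sum>y\<in>V. (q * d y - p y) * real K)"
      using p_le by (intro sum_mono2[OF finV Y(1)]) auto
    also have "\<dots> = (q * (\<Sum>y\<in>V. real (d y)) - q * Q) * real K"
      unfolding qQ sum_p[symmetric] by (simp only: sum_subtractf[symmetric] sum_distrib_right[symmetric] sum_distrib_left)
    also have "\<dots> \<le> (q * M0 - q * Q) * real K"
      using M_le q0 by (intro mult_right_mono diff_mono mult_left_mono) (auto simp: M0_def)
    finally have 2: "(\<Sum>y\<in>Y. (q * d y - p y) * (real (d y) - 1)) \<le> q * (real K * (M0 - Q))"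
      by (simp add: algebra_simps)
    have 3: "(\<Sum>y\<in>Y. p y * (real (d y) - 1))
        = q * (\<Sum>y\<in>Y. real (d y) * (real (d y) - 1)) - (\<Sum>y\<in>Y. (q * d y - p y) * (real (d y) - 1))"
      by (simp add: sum_distrib_left sum_subtractf[symmetric] algebra_simps)
    have "q * (S - 3 * real K * (M0 - Q) - real K * R)
        = q * (S - 2 * real K * (M0 - Q) - real K * R) - q * (real K * (M0 - Q))" by (simp add: algebra_simps)
    also have "\<dots> \<le> (\<Sum>y\<in>Y. p y * (real (d y) - 1))" using 1 2 3 by linarith
    also have "\<dots> = (\<Sum>G\<in>?G. \<Sum>y\<in>nbrs G u \<inter> Y. real (d y) - 1)"
      unfolding p_def by (rule sum_nbrs_eq[OF finV Y(1), symmetric])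
    \<comment> \<open>Neighbours outside Y enter with d y - 1 \<ge> 0, since a neighbour has at
      least the edge to u.\<close>
    also have "\<dots> \<le> (\<Sum>G\<in>?G. \<Sum>y\<in>nbrs G u - A. real (d y) - 1)"
    proof (intro sum_mono sum_mono2)
      fix G y assume G: "G \<in> ?G" and "y \<in> nbrs G u - A - nbrs G u \<inter> Y"
      then have "d y > 0" using degree_pos_of_nbr[OF finV G] by auto
      then show "0 \<le> real (d y) - 1" by simp
    qed (auto simp: Y_def intro: finite_nbrs[OF finV degree_graphs_simple])
    finally show ?thesis .
  qed
  have "0 \<le> q * (h * (S - 3 * real K * (M0 - Q) - real K * R) - ((h - 1) * Q + (1 + h) * R))"
    using drift q0 by (intro mult_nonneg_nonneg) (simp_all add: S_def M0_def)
  also have "\<dots> = (1 - h) * (q * Q) - (1 + h) * (q * R) + h * (q * (S - 3 * real K * (M0 - Q) - real K * R))"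
    by (simp add: algebra_simps)
  also have "\<dots> \<le> (1 - h) * (q * Q) - (1 + h) * (\<Sum>G\<in>?G. real (card (nbrs G u \<inter> A)))
      + h * (\<Sum>G\<in>?G. \<Sum>y\<in>nbrs G u - A. real (d y) - 1)"
  proof -
    have "0 \<le> 1 + h" using h by simp
    from mult_left_mono[OF coll this] mult_left_mono[OF off h] show ?thesis by linarith
  qed
  also have "\<dots> = (\<Sum>G\<in>?G. (1 - h) * d u - (1 + h) * card (nbrs G u \<inter> A)
      + h * (\<Sum>y\<in>nbrs G u - A. real (d y) - 1))"
    unfolding qQ by (simp add: sum.distrib sum_subtractf sum_distrib_left[symmetric] mult_ac)
  finally show ?thesis .
qed

text \<open>Bookkeeping behind the slope h: each of the d u half-edges of u is spent at cost h and
  would bring one newcomer, worth 1 plus h for each of its d y - 1 other half-edges. A half-edge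
  that ends in an active vertex brings no newcomer and uses up a further half-edge there, which
  costs 1 + h.\<close>

lemma potential_change:
  fixes d :: "'a \<Rightarrow> nat" and h :: real
  assumes V: "finite V" and G: "G \<in> degree_graphs V d" and A: "A \<subseteq> V" and u: "u \<in> A"
  defines "N \<equiv> nbrs G u"
  shows "1 + (card (A - {u} \<union> N) + h * (\<Sum>a\<in>A - {u} \<union> N. real (lower_degrees d N a)))
    = (card A + h * (\<Sum>a\<in>A. real (d a)))
      + ((1 - h) * d u - (1 + h) * card (N \<inter> A) + h * (\<Sum>y\<in>N - A. real (d y) - 1))"
proof -
  note s = degree_graphs_simple[OF G]
  have N: "finite N" "u \<notin> N" "card N = d u"
    using finite_nbrs[OF V s] nbrs_subset[OF s, of u] card_nbrs_degree[OF G] u A by (auto simp: N_def)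
  have finA: "finite A" using A V finite_subset by blast
  have eq: "A - {u} \<union> N = (A - {u}) \<union> (N - A)" using N by auto
  have low: "real (lower_degrees d N a) = real (d a) - of_bool (a \<in> N)" for a
    using degree_pos_of_nbr[OF V G, of a u] by (cases "a \<in> N") (simp_all add: lower_degrees_def of_nat_diff N_def)
  have cN: "real (card (N - A)) = real (d u) - card (N \<inter> A)"
    using card_Int_Diff[OF N(1), of A] N(3) by linarith
  have c1: "real (card (A - {u} \<union> N)) = real (card A) - 1 + real (card (N - A))"
    unfolding eq using finA N u card_Suc_Diff1[OF finA u] by (subst card_Un_disjoint) auto
  have "(\<Sum>a\<in>A - {u} \<union> N. real (lower_degrees d N a))
      = (\<Sum>a\<in>A - {u}. real (d a) - of_bool (a \<in> N)) + (\<Sum>a\<in>N - A. real (d a) - of_bool (a \<in> N))"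
    unfolding eq low using finA N by (intro sum.union_disjoint) auto
  also have "(\<Sum>a\<in>A - {u}. real (d a) - of_bool (a \<in> N))
      = (\<Sum>a\<in>A. real (d a)) - real (d u) - real (card (N \<inter> A))"
  proof -
    have "(\<Sum>a\<in>A - {u}. of_bool (a \<in> N) :: real) = real (card ((A - {u}) \<inter> N))"
      using finA by (simp add: of_bool_def sum.If_cases Int_def)
    moreover have "(A - {u}) \<inter> N = N \<inter> A" using N by auto
    ultimately show ?thesis
      using sum.remove[OF finA u, of "\<lambda>y. real (d y)"] by (simp add: sum_subtractf)
  qed
  also have "(\<Sum>a\<in>N - A. real (d a) - of_bool (a \<in> N)) = (\<Sum>a\<in>N - A. real (d a) - 1)"
    by (intro sum.cong) auto
  finally have c2: "(\<Sum>a\<in>A - {u} \<union> N. real (lower_degrees d N a))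
      = (\<Sum>a\<in>A. real (d a)) - real (d u) - real (card (N \<inter> A)) + (\<Sum>a\<in>N - A. real (d a) - 1)" .
  show ?thesis unfolding c1 cN c2 by (simp add: algebra_simps)
qed

text \<open>The potential is a submartingale only while the active half-edges number at most R, and
  the exploration may stop with vertices still active. Both failures are charged to c * exp (- s *
  T) times the exponential supermartingale: \<open>small\<close> makes it dominate the potential
  when T runs out, \<open>large\<close> when the active degree sum reaches R. There, and for A = {},
  the left side is nonpositive. The bound in \<open>large\<close> uses T0, the longest horizon,
  where the discount is strongest.\<close>

lemma sum_card_reach_ge:
  fixes D d :: "'a \<Rightarrow> nat" and s \<eta> h c Q R :: real and T0 :: nat
  assumes V0: "finite V0" and \<Delta>: "\<And>y. y \<in> V0 \<Longrightarrow> D y \<le> \<Delta>" and s: "s \<ge> 0" and \<eta>: "\<eta> \<ge> 0" and Q: "Q > 0"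
    and h: "h \<ge> 0" and c: "c \<ge> 0"
    and exp_drift: "(\<Sum>y\<in>V0. real (D y) * (exp s * (1 + \<eta>) ^ (D y - 1) - 1)) \<le> \<eta> * Q"
    and drift: "(h - 1) * Q + (1 + h) * R \<le> h * ((\<Sum>y | y \<in> V0 \<and> D y \<le> K. real (D y) * (real (D y) - 1))
        - 3 * real K * ((\<Sum>y\<in>V0. real (D y)) - Q) - real K * R)"
    and small: "\<And>(a :: nat) (m :: nat). a + h * m \<le> c * (exp (s * a) * (1 + \<eta>) ^ m)"
    and large: "\<And>(a :: nat) (m :: nat). R \<le> m \<Longrightarrow> a + h * m \<le> c * exp (- s * T0) * (exp (s * a) * (1 + \<eta>) ^ m)"
    and "T \<le> T0" and "V \<subseteq> V0" and "\<And>y. y \<in> V \<Longrightarrow> d y \<le> D y" and "A \<subseteq> V"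
    and "Q + 2 * real \<Delta> * (real \<Delta> + 1) + 2 * real \<Delta> * real T \<le> (\<Sum>y\<in>V. real (d y))"
  shows "card (degree_graphs V d) * (card A + h * (\<Sum>a\<in>A. real (d a))
      - c * exp (- s * T) * (\<Prod>a\<in>A. exp_weight s \<eta> {} d a))
    \<le> (\<Sum>G\<in>degree_graphs V d. real (min (card (reach G A)) T))"
  using assms(12-)
proof (induction T arbitrary: V d A)
  case (0 V d A)
  have finA: "finite A" by (rule finite_subset[OF 0(4) finite_subset[OF 0(2) V0]])
  have "card A + h * (\<Sum>a\<in>A. real (d a)) - c * exp (- s * real 0) * (\<Prod>a\<in>A. exp_weight s \<eta> {} d a) \<le> 0"
    using small[of "card A" "\<Sum>a\<in>A. d a"] by (simp add: prod_exp_weight_empty[OF finA])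
  then show ?case by (simp add: mult_nonneg_nonpos)
next
  case (Suc T V d A)
  let ?G = "degree_graphs V d"
  have finV: "finite V" by (rule finite_subset[OF Suc.prems(2) V0])
  have finA: "finite A" by (rule finite_subset[OF Suc.prems(4) finV])
  have rhs0: "0 \<le> (\<Sum>G\<in>?G. real (min (card (reach G A)) (Suc T)))" by (intro sum_nonneg) simp
  have M: "Q + 2 * real \<Delta> * (real \<Delta> + 1) \<le> (\<Sum>y\<in>V. real (d y))"
    using Suc.prems(5) mult_nonneg_nonneg[of "real \<Delta>" "real (Suc T)"] by linarith
  consider "A = {}" | "R \<le> (\<Sum>a\<in>A. real (d a))" | u where "u \<in> A" "(\<Sum>a\<in>A. real (d a)) \<le> R"
    by (meson all_not_in_conv linear)
  then show ?case
  proof cases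
    case 1
    then show ?thesis using c rhs0 by (simp add: mult_nonneg_nonpos)
  next
    case 2
    have "card A + h * (\<Sum>a\<in>A. real (d a)) \<le> c * exp (- s * T0) * (exp (s * card A) * (1 + \<eta>) ^ (\<Sum>a\<in>A. d a))"
      using large[of "\<Sum>a\<in>A. d a" "card A"] 2 by simp
    also have "\<dots> \<le> c * exp (- s * Suc T) * (exp (s * card A) * (1 + \<eta>) ^ (\<Sum>a\<in>A. d a))"
      using Suc.prems(1) s c \<eta> by (intro mult_right_mono mult_left_mono) (auto intro: mult_left_mono)
    finally have "card A + h * (\<Sum>a\<in>A. real (d a)) - c * exp (- s * Suc T) * (\<Prod>a\<in>A. exp_weight s \<eta> {} d a) \<le> 0"
      by (simp add: prod_exp_weight_empty[OF finA])
    then have "card ?G * (card A + h * (\<Sum>a\<in>A. real (d a))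
        - c * exp (- s * Suc T) * (\<Prod>a\<in>A. exp_weight s \<eta> {} d a)) \<le> 0"
      by (intro mult_nonneg_nonpos) auto
    then show ?thesis using rhs0 by linarith
  next
    case (3 u)
    have uV: "u \<in> V" using 3 Suc.prems(4) by auto
    have du: "d u \<le> \<Delta>" using Suc.prems(3)[OF uV] \<Delta>[of u] Suc.prems(2) uV by fastforce
    define F where "F S H = - real (min (card (reach H (A - {u} \<union> S))) T)" for S H
    define \<psi> where "\<psi> S = card (A - {u} \<union> S) + h * (\<Sum>a\<in>A - {u} \<union> S. real (lower_degrees d S a))" for S
    define E where "E S = (\<Prod>a\<in>A - {u} \<union> S. exp_weight s \<eta> {} (lower_degrees d S) a)" for S
    have step: "(\<Sum>G\<in>?G. F (nbrs G u) (del_vertex G u))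
        \<le> (\<Sum>G\<in>?G. - (\<psi> (nbrs G u) - c * exp (- s * T) * E (nbrs G u)))"
    proof (rule sum_reveal_le[OF finV uV])
      fix G S assume G: "G \<in> ?G" and S: "S = nbrs G u"
      have "S \<subseteq> V - {u}" using nbrs_subset[OF degree_graphs_simple[OF G]] S by simp
      then have "A - {u} \<union> S \<subseteq> V - {u}" using Suc.prems(4) by auto
      moreover have "lower_degrees d S y \<le> D y" if "y \<in> V - {u}" for y
        using Suc.prems(3)[of y] that by (auto simp: lower_degrees_def)
      moreover have "Q + 2 * real \<Delta> * (real \<Delta> + 1) + 2 * real \<Delta> * real T
          \<le> (\<Sum>y\<in>V - {u}. real (lower_degrees d S y))"
        unfolding S sum_lower_degrees[OF finV G uV] using Suc.prems(5) du by (simp add: algebra_simps)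
      moreover have "T \<le> T0" "V - {u} \<subseteq> V0" using Suc.prems by auto
      ultimately have "card (degree_graphs (V - {u}) (lower_degrees d S)) * (\<psi> S - c * exp (- s * T) * E S)
          \<le> (\<Sum>H\<in>degree_graphs (V - {u}) (lower_degrees d S). real (min (card (reach H (A - {u} \<union> S))) T))"
        unfolding \<psi>_def E_def by (intro Suc.IH)
      then show "(\<Sum>H\<in>degree_graphs (V - {u}) (lower_degrees d S). F S H)
          \<le> card (degree_graphs (V - {u}) (lower_degrees d S)) * - (\<psi> S - c * exp (- s * T) * E S)"
        by (simp only: F_def sum_negf mult_minus_right neg_le_iff_le)
    qed
    have E: "exp s * (\<Sum>G\<in>?G. E (nbrs G u)) \<le> card ?G * (\<Prod>a\<in>A. exp_weight s \<eta> {} d a)"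
      unfolding E_def sum_distrib_left using exp_drift Suc.prems 3 M
      by (intro sum_exp_weight_reveal_le[OF V0 \<Delta> s \<eta> Q]) auto
    \<comment> \<open>The one-step bound comes with a factor exp s, which is just the ratio of the
      discounts for T and \<open>Suc T\<close>.\<close>
    have "c * exp (- s * T) * (\<Sum>G\<in>?G. E (nbrs G u)) = c * exp (- s * Suc T) * (exp s * (\<Sum>G\<in>?G. E (nbrs G u)))"
      by (simp add: exp_add[symmetric] algebra_simps mult_exp_exp)
    also have "\<dots> \<le> c * exp (- s * Suc T) * (card ?G * (\<Prod>a\<in>A. exp_weight s \<eta> {} d a))"
      using c by (intro mult_left_mono E) auto
    finally have E': "c * exp (- s * T) * (\<Sum>G\<in>?G. E (nbrs G u))
        \<le> c * exp (- s * Suc T) * (card ?G * (\<Prod>a\<in>A. exp_weight s \<eta> {} d a))" .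
    have "0 \<le> (\<Sum>G\<in>?G. (1 - h) * d u - (1 + h) * card (nbrs G u \<inter> A)
        + h * (\<Sum>y\<in>nbrs G u - A. real (d y) - 1))"
      using Suc.prems 3 M uV by (intro drift_nonneg[OF V0 \<Delta> Q h drift]) auto
    also have "\<dots> = (\<Sum>G\<in>?G. 1 + \<psi> (nbrs G u) - (card A + h * (\<Sum>a\<in>A. real (d a))))"
      unfolding \<psi>_def using potential_change[OF finV _ Suc.prems(4) 3(1), of _ d h]
      by (intro sum.cong refl) (simp add: algebra_simps)
    finally have P: "card ?G * (card A + h * (\<Sum>a\<in>A. real (d a))) \<le> card ?G + (\<Sum>G\<in>?G. \<psi> (nbrs G u))"
      by (simp add: sum_subtractf sum.distrib)
    have "(\<Sum>G\<in>?G. real (min (card (reach G A)) (Suc T))) = (\<Sum>G\<in>?G. 1 - F (nbrs G u) (del_vertex G u))"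
    proof (rule sum.cong[OF refl])
      fix G assume "G \<in> ?G"
      note sG = degree_graphs_simple[OF this]
      show "real (min (card (reach G A)) (Suc T)) = 1 - F (nbrs G u) (del_vertex G u)"
        using card_reach_step[OF finV sG 3(1) Suc.prems(4)] by (simp add: F_def)
    qed
    also have "\<dots> = card ?G - (\<Sum>G\<in>?G. F (nbrs G u) (del_vertex G u))" by (simp add: sum_subtractf)
    also have "\<dots> \<ge> card ?G + (\<Sum>G\<in>?G. \<psi> (nbrs G u)) - c * exp (- s * T) * (\<Sum>G\<in>?G. E (nbrs G u))"
      using step by (simp add: sum_subtractf sum_distrib_left)
    finally show ?thesis using P E' by (simp add: algebra_simps)
  qed
qed

section \<open>Consequences of the power law\<close>

lemma powr_le_sum_powr:
  fixes a :: real
  assumes a: "a \<ge> 1"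
  shows "real m powr a \<le> (\<Sum>k=1..m. a * real k powr (a - 1))"
proof (induction m)
  case (Suc m)
  have "real (Suc m) powr a - real m powr a \<le> a * real (Suc m) powr (a - 1)"
  proof (cases "m = 0")
    case True then show ?thesis using a by simp
  next
    case False
    have "\<exists>z. real m < z \<and> z < real (Suc m) \<and>
        real (Suc m) powr a - real m powr a = (real (Suc m) - real m) * (a * z powr (a - 1))"
      using False by (intro MVT2 has_real_derivative_powr) auto
    then obtain z where z: "real m < z" "z < real (Suc m)"
      "real (Suc m) powr a - real m powr a = a * z powr (a - 1)" by auto
    have "z powr (a - 1) \<le> real (Suc m) powr (a - 1)" using z a by (intro powr_mono2) auto
    then show ?thesis using z(3) a by (simp add: mult_left_mono)
  qed
  then show ?case using Suc by simp
qed simp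

text \<open>Bernoulli's linear bound cannot beat a constant factor above one, as is needed to
  compensate the discount of the exploration; one more term of the binomial expansion can.\<close>

lemma one_plus_power_ge_quadratic:
  fixes x :: real
  assumes x: "x \<ge> 0"
  shows "1 + real m * x + real m * (real m - 1) / 2 * x\<^sup>2 \<le> (1 + x) ^ m"
proof (induction m)
  case (Suc m)
  have "1 + real (Suc m) * x + real (Suc m) * (real (Suc m) - 1) / 2 * x\<^sup>2
      \<le> (1 + x) * (1 + real m * x + real m * (real m - 1) / 2 * x\<^sup>2)"
  proof -
    have "0 \<le> real m * (real m - 1) / 2 * x ^ 3" using x by (cases m) auto
    then show ?thesis by (simp add: field_simps power2_eq_square power3_eq_cube)
  qed
  also have "\<dots> \<le> (1 + x) * (1 + x) ^ m" using x Suc by (intro mult_left_mono) auto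
  finally show ?case by simp
qed simp

lemma exp_le_quadratic:
  fixes z :: real
  assumes "z \<ge> 0"
  shows "exp z \<le> 1 + z + z\<^sup>2 * exp z"
proof -
  have e: "exp z - 1 \<le> z * exp z"
  proof -
    have "(1 - z) * exp z \<le> exp (- z) * exp z"
      using exp_ge_add_one_self[of "- z"] by (intro mult_right_mono) auto
    then show ?thesis by (simp add: algebra_simps mult_exp_exp)
  qed
  have "1 * z \<le> exp z * z" using assms by (intro mult_right_mono) auto
  moreover have "z * (exp z - 1) \<le> z * (z * exp z)" using e assms by (rule mult_left_mono)
  ultimately show ?thesis using e by (simp add: algebra_simps power2_eq_square)
qed

text \<open>Second-order expansion at z = s + \<eta> * (D - 1), the exponent that bounds the weight
  of a newcomer. Summed over the vertices, the linear terms become the half-edge count and the pair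
  count behind \<nu>; the remainder is cubic in D because s \<le> \<eta> gives z \<le> \<eta> *
  D.\<close>

lemma degree_weight_le:
  fixes s \<eta> b :: real and D :: nat
  assumes s: "0 \<le> s" "s \<le> \<eta>" and b: "\<eta> * D \<le> b"
  shows "D * (exp s * (1 + \<eta>) ^ (D - 1) - 1) \<le> s * D + \<eta> * (D * (real D - 1)) + \<eta>\<^sup>2 * exp b * real D ^ 3"
proof (cases "D = 0")
  case False
  have \<eta>: "\<eta> \<ge> 0" using s by simp
  define z where "z = s + \<eta> * (real D - 1)"
  have D1: "real (D - 1) = real D - 1" using False by (simp add: of_nat_diff)
  have z0: "0 \<le> z" using s \<eta> False by (simp add: z_def)
  have zD: "z \<le> \<eta> * D" using s by (simp add: z_def algebra_simps)
  have "(1 + \<eta>) ^ (D - 1) \<le> exp \<eta> ^ (D - 1)"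
    using \<eta> exp_ge_add_one_self[of \<eta>] by (intro power_mono) auto
  also have "\<dots> = exp (\<eta> * (real D - 1))" unfolding D1[symmetric] by (simp only: exp_of_nat2_mult)
  finally have "exp s * (1 + \<eta>) ^ (D - 1) \<le> exp s * exp (\<eta> * (real D - 1))" by (intro mult_left_mono) auto
  also have "\<dots> = exp z" by (simp add: z_def exp_add)
  also have "\<dots> \<le> 1 + z + z\<^sup>2 * exp z" by (rule exp_le_quadratic[OF z0])
  also have "\<dots> \<le> 1 + z + (\<eta> * D)\<^sup>2 * exp b"
    using z0 zD b by (intro add_mono mult_mono power_mono order.refl) auto
  finally have "real D * (exp s * (1 + \<eta>) ^ (D - 1) - 1) \<le> real D * (z + (\<eta> * D)\<^sup>2 * exp b)"
    by (intro mult_left_mono) auto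
  also have "\<dots> = s * D + \<eta> * (D * (real D - 1)) + \<eta>\<^sup>2 * exp b * real D ^ 3"
    by (simp add: z_def algebra_simps power2_eq_square power3_eq_cube)
  finally show ?thesis .
qed simp

section \<open>Degree counts, maximal degree and moments under the tail bound\<close>

locale power_law_degrees =
  fixes d :: "nat \<Rightarrow> nat \<Rightarrow> nat" and \<gamma> C :: real
  assumes gamma: "\<gamma> > 3"
    and tail: "\<And>n k. n \<ge> 1 \<Longrightarrow> k \<ge> 1 \<Longrightarrow>
      measure_pmf.prob (degree_pmf n (d n)) {k..} \<le> C * real k powr (1 - \<gamma>)"
begin

definition scale :: "nat \<Rightarrow> real" where
  "scale n = real n powr (1 / (\<gamma> - 1))"

definition half_edges :: "nat \<Rightarrow> real" where
  "half_edges n = (\<Sum>i=1..n. real (d n i))"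

text \<open>Any positive exponent with 2 + \<beta> < \<gamma> - 1 gives a bounded moment of order 2
  + \<beta>; half of \<gamma> - 3 leaves room, and the cap 1 keeps 1 - \<beta> nonnegative when the
  third moment is reduced to this one.\<close>

definition \<beta> :: real where
  "\<beta> = min 1 ((\<gamma> - 3) / 2)"

lemma \<beta>: "\<beta> > 0" "\<beta> \<le> 1" "2 + \<beta> - \<gamma> < -1"
  unfolding \<beta>_def min_def using gamma by (auto simp: field_simps)

lemma C_nonneg: "C \<ge> 0"
  using order_trans[OF measure_nonneg tail[of 1 1]] by simp

lemma tail_count:
  assumes "n \<ge> 1" "k \<ge> 1"
  shows "real (card {i \<in> {1..n}. k \<le> d n i}) \<le> real n * (C * real k powr (1 - \<gamma>))"
proof -
  have "{1..n} \<inter> d n -` {k..} = {i \<in> {1..n}. k \<le> d n i}" by auto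
  then have "measure_pmf.prob (degree_pmf n (d n)) {k..} = card {i \<in> {1..n}. k \<le> d n i} / n"
    using assms by (simp add: degree_pmf_def measure_pmf_of_set)
  then have "real (card {i \<in> {1..n}. k \<le> d n i}) = real n * measure_pmf.prob (degree_pmf n (d n)) {k..}"
    using assms by simp
  then show ?thesis using tail[OF assms] by (simp add: mult_left_mono)
qed

lemma tail_count_real:
  assumes n: "n \<ge> 1" and x: "x > 0"
  shows "real (card {i \<in> {1..n}. x \<le> real (d n i)}) \<le> real n * (C * x powr (1 - \<gamma>))"
proof -
  define k where "k = nat \<lceil>x\<rceil>"
  have k: "k \<ge> 1" "x \<le> real k" using x by (auto simp: k_def le_nat_iff)
  have "{i \<in> {1..n}. x \<le> real (d n i)} \<subseteq> {i \<in> {1..n}. k \<le> d n i}"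
    by (auto simp: k_def nat_le_iff ceiling_le_iff)
  then have "real (card {i \<in> {1..n}. x \<le> real (d n i)}) \<le> real (card {i \<in> {1..n}. k \<le> d n i})"
    by (intro of_nat_mono card_mono) auto
  also have "\<dots> \<le> real n * (C * real k powr (1 - \<gamma>))" by (rule tail_count[OF n k(1)])
  also have "\<dots> \<le> real n * (C * x powr (1 - \<gamma>))"
    using k x gamma C_nonneg by (intro mult_left_mono powr_mono2') auto
  finally show ?thesis .
qed

text \<open>A vertex of degree k is itself counted by the tail at k, so 1 \<le> n * C * k powr (1 -
  \<gamma>), which is solved for k. C + 1 in place of C keeps the constant positive.\<close>

lemma degree_le_scale:
  obtains c where "c > 0" "\<And>n i. n \<ge> 1 \<Longrightarrow> i \<in> {1..n} \<Longrightarrow> real (d n i) \<le> c * scale n"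
proof
  show "(C + 1) powr (1 / (\<gamma> - 1)) > 0" using C_nonneg by simp
  fix n i :: nat assume n: "n \<ge> 1" and i: "i \<in> {1..n}"
  show "real (d n i) \<le> (C + 1) powr (1 / (\<gamma> - 1)) * scale n"
  proof (cases "d n i = 0")
    case False
    let ?k = "real (d n i)"
    have k: "?k > 0" using False by simp
    have "card {i} \<le> card {j \<in> {1..n}. d n i \<le> d n j}" using i by (intro card_mono) auto
    then have "1 \<le> real (card {j \<in> {1..n}. d n i \<le> d n j})" by simp
    also have "\<dots> \<le> real n * (C * ?k powr (1 - \<gamma>))" using False by (intro tail_count n) auto
    also have "\<dots> \<le> real n * ((C + 1) * ?k powr (1 - \<gamma>))" by (intro mult_left_mono mult_right_mono) auto
    finally have "?k powr (\<gamma> - 1) * 1 \<le> ?k powr (\<gamma> - 1) * (real n * ((C + 1) * ?k powr (1 - \<gamma>)))"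
      by (intro mult_left_mono) auto
    also have "\<dots> = (C + 1) * real n * (?k powr (\<gamma> - 1) * ?k powr (1 - \<gamma>))" by simp
    also have "?k powr (\<gamma> - 1) * ?k powr (1 - \<gamma>) = 1" using k by (simp add: powr_add[symmetric])
    finally have "(?k powr (\<gamma> - 1)) powr (1 / (\<gamma> - 1)) \<le> ((C + 1) * real n) powr (1 / (\<gamma> - 1))"
      using gamma by (intro powr_mono2) auto
    then show ?thesis using k gamma C_nonneg by (simp add: powr_powr powr_mult scale_def)
  qed (simp add: scale_def)
qed

text \<open>Summation by layers: with a = 2 + \<beta>, the power d powr a is at most the sum of a *
  k powr (a - 1) over k \<le> d. Exchanging the sums brings in the tail counts, and the exponents
  add up to 2 + \<beta> - \<gamma> < -1, so the series converges.\<close>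

lemma moment_le:
  obtains c where "c > 0" "\<And>n. n \<ge> 1 \<Longrightarrow> (\<Sum>i=1..n. real (d n i) powr (2 + \<beta>)) \<le> c * real n"
proof
  define a where "a = 2 + \<beta>"
  define S where "S = (\<Sum>k. real k powr (2 + \<beta> - \<gamma>))"
  have summ: "summable (\<lambda>k. real k powr (2 + \<beta> - \<gamma>))" using \<beta>(3) by (simp add: summable_real_powr_iff)
  have S0: "S \<ge> 0" unfolding S_def by (intro suminf_nonneg summ) simp
  show "a * C * S + 1 > 0" using S0 C_nonneg \<beta> by (intro add_nonneg_pos mult_nonneg_nonneg) (auto simp: a_def)
  fix n :: nat assume n: "n \<ge> 1"
  define m where "m = Max (d n ` {1..n})"
  have "(\<Sum>i=1..n. real (d n i) powr a) \<le> (\<Sum>i=1..n. \<Sum>k=1..d n i. a * real k powr (a - 1))"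
    using \<beta> by (intro sum_mono powr_le_sum_powr) (auto simp: a_def)
  also have "\<dots> = (\<Sum>i\<in>{1..n}. \<Sum>k | k \<in> {1..m} \<and> k \<le> d n i. a * real k powr (a - 1))"
  proof (intro sum.cong refl)
    fix i assume "i \<in> {1..n}"
    then have "d n i \<le> m" unfolding m_def by (intro Max_ge) auto
    then show "{1..d n i} = {k. k \<in> {1..m} \<and> k \<le> d n i}" by auto
  qed
  also have "\<dots> = (\<Sum>k\<in>{1..m}. \<Sum>i | i \<in> {1..n} \<and> k \<le> d n i. a * real k powr (a - 1))"
    by (intro sum.swap_restrict) auto
  also have "\<dots> = (\<Sum>k\<in>{1..m}. real (card {i \<in> {1..n}. k \<le> d n i}) * (a * real k powr (a - 1)))" by simp
  also have "\<dots> \<le> (\<Sum>k\<in>{1..m}. real n * (C * real k powr (1 - \<gamma>)) * (a * real k powr (a - 1)))"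
    using n \<beta> by (intro sum_mono mult_right_mono tail_count) (auto simp: a_def)
  also have "\<dots> = (\<Sum>k\<in>{1..m}. a * C * real n * real k powr (2 + \<beta> - \<gamma>))"
  proof (rule sum.cong[OF refl])
    fix k :: nat assume "k \<in> {1..m}"
    have "real k powr (2 + \<beta> - \<gamma>) = real k powr (1 - \<gamma>) * real k powr (a - 1)"
      unfolding powr_add[symmetric] a_def by (simp add: algebra_simps)
    then show "real n * (C * real k powr (1 - \<gamma>)) * (a * real k powr (a - 1)) = a * C * real n * real k powr (2 + \<beta> - \<gamma>)"
      by simp
  qed
  also have "\<dots> = a * C * real n * (\<Sum>k\<in>{1..m}. real k powr (2 + \<beta> - \<gamma>))"
    by (simp add: sum_distrib_left)
  also have "\<dots> \<le> a * C * real n * S"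
    unfolding S_def using C_nonneg \<beta> by (intro mult_left_mono sum_le_suminf summ) (auto simp: a_def)
  also have "\<dots> \<le> (a * C * S + 1) * real n" by (simp add: algebra_simps)
  finally show "(\<Sum>i=1..n. real (d n i) powr (2 + \<beta>)) \<le> (a * C * S + 1) * real n" by (simp add: a_def)
qed

text \<open>One factor d powr (1 - \<beta>) is bounded through the maximal degree, which is
  O(\<open>scale n\<close>); what remains is the moment of order 2 + \<beta>.\<close>

lemma third_moment_le:
  obtains c where "c > 0" "\<And>n. n \<ge> 1 \<Longrightarrow> (\<Sum>i=1..n. real (d n i) ^ 3) \<le> c * real n * scale n powr (1 - \<beta>)"
proof -
  obtain c1 where c1: "c1 > 0" "\<And>n i. n \<ge> 1 \<Longrightarrow> i \<in> {1..n} \<Longrightarrow> real (d n i) \<le> c1 * scale n"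
    by (rule degree_le_scale) blast
  obtain c2 where c2: "c2 > 0" "\<And>n. n \<ge> 1 \<Longrightarrow> (\<Sum>i=1..n. real (d n i) powr (2 + \<beta>)) \<le> c2 * real n"
    by (rule moment_le) blast
  show thesis
  proof
    show "c1 powr (1 - \<beta>) * c2 > 0" using c1 c2 by simp
    fix n :: nat assume n: "n \<ge> 1"
    have "(\<Sum>i=1..n. real (d n i) ^ 3) \<le> (\<Sum>i=1..n. (c1 * scale n) powr (1 - \<beta>) * real (d n i) powr (2 + \<beta>))"
    proof (rule sum_mono)
      fix i assume i: "i \<in> {1..n}"
      have "real (d n i) ^ 3 = real (d n i) powr (1 - \<beta>) * real (d n i) powr (2 + \<beta>)"
        by (cases "d n i = 0") (simp_all add: powr_add[symmetric] powr_numeral)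
      also have "\<dots> \<le> (c1 * scale n) powr (1 - \<beta>) * real (d n i) powr (2 + \<beta>)"
        using c1(2)[OF n i] \<beta> by (intro mult_right_mono powr_mono2) auto
      finally show "real (d n i) ^ 3 \<le> (c1 * scale n) powr (1 - \<beta>) * real (d n i) powr (2 + \<beta>)" .
    qed
    also have "\<dots> = (c1 * scale n) powr (1 - \<beta>) * (\<Sum>i=1..n. real (d n i) powr (2 + \<beta>))"
      by (simp add: sum_distrib_left)
    also have "\<dots> \<le> (c1 * scale n) powr (1 - \<beta>) * (c2 * real n)"
      by (intro mult_left_mono c2 n) auto
    also have "\<dots> = c1 powr (1 - \<beta>) * c2 * real n * scale n powr (1 - \<beta>)"
      using c1 by (simp add: powr_mult scale_def)
    finally show "(\<Sum>i=1..n. real (d n i) ^ 3) \<le> c1 powr (1 - \<beta>) * c2 * real n * scale n powr (1 - \<beta>)" .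
  qed
qed

text \<open>Above K, d^2 \<le> K powr (- \<beta>) * d powr (2 + \<beta>). This is uniform
  integrability of the squared degrees, with a rate independent of n.\<close>

lemma second_moment_tail_le:
  obtains c where "c > 0" "\<And>n K. n \<ge> 1 \<Longrightarrow> K \<ge> 1 \<Longrightarrow>
    (\<Sum>i | i \<in> {1..n} \<and> K < d n i. real (d n i) * (real (d n i) - 1)) \<le> c * real n * real K powr (- \<beta>)"
proof -
  obtain c where c: "c > 0" "\<And>n. n \<ge> 1 \<Longrightarrow> (\<Sum>i=1..n. real (d n i) powr (2 + \<beta>)) \<le> c * real n"
    by (rule moment_le) blast
  show thesis
  proof
    show "c > 0" by (rule c)
    fix n K :: nat assume n: "n \<ge> 1" and K: "K \<ge> 1"
    have "(\<Sum>i | i \<in> {1..n} \<and> K < d n i. real (d n i) * (real (d n i) - 1))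
        \<le> (\<Sum>i | i \<in> {1..n} \<and> K < d n i. real K powr (- \<beta>) * real (d n i) powr (2 + \<beta>))"
    proof (rule sum_mono)
      fix i assume i: "i \<in> {i. i \<in> {1..n} \<and> K < d n i}"
      then have pos: "real (d n i) > 0" using K by auto
      have "real (d n i) * (real (d n i) - 1) \<le> real (d n i) ^ 2"
        by (simp add: power2_eq_square algebra_simps)
      also have "\<dots> = real (d n i) powr (- \<beta>) * real (d n i) powr (2 + \<beta>)"
        using pos by (simp add: powr_add[symmetric] powr_numeral)
      also have "\<dots> \<le> real K powr (- \<beta>) * real (d n i) powr (2 + \<beta>)"
        using i K \<beta> by (intro mult_right_mono powr_mono2') auto
      finally show "real (d n i) * (real (d n i) - 1) \<le> real K powr (- \<beta>) * real (d n i) powr (2 + \<beta>)" .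
    qed
    also have "\<dots> \<le> (\<Sum>i=1..n. real K powr (- \<beta>) * real (d n i) powr (2 + \<beta>))"
      by (intro sum_mono2) auto
    also have "\<dots> = real K powr (- \<beta>) * (\<Sum>i=1..n. real (d n i) powr (2 + \<beta>))" by (simp add: sum_distrib_left)
    also have "\<dots> \<le> real K powr (- \<beta>) * (c * real n)" by (intro mult_left_mono c n) auto
    finally show "(\<Sum>i | i \<in> {1..n} \<and> K < d n i. real (d n i) * (real (d n i) - 1)) \<le> c * real n * real K powr (- \<beta>)"
      by (simp add: mult_ac)
  qed
qed

lemma scale_pos: "n \<ge> 1 \<Longrightarrow> scale n > 0"
  by (simp add: scale_def)

lemma scale_nonneg: "scale n \<ge> 0"
  by (simp add: scale_def)

lemma scale_ge_1: "n \<ge> 1 \<Longrightarrow> scale n \<ge> 1"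
  using gamma by (simp add: scale_def ge_one_powr_ge_zero)

text \<open>By the choice of the scale, its power 1 - \<gamma> is 1 / n, which cancels the factor n
  of the tail count; the number of heavy vertices is bounded in n.\<close>

lemma card_heavy_le:
  assumes n: "n \<ge> 1" and \<epsilon>: "\<epsilon> > 0"
  shows "real (card {i \<in> {1..n}. \<epsilon> * scale n \<le> real (d n i)}) \<le> C * \<epsilon> powr (1 - \<gamma>)"
proof -
  have "1 / (\<gamma> - 1) * (1 - \<gamma>) = - 1" using gamma by (simp add: field_simps)
  then have "scale n powr (1 - \<gamma>) = real n powr - 1"
    by (simp only: scale_def powr_powr)
  also have "\<dots> = 1 / real n" using n by (simp add: powr_minus_divide)
  finally have "(\<epsilon> * scale n) powr (1 - \<gamma>) = \<epsilon> powr (1 - \<gamma>) / real n"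
    using \<epsilon> scale_nonneg[of n] by (simp add: powr_mult)
  then show ?thesis
    using tail_count_real[OF n mult_pos_pos[OF \<epsilon> scale_pos[OF n]]] n by simp
qed

lemma filterlim_scale: "filterlim scale at_top sequentially"
proof -
  have "filterlim (\<lambda>x. x powr (1 / (\<gamma> - 1))) at_top (at_top :: real filter)"
    using gamma by (intro real_powr_at_top) simp
  from filterlim_compose[OF this filterlim_real_sequentially] show ?thesis unfolding scale_def .
qed

lemma scale_powr_div_tendsto:
  assumes "q < \<gamma> - 1"
  shows "(\<lambda>n. scale n powr q / real n) \<longlonglongrightarrow> 0"
proof -
  have "q / (\<gamma> - 1) - 1 < 0" using assms gamma by (simp add: field_simps)
  then have "(\<lambda>n. real n powr (q / (\<gamma> - 1) - 1)) \<longlonglongrightarrow> 0"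
    by (intro tendsto_neg_powr filterlim_real_sequentially)
  then show ?thesis
  proof (rule Lim_transform_eventually)
    show "\<forall>\<^sub>F n in sequentially. real n powr (q / (\<gamma> - 1) - 1) = scale n powr q / real n"
      using eventually_ge_at_top[of 1] by eventually_elim (simp add: scale_def powr_powr powr_diff)
  qed
qed

lemma scale_div_tendsto: "(\<lambda>n. scale n / real n) \<longlonglongrightarrow> 0"
  using scale_powr_div_tendsto[of 1] gamma by (simp add: scale_def)

text \<open>The exponent 2 lies below \<gamma> - 1 because \<gamma> > 3. This makes all losses of
  order \<Delta>^2 negligible against n.\<close>

lemma scale_square_div_tendsto: "(\<lambda>n. (scale n)\<^sup>2 / real n) \<longlonglongrightarrow> 0"
proof (rule Lim_transform_eventually[OF scale_powr_div_tendsto[of 2]])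
  show "\<forall>\<^sub>F n in sequentially. scale n powr 2 / real n = (scale n)\<^sup>2 / real n"
    using eventually_ge_at_top[of 1] by eventually_elim (simp add: scale_nonneg)
qed (use gamma in simp)

end

section \<open>Asymptotics\<close>

text \<open>Both sides are compared with N * ((1 + a / N) * (1 + h' * m / N)), which expands to more
  than a + h' * m.\<close>

lemma linear_le_exp_weight:
  fixes N h h' :: real
  assumes N: "N > 0" and h: "0 \<le> h" "h \<le> h'"
  shows "real a + h * real m \<le> N * (exp (1 / N * real a) * (1 + h' / N) ^ m)"
proof -
  have "0 \<le> h' / N" using N h by simp
  then have bern: "1 + real m * (h' / N) \<le> (1 + h' / N) ^ m" by (intro Bernoulli_inequality) linarith
  have "real a + h * real m \<le> real a + h' * real m" using h by (simp add: mult_right_mono)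
  also have "\<dots> \<le> N * ((1 + real a / N) * (1 + real m * (h' / N)))"
    using N h by (simp add: field_simps)
  also have "\<dots> \<le> N * (exp (1 / N * real a) * (1 + h' / N) ^ m)"
    using N h exp_ge_add_one_self[of "1 / N * real a"]
    by (intro mult_left_mono mult_mono bern) auto
  finally show ?thesis .
qed

text \<open>The discount costs a factor of at most exp (K + 1), since T / N \<le> K + 1. Once t = h'
  * m / N is large against this constant, the quadratic term of (1 + h' / N) ^ m makes up for
  it.\<close>

lemma linear_le_exp_weight_large:
  fixes N h h' K :: real
  assumes N: "N \<ge> 1" "h' \<le> N" and h: "0 \<le> h" "h \<le> h'" "h' > 0"
    and T: "real T \<le> K * N + 1" and K: "K \<ge> 0" and m: "8 * exp (K + 1) / h' * N \<le> real m"
  shows "real a + h * real m \<le> N * exp (- (1 / N) * real T) * (exp (1 / N * real a) * (1 + h' / N) ^ m)"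
proof -
  define t where "t = h' / N * real m"
  have t: "8 * exp (K + 1) \<le> t" using m N h by (simp add: t_def field_simps)
  have e1: "exp (K + 1) \<ge> 1" using K by simp
  have t8: "t \<ge> 8" using t e1 by linarith
  have "h' / N \<le> 1" using N by simp
  then have "t \<le> 1 * real m" unfolding t_def by (intro mult_right_mono) auto
  then have m2: "real m \<ge> 2" using t8 by simp
  \<comment> \<open>With e = exp (K + 1) and 8 * e \<le> t, both e and e * t are at most t^2 / 8;
    the sum t^2 / 4 is what m * (m - 1) / 2 \<ge> m^2 / 4 offers for m \<ge> 2.\<close>
  have "exp (K + 1) * (1 + t) \<le> 1 + t + t\<^sup>2 / 4"
  proof -
    have "8 * exp (K + 1) * t \<le> t * t" using t t8 by (intro mult_right_mono) auto
    then have "8 * (exp (K + 1) * t) \<le> t * t" by simp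
    moreover have "exp (K + 1) * 1 \<le> exp (K + 1) * t" using t8 by (intro mult_left_mono) auto
    ultimately show ?thesis using t8 unfolding power2_eq_square distrib_left by linarith
  qed
  also have "\<dots> \<le> 1 + real m * (h' / N) + real m * (real m - 1) / 2 * (h' / N)\<^sup>2"
  proof -
    have "real m * real m / 4 \<le> real m * (real m - 1) / 2"
      using mult_left_mono[of 2 "real m" "real m"] m2 by (simp add: field_simps)
    then have "real m * real m / 4 * (h' / N)\<^sup>2 \<le> real m * (real m - 1) / 2 * (h' / N)\<^sup>2"
      by (rule mult_right_mono) simp
    moreover have "t\<^sup>2 / 4 = real m * real m / 4 * (h' / N)\<^sup>2" by (simp add: t_def power2_eq_square mult_ac)
    moreover have "t = real m * (h' / N)" by (simp add: t_def)
    ultimately show ?thesis by linarith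
  qed
  also have "\<dots> \<le> (1 + h' / N) ^ m" using N h by (intro one_plus_power_ge_quadratic) auto
  finally have pow: "exp (K + 1) * (1 + t) \<le> (1 + h' / N) ^ m" .
  have TN: "exp (- (K + 1)) \<le> exp (- (1 / N) * real T)"
  proof -
    have "real T / N \<le> K + 1 / N" using T N by (simp add: field_simps)
    also have "\<dots> \<le> K + 1" using N by simp
    finally show ?thesis by simp
  qed
  have "real a + h * real m \<le> real a + h' * real m" using h by (simp add: mult_right_mono)
  also have "\<dots> \<le> N * ((1 + real a / N) * (1 + t))"
    using N h by (simp add: t_def field_simps)
  also have "\<dots> = N * exp (- (K + 1)) * ((1 + real a / N) * (exp (K + 1) * (1 + t)))"
  proof -
    have "exp (- (K + 1)) * exp (K + 1) = 1" by (simp add: mult_exp_exp)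
    then have "N * ((1 + real a / N) * (1 + t)) = N * ((1 + real a / N) * (1 + t)) * (exp (- (K + 1)) * exp (K + 1))"
      by simp
    then show ?thesis by (simp only: mult_ac)
  qed
  also have "\<dots> \<le> N * exp (- (1 / N) * real T) * (exp (1 / N * real a) * (1 + h' / N) ^ m)"
    using N h pow TN t8 exp_ge_add_one_self[of "1 / N * real a"]
    by (intro mult_mono) (auto simp: mult.commute)
  finally show ?thesis .
qed

text \<open>The function exp y - 1 - y is convex with minimum 0 at 0. On [-1, 1], squaring 1 + x / 2
  \<le> exp (x / 2) gives x^2 / 4; further out, the tangent of exp at \<delta> or - \<delta> shows
  that the function does not fall below its value there.\<close>

lemma exp_minus_linear_ge:
  fixes y \<delta> :: real
  assumes \<delta>: "0 < \<delta>" "\<delta> \<le> 1" and y: "\<delta> \<le> \<bar>y\<bar>"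
  shows "\<delta>\<^sup>2 / 4 \<le> exp y - 1 - y"
proof -
  have sq: "x\<^sup>2 / 4 \<le> exp x - 1 - x" if "\<bar>x\<bar> \<le> 1" for x :: real
  proof -
    have "(1 + x / 2)\<^sup>2 \<le> (exp (x / 2))\<^sup>2"
      using that exp_ge_add_one_self[of "x / 2"] by (intro power_mono) auto
    also have "\<dots> = exp x" by (simp add: power2_eq_square mult_exp_exp)
    finally show ?thesis by (simp add: power2_eq_square field_simps)
  qed
  have tangent: "exp x * (1 + (y - x)) \<le> exp y" for x
    using mult_left_mono[OF exp_ge_add_one_self[of "y - x"], of "exp x"] by (simp add: mult_exp_exp)
  show ?thesis
  proof (cases "y \<ge> 0")
    case True
    have "0 \<le> (exp \<delta> - 1) * (y - \<delta>)" using True y \<delta> by (intro mult_nonneg_nonneg) auto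
    then show ?thesis using tangent[of \<delta>] sq[of \<delta>] \<delta> by (simp add: algebra_simps)
  next
    case False
    have "0 \<le> (1 - exp (- \<delta>)) * (- y - \<delta>)" using False y \<delta> by (intro mult_nonneg_nonneg) auto
    then show ?thesis using tangent[of "- \<delta>"] sq[of "- \<delta>"] \<delta> by (simp add: algebra_simps)
  qed
qed

section \<open>Limits of half-edge and pair counts, and the drift conditions\<close>

locale subcritical_degrees = power_law_degrees +
  fixes mu_inf nu_inf :: real
  assumes mu_lim: "(\<lambda>n. mean_degree n (d n)) \<longlonglongrightarrow> mu_inf"
    and nu_lim: "(\<lambda>n. nu n (d n)) \<longlonglongrightarrow> nu_inf"
    and mu_pos: "mu_inf > 0" and nu_less: "nu_inf < 1"
begin

definition degree_pairs :: "nat \<Rightarrow> real" where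
  "degree_pairs n = (\<Sum>i=1..n. real (d n i) * (real (d n i) - 1))"

lemma degree_pair_nonneg: "0 \<le> real k * (real k - 1)"
  by (cases k) auto

lemma half_edges_lim: "(\<lambda>n. half_edges n / n) \<longlonglongrightarrow> mu_inf"
proof (rule Lim_transform_eventually[OF mu_lim])
  show "\<forall>\<^sub>F n in sequentially. mean_degree n (d n) = half_edges n / n"
    using eventually_ge_at_top[of 1] by eventually_elim (simp add: mean_degree_eq_sum half_edges_def)
qed

lemma degree_pairs_lim: "(\<lambda>n. degree_pairs n / n) \<longlonglongrightarrow> nu_inf * mu_inf"
proof (rule Lim_transform_eventually[OF tendsto_mult[OF nu_lim mu_lim]])
  have "\<forall>\<^sub>F n in sequentially. mean_degree n (d n) > 0" by (rule order_tendstoD(1)[OF mu_lim mu_pos])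
  then show "\<forall>\<^sub>F n in sequentially. nu n (d n) * mean_degree n (d n) = degree_pairs n / n"
    by eventually_elim (simp add: nu_def degree_pairs_def)
qed

lemma nu_inf_nonneg: "nu_inf \<ge> 0"
proof (rule tendsto_lowerbound[OF nu_lim])
  have "\<forall>\<^sub>F n in sequentially. mean_degree n (d n) > 0" by (rule order_tendstoD(1)[OF mu_lim mu_pos])
  then show "\<forall>\<^sub>F n in sequentially. 0 \<le> nu n (d n)"
    by eventually_elim (unfold nu_def, intro mult_nonneg_nonneg sum_nonneg degree_pair_nonneg, simp)
qed simp

definition trunc :: "real \<Rightarrow> nat \<Rightarrow> nat" where
  "trunc K n = nat \<lceil>K * scale n\<rceil>"

text \<open>The value of Q for an exploration cut off after \<open>trunc K n\<close> vertices: it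
  reserves the switching loss and 2 * \<Delta> half-edges for each revealed vertex.\<close>

definition residual :: "real \<Rightarrow> nat \<Rightarrow> real" where
  "residual K n = half_edges n - 2 * real (max_degree n (d n)) * (real (max_degree n (d n)) + 1)
     - 2 * real (max_degree n (d n)) * real (trunc K n)"

lemma trunc_bounds:
  assumes "K \<ge> 0"
  shows "K * scale n \<le> trunc K n" "trunc K n \<le> K * scale n + 1"
proof -
  have "real (nat \<lceil>K * scale n\<rceil>) = of_int \<lceil>K * scale n\<rceil>"
    using mult_nonneg_nonneg[OF assms scale_nonneg[of n]] by simp
  then show "K * scale n \<le> trunc K n" "trunc K n \<le> K * scale n + 1"
    unfolding trunc_def by linarith+
qed

lemma degree_le_max: "i \<in> {1..n} \<Longrightarrow> d n i \<le> max_degree n (d n)"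
  unfolding max_degree_def by (intro Max_ge) auto

lemma max_degree_attained:
  assumes "n \<ge> 1"
  obtains v where "v \<in> {1..n}" "d n v = max_degree n (d n)"
proof -
  have "max_degree n (d n) \<in> d n ` {1..n}" unfolding max_degree_def using assms by (intro Max_in) auto
  then show thesis using that by auto
qed

lemma residual_le: "residual K n \<le> half_edges n"
proof -
  have "0 \<le> 2 * real (max_degree n (d n)) * (real (max_degree n (d n)) + 1)
     + 2 * real (max_degree n (d n)) * real (trunc K n)" by simp
  then show ?thesis unfolding residual_def by linarith
qed

text \<open>\<Delta> and \<open>trunc K n\<close> are both O(\<open>scale n\<close>), so the
  difference is of the order of the squared scale, hence o(n).\<close>

lemma residual_diff_lim:
  assumes K: "K \<ge> 0"
  shows "(\<lambda>n. (half_edges n - residual K n) / n) \<longlonglongrightarrow> 0"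
proof -
  obtain c where c: "c > 0" "\<And>n i. n \<ge> 1 \<Longrightarrow> i \<in> {1..n} \<Longrightarrow> real (d n i) \<le> c * scale n"
    by (rule degree_le_scale) blast
  define b where "b = 2 * c * (c + 1) + 2 * c * (K + 1)"
  show ?thesis
  proof (rule tendsto_sandwich[OF _ _ tendsto_const])
    show "\<forall>\<^sub>F n in sequentially. 0 \<le> (half_edges n - residual K n) / n"
      using residual_le by simp
    show "\<forall>\<^sub>F n in sequentially. (half_edges n - residual K n) / n \<le> b * ((scale n)\<^sup>2 / n)"
      using eventually_ge_at_top[of 1]
    proof eventually_elim
      case (elim n)
      define D where "D = real (max_degree n (d n))"
      define s where "s = scale n"
      have s: "s \<ge> 1" using scale_ge_1[OF elim] by (simp add: s_def)
      obtain v where v: "v \<in> {1..n}" "d n v = max_degree n (d n)" by (rule max_degree_attained[OF elim])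
      have D: "0 \<le> D" "D \<le> c * s" using c(2)[OF elim v(1)] v(2) by (simp_all add: D_def s_def)
      have T: "real (trunc K n) \<le> (K + 1) * s"
        using trunc_bounds(2)[OF K, of n] s by (simp add: s_def algebra_simps)
      have "half_edges n - residual K n = 2 * D * (D + 1) + 2 * D * real (trunc K n)"
        by (simp add: residual_def D_def)
      also have "\<dots> \<le> 2 * (c * s) * (c * s + s) + 2 * (c * s) * ((K + 1) * s)"
        using D T s c by (intro add_mono mult_mono) auto
      also have "\<dots> = b * s\<^sup>2" by (simp add: b_def algebra_simps power2_eq_square)
      finally have "half_edges n - residual K n \<le> b * s\<^sup>2" .
      then show ?case using elim by (simp add: s_def divide_right_mono)
    qed
    show "(\<lambda>n. b * ((scale n)\<^sup>2 / n)) \<longlonglongrightarrow> 0"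
      using tendsto_mult_right_zero[OF scale_square_div_tendsto] .
  qed
qed

lemma residual_lim:
  assumes K: "K \<ge> 0"
  shows "(\<lambda>n. residual K n / n) \<longlonglongrightarrow> mu_inf"
  using tendsto_diff[OF half_edges_lim residual_diff_lim[OF K]] by (simp add: diff_divide_distrib)

lemma eventually_residual_pos:
  assumes K: "K \<ge> 0"
  shows "\<forall>\<^sub>F n in sequentially. residual K n > 0"
proof -
  have "\<forall>\<^sub>F n in sequentially. residual K n / n > 0" by (rule order_tendstoD(1)[OF residual_lim[OF K] mu_pos])
  then show ?thesis by eventually_elim (auto simp: zero_less_divide_iff)
qed

text \<open>Divided by h * s * n, the expanded sum becomes \<mu> / h + \<nu> * \<mu> plus an error
  of order s * exp b * \<open>scale n\<close> powr (1 - \<beta>), while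
  \<open>residual K n / n\<close> tends to \<mu>; so 1 / h + \<nu> < 1 leaves a positive margin. The
  sequence b bounds the exponents of the vertices outside B.\<close>

lemma eventually_exp_drift:
  fixes s b :: "nat \<Rightarrow> real"
  assumes K: "K \<ge> 0" and h: "h \<ge> 1" "1 / h + nu_inf < 1"
    and s: "\<forall>\<^sub>F n in sequentially. s n > 0"
    and b: "\<forall>\<^sub>F n in sequentially. \<forall>i\<in>{1..n} - B n. h * s n * real (d n i) \<le> b n"
    and lim: "(\<lambda>n. s n * exp (b n) * scale n powr (1 - \<beta>)) \<longlonglongrightarrow> 0"
  shows "\<forall>\<^sub>F n in sequentially. (\<Sum>i\<in>{1..n} - B n. real (d n i) * (exp (s n) * (1 + h * s n) ^ (d n i - 1) - 1))
    \<le> h * s n * residual K n"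
proof -
  obtain c where c: "c > 0"
    "\<And>n. n \<ge> 1 \<Longrightarrow> (\<Sum>i=1..n. real (d n i) ^ 3) \<le> c * real n * scale n powr (1 - \<beta>)"
    by (rule third_moment_le) blast
  have "(\<lambda>n. residual K n / n - (1 / h * (half_edges n / n) + degree_pairs n / n
      + h * c * (s n * exp (b n) * scale n powr (1 - \<beta>))))
      \<longlonglongrightarrow> mu_inf - (1 / h * mu_inf + nu_inf * mu_inf + h * c * 0)"
    by (intro tendsto_diff tendsto_add tendsto_mult tendsto_const half_edges_lim degree_pairs_lim lim
        residual_lim[OF K])
  moreover have "mu_inf - (1 / h * mu_inf + nu_inf * mu_inf + h * c * 0) > 0"
  proof -
    have "mu_inf * (1 - (1 / h + nu_inf)) > 0" using h mu_pos by (intro mult_pos_pos) auto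
    then show ?thesis by (simp add: algebra_simps)
  qed
  ultimately have "\<forall>\<^sub>F n in sequentially. 0 < residual K n / n - (1 / h * (half_edges n / n) + degree_pairs n / n
      + h * c * (s n * exp (b n) * scale n powr (1 - \<beta>)))"
    by (rule order_tendstoD)
  then show ?thesis using s b eventually_ge_at_top[of 1]
  proof eventually_elim
    case (elim n)
    let ?w = "scale n powr (1 - \<beta>)"
    have n: "real n > 0" using elim by simp
    have hs: "0 \<le> s n" "s n \<le> h * s n" using elim(2) h by auto
    have "(\<Sum>i\<in>{1..n} - B n. real (d n i) * (exp (s n) * (1 + h * s n) ^ (d n i - 1) - 1))
        \<le> (\<Sum>i\<in>{1..n} - B n. s n * d n i + h * s n * (d n i * (real (d n i) - 1)) + (h * s n)\<^sup>2 * exp (b n) * real (d n i) ^ 3)"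
      using elim(3) by (intro sum_mono degree_weight_le[OF hs]) auto
    also have "\<dots> \<le> (\<Sum>i=1..n. s n * d n i + h * s n * (d n i * (real (d n i) - 1)) + (h * s n)\<^sup>2 * exp (b n) * real (d n i) ^ 3)"
      using elim(2) h degree_pair_nonneg by (intro sum_mono2) auto
    also have "\<dots> = s n * half_edges n + h * s n * degree_pairs n + (h * s n)\<^sup>2 * exp (b n) * (\<Sum>i=1..n. real (d n i) ^ 3)"
      by (simp add: sum.distrib sum_distrib_left half_edges_def degree_pairs_def)
    also have "\<dots> \<le> s n * half_edges n + h * s n * degree_pairs n + (h * s n)\<^sup>2 * exp (b n) * (c * real n * ?w)"
      using c(2)[OF elim(4)] by (intro add_left_mono mult_left_mono) auto
    also have "\<dots> = (h * s n * n) * (1 / h * (half_edges n / n) + degree_pairs n / n + h * c * (s n * exp (b n) * ?w))"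
      using n h by (simp add: field_simps power2_eq_square)
    also have "\<dots> \<le> (h * s n * n) * (residual K n / n)"
      using elim(1,2) n h by (intro mult_left_mono) auto
    also have "\<dots> = h * s n * residual K n" using n by simp
    finally show ?case .
  qed
qed

text \<open>K must be fixed before n grows: it is chosen so that the pairs at vertices of degree
  above K use up less than the margin \<mu> * (1 - h * (1 - \<nu>)), positive because h is below 1 /
  (1 - \<nu>). For fixed K the half-edge losses and the R0 terms are o(n), so the same K serves
  every R0.\<close>

lemma eventually_drift:
  assumes K0: "K0 \<ge> 0" and h: "h > 0" "h - 1 < h * nu_inf"
  obtains K where "\<And>R0. \<forall>\<^sub>F n in sequentially. (h - 1) * residual K0 n + (1 + h) * (R0 * scale n)
    \<le> h * ((\<Sum>i | i \<in> {1..n} \<and> d n i \<le> K. real (d n i) * (real (d n i) - 1))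
        - 3 * real K * (half_edges n - residual K0 n) - real K * (R0 * scale n))"
proof -
  obtain c where c: "c > 0" "\<And>n K. n \<ge> 1 \<Longrightarrow> K \<ge> 1 \<Longrightarrow>
    (\<Sum>i | i \<in> {1..n} \<and> K < d n i. real (d n i) * (real (d n i) - 1)) \<le> c * real n * real K powr (- \<beta>)"
    by (rule second_moment_tail_le) blast
  have "(\<lambda>K. h * c * real K powr (- \<beta>)) \<longlonglongrightarrow> h * c * 0"
    using \<beta> by (intro tendsto_mult tendsto_const tendsto_neg_powr filterlim_real_sequentially) simp
  moreover have gap: "h * c * 0 < mu_inf * (h * nu_inf - h + 1)" using mu_pos h by simp
  ultimately have "\<forall>\<^sub>F K in sequentially. h * c * real K powr (- \<beta>) < mu_inf * (h * nu_inf - h + 1)"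
    by (rule order_tendstoD)
  then obtain K where K: "K \<ge> 1" "h * c * real K powr (- \<beta>) < mu_inf * (h * nu_inf - h + 1)"
    using eventually_ge_at_top[of 1] by (metis (mono_tags, lifting) eventually_conj eventually_sequentially order.refl)
  show thesis
  proof
    fix R0
    have "(\<lambda>n. h * (degree_pairs n / n - c * real K powr (- \<beta>) - 3 * real K * ((half_edges n - residual K0 n) / n)
          - real K * (R0 * (scale n / n))) - ((h - 1) * (residual K0 n / n) + (1 + h) * (R0 * (scale n / n))))
        \<longlonglongrightarrow> h * (nu_inf * mu_inf - c * real K powr (- \<beta>) - 3 * real K * 0 - real K * (R0 * 0))
          - ((h - 1) * mu_inf + (1 + h) * (R0 * 0))"
      by (intro tendsto_diff tendsto_add tendsto_mult tendsto_const degree_pairs_lim residual_diff_lim[OF K0]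
          residual_lim[OF K0] scale_div_tendsto)
    moreover have "h * (nu_inf * mu_inf - c * real K powr (- \<beta>) - 3 * real K * 0 - real K * (R0 * 0))
          - ((h - 1) * mu_inf + (1 + h) * (R0 * 0)) > 0"
      using K(2) by (simp add: algebra_simps)
    ultimately have "\<forall>\<^sub>F n in sequentially. 0 < h * (degree_pairs n / n - c * real K powr (- \<beta>)
          - 3 * real K * ((half_edges n - residual K0 n) / n)
          - real K * (R0 * (scale n / n))) - ((h - 1) * (residual K0 n / n) + (1 + h) * (R0 * (scale n / n)))"
      by (rule order_tendstoD)
    then show "\<forall>\<^sub>F n in sequentially. (h - 1) * residual K0 n + (1 + h) * (R0 * scale n)
      \<le> h * ((\<Sum>i | i \<in> {1..n} \<and> d n i \<le> K. real (d n i) * (real (d n i) - 1))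
        - 3 * real K * (half_edges n - residual K0 n) - real K * (R0 * scale n))"
      using eventually_ge_at_top[of 1]
    proof eventually_elim
      case (elim n)
      let ?f = "\<lambda>i. real (d n i) * (real (d n i) - 1)"
      have n: "real n > 0" using elim by simp
      have "degree_pairs n = (\<Sum>i | i \<in> {1..n} \<and> d n i \<le> K. ?f i) + (\<Sum>i | i \<in> {1..n} \<and> K < d n i. ?f i)"
        unfolding degree_pairs_def by (subst sum.union_disjoint[symmetric]) (auto intro!: sum.cong)
      also have "(\<Sum>i | i \<in> {1..n} \<and> K < d n i. ?f i) \<le> c * real n * real K powr (- \<beta>)"
        by (rule c(2)[OF elim(2) K(1)])
      finally have "degree_pairs n - c * real n * real K powr (- \<beta>) \<le> (\<Sum>i | i \<in> {1..n} \<and> d n i \<le> K. ?f i)"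
        by simp
      then have *: "h * (degree_pairs n - c * real n * real K powr (- \<beta>) - 3 * real K * (half_edges n - residual K0 n) - real K * (R0 * scale n))
         \<le> h * ((\<Sum>i | i \<in> {1..n} \<and> d n i \<le> K. ?f i) - 3 * real K * (half_edges n - residual K0 n) - real K * (R0 * scale n))"
        using h by (intro mult_left_mono) auto
      have "0 \<le> real n * (h * (degree_pairs n / n - c * real K powr (- \<beta>)
          - 3 * real K * ((half_edges n - residual K0 n) / n)
          - real K * (R0 * (scale n / n))) - ((h - 1) * (residual K0 n / n) + (1 + h) * (R0 * (scale n / n))))"
        using elim(1) n by (intro mult_nonneg_nonneg) auto
      also have "\<dots> = h * (degree_pairs n - c * real n * real K powr (- \<beta>) - 3 * real K * (half_edges n - residual K0 n) - real K * (R0 * scale n))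
          - ((h - 1) * residual K0 n + (1 + h) * (R0 * scale n))"
        using n by (simp add: field_simps)
      finally show ?case using * by linarith
    qed
  qed
qed

end

section \<open>Concentration and light components\<close>

lemma components_eq_reach:
  assumes E: "E \<in> simple_graphs V"
  shows "components V E = (\<lambda>u. reach E {u}) ` V"
proof -
  have "{w \<in> V. (u, w) \<in> (adjacency E)\<^sup>*} = reach E {u}" if "u \<in> V" for u
    using reach_subset[OF E, of "{u}"] that by (auto simp: reach_def)
  then show ?thesis by (auto simp: components_def)
qed

lemma reach_eq_of_mem:
  assumes w: "w \<in> reach E {u}"
  shows "reach E {w} = reach E {u}"
proof -
  have "sym ((adjacency E)\<^sup>*)"
    by (intro sym_rtrancl) (auto simp: sym_def adjacency_def insert_commute)
  moreover have "(u, w) \<in> (adjacency E)\<^sup>*" using w by (simp add: reach_def)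
  ultimately show ?thesis by (auto simp: reach_def dest: symD intro: rtrancl_trans)
qed

context subcritical_degrees
begin

abbreviation graphs :: "nat \<Rightarrow> nat set set set" where
  "graphs n \<equiv> degree_graphs {1..n} (d n)"

definition comp_size :: "real \<Rightarrow> nat \<Rightarrow> nat \<Rightarrow> nat set set \<Rightarrow> real" where
  "comp_size K n v G = real (min (card (reach G {v})) (trunc K n))"

lemma exp_comp_size_le:
  assumes s: "s \<ge> 0" and \<eta>: "\<eta> \<ge> 0" and Q: "residual K n > 0" and v: "v \<in> {1..n}"
    and drift: "(\<Sum>i\<in>{1..n} - B. real (d n i) * (exp s * (1 + \<eta>) ^ (d n i - 1) - 1)) \<le> \<eta> * residual K n"
  shows "(\<Sum>G\<in>graphs n. of_bool (reach G {v} \<inter> B = {}) * exp (s * comp_size K n v G))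
    \<le> card (graphs n) * exp_weight s \<eta> B (d n) v"
proof -
  have "(\<Sum>G\<in>graphs n. of_bool (reach G {v} \<inter> B = {}) * exp (s * min (card (reach G {v})) (trunc K n)))
    \<le> card (graphs n) * (\<Prod>a\<in>{v}. exp_weight s \<eta> B (d n) a)"
    using v by (intro exp_reach_le[OF _ degree_le_max s \<eta> Q drift]) (auto simp: residual_def half_edges_def)
  then show ?thesis by (simp add: comp_size_def)
qed

lemma scale_powr_neg_lim: "(\<lambda>n. scale n powr (- \<beta>)) \<longlonglongrightarrow> 0"
  using \<beta> by (intro tendsto_neg_powr filterlim_scale) simp

lemma inverse_scale_lim: "(\<lambda>n. 1 / scale n) \<longlonglongrightarrow> 0"
  using tendsto_inverse_0_at_top[OF filterlim_scale] by (simp add: inverse_eq_divide)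

text \<open>The exploration bounds with s = 1 / N, \<eta> = h' / N, c = N for N =
  \<open>scale n\<close>, started from A = {v}. In the lower bound the discounted term becomes exp
  (- K + 1 / N + h' * (d v / N)), since the horizon is at least K * N; as d v / N is bounded, a
  large K makes it negligible.\<close>

lemma eventually_moments:
  assumes K: "K \<ge> 0" and h': "h' \<ge> 1" "1 / h' + nu_inf < 1" and h: "0 < h" "h \<le> h'" "h - 1 < h * nu_inf"
  shows "\<forall>\<^sub>F n in sequentially. \<forall>v\<in>{1..n}.
      (\<Sum>G\<in>graphs n. exp (comp_size K n v G / scale n))
        \<le> card (graphs n) * exp (1 / scale n + h' * (d n v / scale n))
    \<and> card (graphs n) * (h * (d n v / scale n) - exp (- K + 1 / scale n + h' * (d n v / scale n)))
        \<le> (\<Sum>G\<in>graphs n. comp_size K n v G / scale n)"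
proof -
  obtain c where c: "c > 0" "\<And>n i. n \<ge> 1 \<Longrightarrow> i \<in> {1..n} \<Longrightarrow> real (d n i) \<le> c * scale n"
    by (rule degree_le_scale) blast
  obtain k where drift: "\<And>R0. \<forall>\<^sub>F n in sequentially. (h - 1) * residual K n + (1 + h) * (R0 * scale n)
    \<le> h * ((\<Sum>i | i \<in> {1..n} \<and> d n i \<le> k. real (d n i) * (real (d n i) - 1))
        - 3 * real k * (half_edges n - residual K n) - real k * (R0 * scale n))"
    by (rule eventually_drift[OF K h(1,3)]) blast
  have "\<forall>\<^sub>F n in sequentially. (\<Sum>i\<in>{1..n} - {}. real (d n i) * (exp (1 / scale n) * (1 + h' * (1 / scale n)) ^ (d n i - 1) - 1))
    \<le> h' * (1 / scale n) * residual K n"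
  proof (rule eventually_exp_drift[OF K h'])
    show "\<forall>\<^sub>F n in sequentially. 1 / scale n > 0"
      using eventually_ge_at_top[of 1] by eventually_elim (simp add: scale_pos)
    show "\<forall>\<^sub>F n in sequentially. \<forall>i\<in>{1..n} - {}. h' * (1 / scale n) * real (d n i) \<le> h' * c"
      using eventually_ge_at_top[of 1]
    proof eventually_elim
      case (elim n)
      show ?case
      proof
        fix i assume "i \<in> {1..n} - {}"
        then have "real (d n i) / scale n \<le> c" using c(2)[OF elim, of i] scale_pos[OF elim] by (simp add: field_simps)
        then have "h' * (real (d n i) / scale n) \<le> h' * c" using h' by (intro mult_left_mono) auto
        then show "h' * (1 / scale n) * real (d n i) \<le> h' * c" by simp
      qed
    qed
    have "(\<lambda>n. exp (h' * c) * scale n powr (- \<beta>)) \<longlonglongrightarrow> 0"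
      by (intro tendsto_mult_right_zero scale_powr_neg_lim)
    then show "(\<lambda>n. 1 / scale n * exp (h' * c) * scale n powr (1 - \<beta>)) \<longlonglongrightarrow> 0"
    proof (rule Lim_transform_eventually)
      show "\<forall>\<^sub>F n in sequentially. exp (h' * c) * scale n powr (- \<beta>) = 1 / scale n * exp (h' * c) * scale n powr (1 - \<beta>)"
        using eventually_ge_at_top[of 1]
      proof eventually_elim
        case (elim n)
        have "scale n powr (- \<beta>) = scale n powr (1 - \<beta>) / scale n"
          using scale_pos[OF elim] by (simp add: powr_diff powr_minus field_simps)
        then show ?case by simp
      qed
    qed
  qed
  moreover have "\<forall>\<^sub>F n in sequentially. h' \<le> scale n"
    using filterlim_scale by (simp add: filterlim_at_top)
  ultimately show ?thesis
    using drift[of "8 * exp (K + 1) / h'"] eventually_residual_pos[OF K] eventually_ge_at_top[of 1]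
  proof eventually_elim
    case (elim n)
    define N where "N = scale n"
    define T where "T = trunc K n"
    define g where "g = real (card (graphs n))"
    \<comment> \<open>The threshold at which the growth of the weight compensates the discount over
      the whole horizon; being O(N), it is negligible in the drift.\<close>
    define R where "R = 8 * exp (K + 1) / h' * N"
    have N: "N \<ge> 1" "N > 0" using scale_ge_1[OF elim(5)] by (auto simp: N_def)
    have T: "K * N \<le> T" "T \<le> K * N + 1" using trunc_bounds[OF K, of n] by (auto simp: N_def T_def)
    have ed: "(\<Sum>i\<in>{1..n} - {}. real (d n i) * (exp (1 / N) * (1 + h' / N) ^ (d n i - 1) - 1)) \<le> h' / N * residual K n"
      using elim(1) by (simp add: N_def)
    show ?case
    proof (intro ballI conjI)
      fix v assume v: "v \<in> {1..n}"
      have pw: "exp (1 / N) * (1 + h' / N) ^ d n v \<le> exp (1 / N + h' * (d n v / N))"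
      proof -
        have "(1 + h' / N) ^ d n v \<le> exp (h' / N) ^ d n v"
          using N h' by (intro power_mono exp_ge_add_one_self) auto
        also have "\<dots> = exp (h' * (d n v / N))" by (simp add: exp_of_nat2_mult[symmetric])
        finally show ?thesis by (simp add: exp_add)
      qed
      have "(\<Sum>G\<in>graphs n. of_bool (reach G {v} \<inter> {} = {}) * exp (1 / N * comp_size K n v G)) \<le> g * exp_weight (1 / N) (h' / N) {} (d n) v"
        unfolding g_def using N h' by (intro exp_comp_size_le elim(4) v ed) auto
      also have "\<dots> \<le> g * exp (1 / N + h' * (d n v / N))"
        using pw by (intro mult_left_mono) (auto simp: g_def exp_weight_def)
      finally show "(\<Sum>G\<in>graphs n. exp (comp_size K n v G / scale n))
        \<le> card (graphs n) * exp (1 / scale n + h' * (d n v / scale n))" by (simp add: g_def N_def)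
      have "g * (card {v} + h * (\<Sum>a\<in>{v}. real (d n a)) - N * exp (- (1 / N) * T) * (\<Prod>a\<in>{v}. exp_weight (1 / N) (h' / N) {} (d n) a))
        \<le> (\<Sum>G\<in>graphs n. real (min (card (reach G {v})) T))"
      proof -
        have ed': "(\<Sum>y\<in>{1..n}. real (d n y) * (exp (1 / N) * (1 + h' / N) ^ (d n y - 1) - 1)) \<le> h' / N * residual K n"
          using ed by simp
        have dr: "(h - 1) * residual K n + (1 + h) * R \<le> h * ((\<Sum>y | y \<in> {1..n} \<and> d n y \<le> k. real (d n y) * (real (d n y) - 1))
            - 3 * real k * ((\<Sum>y\<in>{1..n}. real (d n y)) - residual K n) - real k * R)"
          using elim(3) by (simp add: R_def N_def half_edges_def)
        have small: "real a + h * real m \<le> N * (exp (1 / N * real a) * (1 + h' / N) ^ m)" for a m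
          using N h by (intro linear_le_exp_weight) auto
        have large: "real a + h * real m \<le> N * exp (- (1 / N) * real T) * (exp (1 / N * real a) * (1 + h' / N) ^ m)"
          if "R \<le> real m" for a m
          using N h h' T K that elim(2) by (intro linear_le_exp_weight_large[of N h' h T K]) (auto simp: R_def N_def)
        have nn: "0 \<le> 1 / N" "0 \<le> h' / N" "0 \<le> h" "0 \<le> N" using N h h' by auto
        have hs: "residual K n + 2 * real (max_degree n (d n)) * (real (max_degree n (d n)) + 1)
            + 2 * real (max_degree n (d n)) * real T \<le> (\<Sum>y\<in>{1..n}. real (d n y))"
          by (simp add: residual_def half_edges_def T_def)
        have vV: "{v} \<subseteq> {1..n}" using v by simp
        show ?thesis unfolding g_def
          by (rule sum_card_reach_ge[OF finite_atLeastAtMost degree_le_max nn(1,2) elim(4) nn(3,4) ed' dr small large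
            order.refl order.refl order.refl vV hs])
      qed
      then have "g * (1 + h * d n v - N * (exp (- (1 / N) * T) * (exp (1 / N) * (1 + h' / N) ^ d n v)))
          \<le> (\<Sum>G\<in>graphs n. comp_size K n v G)"
        by (simp add: comp_size_def T_def exp_weight_def mult.assoc)
      moreover have "g * (h * d n v - N * (exp (- K) * exp (1 / N + h' * (d n v / N))))
          \<le> g * (1 + h * d n v - N * (exp (- (1 / N) * T) * (exp (1 / N) * (1 + h' / N) ^ d n v)))"
      proof (intro mult_left_mono)
        have "K \<le> 1 / N * T" using T N by (simp add: field_simps)
        then have "exp (- (1 / N) * T) * (exp (1 / N) * (1 + h' / N) ^ d n v) \<le> exp (- K) * exp (1 / N + h' * (d n v / N))"
          using pw N h' by (intro mult_mono) auto
        then have "N * (exp (- (1 / N) * T) * (exp (1 / N) * (1 + h' / N) ^ d n v)) \<le> N * (exp (- K) * exp (1 / N + h' * (d n v / N)))"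
          using N by (intro mult_left_mono) auto
        then show "h * d n v - N * (exp (- K) * exp (1 / N + h' * (d n v / N)))
          \<le> 1 + h * d n v - N * (exp (- (1 / N) * T) * (exp (1 / N) * (1 + h' / N) ^ d n v))" by linarith
      qed (simp add: g_def)
      ultimately have "g * (h * d n v - N * (exp (- K) * exp (1 / N + h' * (d n v / N)))) / N
          \<le> (\<Sum>G\<in>graphs n. comp_size K n v G) / N"
        using N by (intro divide_right_mono) linarith+
      also have "g * (h * d n v - N * (exp (- K) * exp (1 / N + h' * (d n v / N)))) / N
          = g * (h * (d n v / N) - exp (- K + 1 / N + h' * (d n v / N)))"
      proof -
        have "exp (- K) * exp (1 / N + h' * (d n v / N)) = exp (- K + 1 / N + h' * (d n v / N))"
          by (simp add: mult_exp_exp add.assoc)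
        then show ?thesis using N by (simp add: right_diff_distrib diff_divide_distrib)
      qed
      finally show "card (graphs n) * (h * (d n v / scale n) - exp (- K + 1 / scale n + h' * (d n v / scale n)))
        \<le> (\<Sum>G\<in>graphs n. comp_size K n v G / scale n)"
        by (simp add: N_def g_def sum_divide_distrib)
    qed
  qed
qed

text \<open>
  Both one-sided estimates at once: \<open>exp y - 1 - y\<close> has small mean for
  \<open>y = (X - d v / (1 - nu_inf)) / scale n\<close> and is bounded below away from \<open>y = 0\<close>.
\<close>

lemma eventually_concentrated:
  fixes \<delta> \<rho> K1 :: real
  assumes \<delta>: "0 < \<delta>" "\<delta> \<le> 1" and \<rho>: "\<rho> > 0"
  obtains K where "K \<ge> K1" "K \<ge> 0"
    "\<forall>\<^sub>F n in sequentially. \<forall>v\<in>{1..n}.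
      card {G \<in> graphs n. \<delta> * scale n \<le> \<bar>comp_size K n v G - d n v / (1 - nu_inf)\<bar>} \<le> \<rho> * card (graphs n)"
proof -
  obtain c where c: "c > 0" "\<And>n i. n \<ge> 1 \<Longrightarrow> i \<in> {1..n} \<Longrightarrow> real (d n i) \<le> c * scale n"
    by (rule degree_le_scale) blast
  define q where "q = 1 - nu_inf"
  have q: "0 < q" "q \<le> 1" using nu_less nu_inf_nonneg by (auto simp: q_def)
  \<comment> \<open>Markov's inequality for exp y - 1 - y, which is at least \<delta>^2 / 4 on the
    bad event, needs a mean of at most \<tau>.\<close>
  define \<tau> where "\<tau> = \<rho> * \<delta>\<^sup>2 / 4"
  have \<tau>: "\<tau> > 0" using \<delta> \<rho> by (simp add: \<tau>_def)
  \<comment> \<open>The slopes 1 / (q - e) and 1 / (q + e) bracket 1 / q; the contribution of their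
    distance vanishes as e tends to 0, uniformly for d v / N \<le> c.\<close>
  have "((\<lambda>e. exp ((1 / (q - e) - 1 / q) * c) - 1 + (1 / q - 1 / (q + e)) * c)
      \<longlongrightarrow> exp ((1 / (q - 0) - 1 / q) * c) - 1 + (1 / q - 1 / (q + 0)) * c) (at_right 0)"
    using q by (intro tendsto_intros) auto
  then have "\<forall>\<^sub>F e in at_right 0. exp ((1 / (q - e) - 1 / q) * c) - 1 + (1 / q - 1 / (q + e)) * c < \<tau> / 2"
    using \<tau> by (intro order_tendstoD(2)) auto
  moreover have "\<forall>\<^sub>F e in at_right 0. e \<in> {0<..<q}" using q by (intro eventually_at_right_real) auto
  ultimately have "\<forall>\<^sub>F e in at_right 0. exp ((1 / (q - e) - 1 / q) * c) - 1 + (1 / q - 1 / (q + e)) * c < \<tau> / 2 \<and> e \<in> {0<..<q}"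
    by (rule eventually_conj)
  then obtain e where e: "exp ((1 / (q - e) - 1 / q) * c) - 1 + (1 / q - 1 / (q + e)) * c < \<tau> / 2" "0 < e" "e < q"
    using eventually_happens'[of "at_right (0::real)"] by fastforce
  define h' where "h' = 1 / (q - e)"
  define h where "h = 1 / (q + e)"
  have h': "h' \<ge> 1" "1 / h' + nu_inf < 1" using e q by (auto simp: h'_def q_def)
  have h: "0 < h" "h \<le> h'" "h - 1 < h * nu_inf"
  proof -
    show "0 < h" "h \<le> h'" using e q by (auto simp: h_def h'_def intro!: divide_left_mono)
    have "h * q < 1" using e q by (simp add: h_def field_simps)
    then show "h - 1 < h * nu_inf" by (simp add: q_def algebra_simps)
  qed
  have hq: "1 / q \<le> h'" "h \<le> 1 / q" using e q by (auto simp: h_def h'_def intro!: divide_left_mono)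
  \<comment> \<open>The logarithm makes the truncation term exp (- K + h' * c) at most \<tau> / 4;
    K1 is the level that the application demands.\<close>
  define K where "K = Max {K1, 0, h' * c - ln (\<tau> / 4)}"
  have K: "K \<ge> K1" "K \<ge> 0" "h' * c - ln (\<tau> / 4) \<le> K" by (auto simp: K_def)
  have "exp (- K + h' * c) \<le> exp (ln (\<tau> / 4))" using K(3) by simp
  then have eK: "exp (- K + h' * c) \<le> \<tau> / 4" using \<tau> by simp
  have "(\<lambda>n. exp (1 / scale n + (h' - 1 / q) * c) - 1 + (1 / q - h) * c + exp (- K + 1 / scale n + h' * c))
      \<longlonglongrightarrow> exp (0 + (h' - 1 / q) * c) - 1 + (1 / q - h) * c + exp (- K + 0 + h' * c)"
    by (intro tendsto_intros inverse_scale_lim)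
  moreover have "exp (0 + (h' - 1 / q) * c) - 1 + (1 / q - h) * c + exp (- K + 0 + h' * c) < \<tau>"
    using e(1) eK \<tau> by (simp add: h'_def h_def)
  ultimately have "\<forall>\<^sub>F n in sequentially. exp (1 / scale n + (h' - 1 / q) * c) - 1 + (1 / q - h) * c
      + exp (- K + 1 / scale n + h' * c) < \<tau>"
    by (rule order_tendstoD(2))
  then have "\<forall>\<^sub>F n in sequentially. \<forall>v\<in>{1..n}.
      card {G \<in> graphs n. \<delta> * scale n \<le> \<bar>comp_size K n v G - d n v / (1 - nu_inf)\<bar>} \<le> \<rho> * card (graphs n)"
    using eventually_moments[OF K(2) h' h] eventually_ge_at_top[of 1]
  proof eventually_elim
    case (elim n)
    have N: "scale n > 0" using scale_pos[OF elim(3)] .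
    show ?case
    proof
      fix v assume v: "v \<in> {1..n}"
      define t where "t = real (d n v) / scale n"
      define g where "g = real (card (graphs n))"
      define y where "y G = comp_size K n v G / scale n - t / q" for G
      have t: "0 \<le> t" "t \<le> c" using c(2)[OF elim(3) v] N by (auto simp: t_def field_simps)
      have fin: "finite (graphs n)" by (rule finite_degree_graphs) simp
      have eq: "{G \<in> graphs n. \<delta> * scale n \<le> \<bar>comp_size K n v G - d n v / (1 - nu_inf)\<bar>} = {G \<in> graphs n. \<delta> \<le> \<bar>y G\<bar>}"
      proof -
        have "comp_size K n v G - d n v / (1 - nu_inf) = y G * scale n" for G
          using N by (simp add: y_def t_def q_def[symmetric] field_simps)
        then show ?thesis using N by (simp add: abs_mult)
      qed
      have "real (card {G \<in> graphs n. \<delta> \<le> \<bar>y G\<bar>}) * (\<delta>\<^sup>2 / 4) = (\<Sum>G | G \<in> graphs n \<and> \<delta> \<le> \<bar>y G\<bar>. \<delta>\<^sup>2 / 4)" by simp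
      also have "\<dots> \<le> (\<Sum>G | G \<in> graphs n \<and> \<delta> \<le> \<bar>y G\<bar>. exp (y G) - 1 - y G)"
        by (intro sum_mono exp_minus_linear_ge[OF \<delta>]) auto
      also have "\<dots> \<le> (\<Sum>G\<in>graphs n. exp (y G) - 1 - y G)"
      proof (rule sum_mono2[OF fin])
        show "0 \<le> exp (y G) - 1 - y G" for G using exp_ge_add_one_self[of "y G"] by linarith
      qed auto
      also have "\<dots> = exp (- t / q) * (\<Sum>G\<in>graphs n. exp (comp_size K n v G / scale n)) - g
          - (\<Sum>G\<in>graphs n. comp_size K n v G / scale n) + g * (t / q)"
      proof -
        have "exp (y G) = exp (- t / q) * exp (comp_size K n v G / scale n)" for G
          by (simp add: y_def mult_exp_exp)
        then show ?thesis by (simp add: sum_subtractf sum_distrib_left y_def g_def)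
      qed
      also have "\<dots> \<le> exp (- t / q) * (g * exp (1 / scale n + h' * t)) - g
          - g * (h * t - exp (- K + 1 / scale n + h' * t)) + g * (t / q)"
        using elim(2) v unfolding g_def t_def by (intro add_mono diff_mono mult_left_mono order.refl) auto
      also have "\<dots> = g * (exp (1 / scale n + (h' - 1 / q) * t) - 1 + (1 / q - h) * t + exp (- K + 1 / scale n + h' * t))"
      proof -
        have "exp (- t / q) * exp (1 / scale n + h' * t) = exp (1 / scale n + (h' - 1 / q) * t)"
          by (simp add: mult_exp_exp algebra_simps)
        then have "exp (- t / q) * (g * exp (1 / scale n + h' * t)) = g * exp (1 / scale n + (h' - 1 / q) * t)"
          by (simp add: mult.left_commute)
        then show ?thesis by (simp only: algebra_simps) simp
      qed
      \<comment> \<open>Every term is nondecreasing in t, so t \<le> c makes the bound uniform in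
        v.\<close>
      also have "\<dots> \<le> g * (exp (1 / scale n + (h' - 1 / q) * c) - 1 + (1 / q - h) * c + exp (- K + 1 / scale n + h' * c))"
        using t hq h' unfolding g_def
        by (intro mult_left_mono add_mono diff_mono order.refl iffD2[OF exp_le_cancel_iff]) (auto intro!: mult_left_mono add_mono)
      also have "\<dots> \<le> g * \<tau>" using elim(1) by (intro mult_left_mono) (auto simp: g_def)
      also have "\<dots> = (\<rho> * g) * (\<delta>\<^sup>2 / 4)" by (simp add: \<tau>_def)
      finally have "real (card {G \<in> graphs n. \<delta> \<le> \<bar>y G\<bar>}) \<le> \<rho> * g"
        using \<delta> by (simp add: mult_le_cancel_right)
      then show "card {G \<in> graphs n. \<delta> * scale n \<le> \<bar>comp_size K n v G - d n v / (1 - nu_inf)\<bar>} \<le> \<rho> * card (graphs n)"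
        unfolding eq g_def .
    qed
  qed
  then show thesis using that K by blast
qed

text \<open>Exponential Markov inequality with s = \<kappa> * ln n / N: a light component of size
  \<delta> * N contributes at least exp (s * \<delta> * N) = n^3, while the starting weight of a
  light vertex is at most n. The resulting probability n^(-2) survives the union over all n
  vertices.\<close>

lemma eventually_no_large_light_component:
  assumes \<delta>: "\<delta> > 0"
  obtains \<epsilon> where "\<epsilon> > 0" "\<forall>\<^sub>F n in sequentially. \<forall>v\<in>{1..n}.
    card {G \<in> graphs n. reach G {v} \<inter> {i \<in> {1..n}. \<epsilon> * scale n \<le> d n i} = {} \<and> \<delta> * scale n \<le> card (reach G {v})}
      * (real n)\<^sup>2 \<le> card (graphs n)"
proof -
  define \<kappa> where "\<kappa> = 3 / \<delta>"
  \<comment> \<open>Twice the critical slope is good enough, as only the order of magnitude of light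
    components matters.\<close>
  define h where "h = 2 / (1 - nu_inf)"
  have h: "h \<ge> 1" "1 / h + nu_inf < 1" using nu_less nu_inf_nonneg by (auto simp: h_def field_simps)
  have \<kappa>: "\<kappa> > 0" using \<delta> by (simp add: \<kappa>_def)
  \<comment> \<open>The powers (1 + h * s) ^ d of light vertices will be at most n^a, and \<epsilon>
    is solved from h * \<kappa> * \<epsilon> = a. The bound 1 / 2 keeps the starting weight below n;
    a < \<beta> / (\<gamma> - 1) lets N powr (- \<beta>) absorb n^a * ln n in the drift
    error.\<close>
  define a where "a = min (1 / 2) (\<beta> / (2 * (\<gamma> - 1)))"
  have a: "a > 0" "a \<le> 1 / 2" "a - \<beta> / (\<gamma> - 1) < 0"
  proof -
    define p where "p = \<beta> / (\<gamma> - 1)"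
    have p: "p > 0" using \<beta> gamma by (simp add: p_def)
    show "a > 0" "a \<le> 1 / 2" using \<beta> gamma by (auto simp: a_def)
    have "a \<le> \<beta> / (2 * (\<gamma> - 1))" by (simp add: a_def)
    also have "\<dots> = p / 2" by (simp add: p_def)
    finally have "a - p < 0" using p by linarith
    then show "a - \<beta> / (\<gamma> - 1) < 0" by (simp add: p_def)
  qed
  define \<epsilon> where "\<epsilon> = a / (h * \<kappa>)"
  have \<epsilon>: "\<epsilon> > 0" "h * \<kappa> * \<epsilon> = a" using a h \<kappa> by (auto simp: \<epsilon>_def)
  define B where "B n = {i \<in> {1..n}. \<epsilon> * scale n \<le> real (d n i)}" for n
  define s where "s n = \<kappa> * ln (real n) / scale n" for n
  have sb: "h * s n * real (d n i) \<le> a * ln n" if "n \<ge> 1" "i \<in> {1..n} - B n" for n i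
  proof -
    have N: "scale n > 0" using scale_pos that(1) by blast
    have "real (d n i) \<le> \<epsilon> * scale n" using that by (auto simp: B_def)
    then have "h * s n * real (d n i) \<le> h * s n * (\<epsilon> * scale n)"
      using h \<kappa> N that by (intro mult_left_mono) (auto simp: s_def)
    also have "\<dots> = h * \<kappa> * \<epsilon> * ln n" using N by (simp add: s_def)
    finally show ?thesis by (simp add: \<epsilon>(2))
  qed
  have drift: "\<forall>\<^sub>F n in sequentially. (\<Sum>i\<in>{1..n} - B n. real (d n i) * (exp (s n) * (1 + h * s n) ^ (d n i - 1) - 1))
    \<le> h * s n * residual \<delta> n"
  proof (rule eventually_exp_drift[OF less_imp_le[OF \<delta>] h])
    show "\<forall>\<^sub>F n in sequentially. s n > 0"
      using eventually_ge_at_top[of 2] by eventually_elim (auto simp: s_def \<kappa> intro!: divide_pos_pos mult_pos_pos scale_pos)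
    show "\<forall>\<^sub>F n in sequentially. \<forall>i\<in>{1..n} - B n. h * s n * real (d n i) \<le> a * ln n"
      using eventually_ge_at_top[of 1] by eventually_elim (use sb in blast)
    have "(\<lambda>n. \<kappa> * (ln (real n) / real n powr (\<beta> / (\<gamma> - 1) - a))) \<longlonglongrightarrow> \<kappa> * 0"
      using a by (intro tendsto_mult tendsto_const lim_ln_over_power) simp
    then have "(\<lambda>n. \<kappa> * (ln (real n) / real n powr (\<beta> / (\<gamma> - 1) - a))) \<longlonglongrightarrow> 0" by simp
    then show "(\<lambda>n. s n * exp (a * ln n) * scale n powr (1 - \<beta>)) \<longlonglongrightarrow> 0"
    proof (rule Lim_transform_eventually)
      show "\<forall>\<^sub>F n in sequentially. \<kappa> * (ln (real n) / real n powr (\<beta> / (\<gamma> - 1) - a)) = s n * exp (a * ln n) * scale n powr (1 - \<beta>)"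
        using eventually_ge_at_top[of 1]
      proof eventually_elim
        case (elim n)
        have n: "real n > 0" using elim by simp
        have N: "scale n > 0" using scale_pos elim by blast
        have "scale n powr (1 - \<beta>) = scale n * scale n powr (- \<beta>)"
          using N by (simp add: powr_diff powr_minus field_simps)
        moreover have "scale n powr (- \<beta>) = real n powr (- (\<beta> / (\<gamma> - 1)))"
          by (simp add: scale_def powr_powr)
        moreover have "exp (a * ln n) = real n powr a" using n by (simp add: powr_def)
        ultimately have "s n * exp (a * ln n) * scale n powr (1 - \<beta>) = \<kappa> * ln n * (real n powr a * real n powr (- (\<beta> / (\<gamma> - 1))))"
          using N by (simp add: s_def)
        also have "real n powr a * real n powr (- (\<beta> / (\<gamma> - 1))) = real n powr (- (\<beta> / (\<gamma> - 1) - a))"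
          by (simp add: powr_add[symmetric])
        also have "\<dots> = 1 / real n powr (\<beta> / (\<gamma> - 1) - a)" unfolding powr_minus by (simp add: inverse_eq_divide)
        finally show ?case by simp
      qed
    qed
  qed
  have "\<forall>\<^sub>F n in sequentially. 2 * \<kappa> \<le> scale n"
    using filterlim_scale by (simp add: filterlim_at_top)
  then have "\<forall>\<^sub>F n in sequentially. \<forall>v\<in>{1..n}.
    card {G \<in> graphs n. reach G {v} \<inter> B n = {} \<and> \<delta> * scale n \<le> card (reach G {v})} * (real n)\<^sup>2 \<le> card (graphs n)"
    using drift eventually_residual_pos[OF less_imp_le[OF \<delta>]] eventually_ge_at_top[of 1]
  proof eventually_elim
    case (elim n)
    have n: "real n \<ge> 1" using elim by simp
    have N: "scale n > 0" using scale_pos elim by blast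
    have s0: "s n \<ge> 0" using n N \<kappa> by (simp add: s_def)
    have fin: "finite (graphs n)" by (rule finite_degree_graphs) simp
    show ?case
    proof
      fix v assume v: "v \<in> {1..n}"
      let ?E = "{G \<in> graphs n. reach G {v} \<inter> B n = {} \<and> \<delta> * scale n \<le> card (reach G {v})}"
      show "card ?E * (real n)\<^sup>2 \<le> card (graphs n)"
      proof (cases "v \<in> B n")
        case True
        then have E0: "?E = {}" using subset_reach by fastforce
        show ?thesis unfolding E0 by simp
      next
        case False
        have "card ?E * real n ^ 3 = (\<Sum>G\<in>?E. real n ^ 3)" by simp
        also have "\<dots> \<le> (\<Sum>G\<in>?E. of_bool (reach G {v} \<inter> B n = {}) * exp (s n * comp_size \<delta> n v G))"
        proof (rule sum_mono)
          fix G assume G: "G \<in> ?E"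
          have "\<delta> * scale n \<le> comp_size \<delta> n v G"
            using G trunc_bounds(1)[of \<delta> n] \<delta> by (auto simp: comp_size_def min_def)
          then have "s n * (\<delta> * scale n) \<le> s n * comp_size \<delta> n v G" using s0 by (rule mult_left_mono)
          moreover have "s n * (\<delta> * scale n) = 3 * ln n" using N \<delta> by (simp add: s_def \<kappa>_def)
          ultimately have "exp (3 * ln n) \<le> exp (s n * comp_size \<delta> n v G)" by simp
          moreover have "exp (3 * ln n) = real n ^ 3"
            using n exp_of_nat_mult[of 3 "ln n"] by simp
          ultimately show "real n ^ 3 \<le> of_bool (reach G {v} \<inter> B n = {}) * exp (s n * comp_size \<delta> n v G)"
            using G by simp
        qed
        also have "\<dots> \<le> (\<Sum>G\<in>graphs n. of_bool (reach G {v} \<inter> B n = {}) * exp (s n * comp_size \<delta> n v G))"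
          by (intro sum_mono2 fin) auto
        also have "\<dots> \<le> card (graphs n) * exp_weight (s n) (h * s n) (B n) (d n) v"
          using s0 h by (intro exp_comp_size_le elim v) auto
        also have "\<dots> \<le> card (graphs n) * real n"
        proof (intro mult_left_mono)
          have "(1 + h * s n) ^ d n v \<le> exp (h * s n) ^ d n v"
            using s0 h exp_ge_add_one_self[of "h * s n"] by (intro power_mono) auto
          also have "\<dots> = exp (h * s n * d n v)" by (simp add: exp_of_nat2_mult)
          also have "\<dots> \<le> exp (1 / 2 * ln n)"
          proof -
            have "h * s n * d n v \<le> a * ln n" using sb[of n v] elim(4) v False by simp
            also have "\<dots> \<le> 1 / 2 * ln n" using a n by (intro mult_right_mono) auto
            finally show ?thesis by simp
          qed
          finally have 1: "(1 + h * s n) ^ d n v \<le> exp (1 / 2 * ln n)" .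
          \<comment> \<open>Eventually 2 * \<kappa> \<le> \<open>scale n\<close>, so exp (s n) is at
            most the square root of n, the other half of the starting weight.\<close>
          have "s n = \<kappa> / scale n * ln n" by (simp add: s_def)
          also have "\<dots> \<le> 1 / 2 * ln n" using elim(1) N n by (intro mult_right_mono) (auto simp: field_simps)
          finally have "exp (s n) \<le> exp (1 / 2 * ln n)" by simp
          then have "exp (s n) * (1 + h * s n) ^ d n v \<le> exp (1 / 2 * ln n) * exp (1 / 2 * ln n)"
            using 1 s0 h by (intro mult_mono) auto
          also have "\<dots> = real n" using n by (simp add: mult_exp_exp)
          finally show "exp_weight (s n) (h * s n) (B n) (d n) v \<le> real n" using False by (simp add: exp_weight_def)
        qed simp
        finally have "real n * (card ?E * (real n)\<^sup>2) \<le> real n * card (graphs n)"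
          by (simp add: power2_eq_square power3_eq_cube mult_ac)
        then show ?thesis using n by simp
      qed
    qed
  qed
  then show thesis unfolding B_def by (rule that[OF \<epsilon>(1)])
qed

text \<open>The maximal degree is O(\<open>scale n\<close>), so the o(1) error in 1 / (1 - \<nu>) is
  multiplied by no more than the order of the scale.\<close>

lemma eventually_centering_close:
  assumes \<epsilon>: "\<epsilon> > 0"
  shows "\<forall>\<^sub>F n in sequentially.
    \<bar>real (max_degree n (d n)) / (1 - nu n (d n)) - real (max_degree n (d n)) / (1 - nu_inf)\<bar> \<le> \<epsilon> * scale n"
proof -
  obtain c where c: "c > 0" "\<And>n i. n \<ge> 1 \<Longrightarrow> i \<in> {1..n} \<Longrightarrow> real (d n i) \<le> c * scale n"
    by (rule degree_le_scale) blast
  have "(\<lambda>n. 1 / (1 - nu n (d n)) - 1 / (1 - nu_inf)) \<longlonglongrightarrow> 1 / (1 - nu_inf) - 1 / (1 - nu_inf)"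
    using nu_less by (intro tendsto_intros nu_lim) auto
  then have "(\<lambda>n. \<bar>1 / (1 - nu n (d n)) - 1 / (1 - nu_inf)\<bar>) \<longlonglongrightarrow> 0"
    by (simp add: tendsto_rabs_zero)
  then have "\<forall>\<^sub>F n in sequentially. \<bar>1 / (1 - nu n (d n)) - 1 / (1 - nu_inf)\<bar> < \<epsilon> / c"
    using \<epsilon> c by (intro order_tendstoD(2)) auto
  then show ?thesis using eventually_ge_at_top[of 1]
  proof eventually_elim
    case (elim n)
    obtain v where v: "v \<in> {1..n}" "d n v = max_degree n (d n)" by (rule max_degree_attained[OF elim(2)])
    let ?D = "real (max_degree n (d n))"
    have "\<bar>?D / (1 - nu n (d n)) - ?D / (1 - nu_inf)\<bar> = ?D * \<bar>1 / (1 - nu n (d n)) - 1 / (1 - nu_inf)\<bar>"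
    proof -
      have "?D / (1 - nu n (d n)) - ?D / (1 - nu_inf) = ?D * (1 / (1 - nu n (d n)) - 1 / (1 - nu_inf))"
        by (simp add: right_diff_distrib)
      then show ?thesis by (simp only: abs_mult abs_of_nat)
    qed
    also have "\<dots> \<le> (c * scale n) * (\<epsilon> / c)"
      using c(2)[OF elim(2) v(1)] v(2) elim(1) by (intro mult_mono) auto
    also have "\<dots> = \<epsilon> * scale n" using c by simp
    finally show ?case .
  qed
qed

text \<open>A deviation forces one of few events: some vertex lies in a large light component, or
  the truncated component size of a heavy vertex or of a vertex w of maximal degree is off. Outside
  them, a component that meets B is that of a heavy z, of size at most about d z / (1 - \<nu>) \<le>
  \<Delta> / (1 - \<nu>), and the component of w gives the matching lower bound.\<close>

lemma eventually_largest_component: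
  fixes C1 :: "nat \<Rightarrow> nat set set \<Rightarrow> nat set" and \<epsilon> r :: real
  assumes largest: "\<And>n G. n \<ge> 1 \<Longrightarrow> G \<in> graphs n \<Longrightarrow> is_largest_component {1..n} G (C1 n G)"
    and \<epsilon>: "\<epsilon> > 0" and r: "r > 0"
  shows "\<forall>\<^sub>F n in sequentially. real (card {G \<in> graphs n. \<epsilon> * scale n
      < \<bar>real (card (C1 n G)) - real (max_degree n (d n)) / (1 - nu n (d n))\<bar>}) \<le> r * card (graphs n)"
proof -
  define q where "q = 1 - nu_inf"
  have q: "q > 0" using nu_less by (simp add: q_def)
  define \<delta> where "\<delta> = min 1 (\<epsilon> / 2)"
  have \<delta>: "0 < \<delta>" "\<delta> \<le> 1" "\<delta> \<le> \<epsilon> / 2" using \<epsilon> by (auto simp: \<delta>_def)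
  obtain c where c: "c > 0" "\<And>n i. n \<ge> 1 \<Longrightarrow> i \<in> {1..n} \<Longrightarrow> real (d n i) \<le> c * scale n"
    by (rule degree_le_scale) blast
  obtain \<epsilon>0 where \<epsilon>0: "\<epsilon>0 > 0" and light: "\<forall>\<^sub>F n in sequentially. \<forall>v\<in>{1..n}.
    card {G \<in> graphs n. reach G {v} \<inter> {i \<in> {1..n}. \<epsilon>0 * scale n \<le> d n i} = {} \<and> \<delta> * scale n \<le> card (reach G {v})}
      * (real n)\<^sup>2 \<le> card (graphs n)"
    by (rule eventually_no_large_light_component[OF \<delta>(1)])
  define b where "b = C * \<epsilon>0 powr (1 - \<gamma>)"
  have b: "b \<ge> 0" using C_nonneg by (simp add: b_def)
  \<comment> \<open>Half of r is shared by at most b + 1 vertices, the heavy ones and w; the other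
    half covers the n events of probability n^(-2).\<close>
  define \<rho> where "\<rho> = r / (2 * (b + 1))"
  have \<rho>: "\<rho> > 0" using r b by (simp add: \<rho>_def)
  \<comment> \<open>The truncation level K * N has to reach d v / q + \<delta> * N, so that the
    truncated size detects a component that is too large.\<close>
  obtain K where K: "K \<ge> c / q + 1" "K \<ge> 0" and conc: "\<forall>\<^sub>F n in sequentially. \<forall>v\<in>{1..n}.
      card {G \<in> graphs n. \<delta> * scale n \<le> \<bar>comp_size K n v G - d n v / (1 - nu_inf)\<bar>} \<le> \<rho> * card (graphs n)"
    by (rule eventually_concentrated[OF \<delta>(1,2) \<rho>])
  have "\<forall>\<^sub>F n in sequentially. 1 / real n < r / 2"
    using r by (intro order_tendstoD(2)[OF lim_1_over_n]) auto
  then show ?thesis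
    using light conc eventually_centering_close[OF half_gt_zero[OF \<epsilon>]] eventually_ge_at_top[of 1]
  proof eventually_elim
    case (elim n)
    have n1: "n \<ge> 1" using elim(5) by simp
    have N: "scale n > 0" using scale_pos[OF n1] .
    define B where "B = {i \<in> {1..n}. \<epsilon>0 * scale n \<le> real (d n i)}"
    define g where "g = real (card (graphs n))"
    obtain w where w: "w \<in> {1..n}" "d n w = max_degree n (d n)" by (rule max_degree_attained[OF n1])
    define L where "L v = {G \<in> graphs n. reach G {v} \<inter> B = {} \<and> \<delta> * scale n \<le> card (reach G {v})}" for v
    define H where "H v = {G \<in> graphs n. \<delta> * scale n \<le> \<bar>comp_size K n v G - d n v / (1 - nu_inf)\<bar>}" for v
    define X where "X = {G \<in> graphs n. \<epsilon> * scale n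
      < \<bar>real (card (C1 n G)) - real (max_degree n (d n)) / (1 - nu n (d n))\<bar>}"
    let ?D = "real (max_degree n (d n))"
    have fin: "finite (graphs n)" by (rule finite_degree_graphs) simp
    have finLH: "finite (L v)" "finite (H v)" for v using fin by (auto simp: L_def H_def)
    have finB: "finite B" by (simp add: B_def)
    have large: "real (card (reach G {v})) < d n v / q + \<delta> * scale n" 
      if "G \<in> graphs n" "v \<in> {1..n}" "G \<notin> H v" for G v
    proof (rule ccontr)
      assume "\<not> ?thesis"
      then have 1: "d n v / q + \<delta> * scale n \<le> real (card (reach G {v}))" by simp
      have "d n v / q \<le> c / q * scale n" using c(2)[OF n1 that(2)] q by (simp add: field_simps)
      moreover have "\<delta> * scale n \<le> 1 * scale n" using \<delta> N by (intro mult_right_mono) auto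
      ultimately have "d n v / q + \<delta> * scale n \<le> (c / q + 1) * scale n" by (simp add: algebra_simps)
      also have "\<dots> \<le> K * scale n" using K N by (intro mult_right_mono) auto
      also have "\<dots> \<le> trunc K n" by (rule trunc_bounds(1)[OF K(2)])
      finally have "d n v / q + \<delta> * scale n \<le> comp_size K n v G" using 1 by (simp add: comp_size_def min_def)
      then have "G \<in> H v" using that(1) by (simp add: H_def q_def)
      then show False using that(3) by simp
    qed
    \<comment> \<open>The vertex w is added to B because a vertex of maximal degree need not be
      heavy.\<close>
    have "X \<subseteq> (\<Union>v\<in>{1..n}. L v) \<union> (\<Union>v\<in>insert w B. H v)"
    proof (rule subsetI, rule ccontr)
      fix G assume GX: "G \<in> X" and not: "G \<notin> (\<Union>v\<in>{1..n}. L v) \<union> (\<Union>v\<in>insert w B. H v)"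
      have G: "G \<in> graphs n" using GX by (simp add: X_def)
      note sG = degree_graphs_simple[OF G]
      have lc: "C1 n G \<in> components {1..n} G" "\<And>C'. C' \<in> components {1..n} G \<Longrightarrow> card C' \<le> card (C1 n G)"
        using largest[OF n1 G] by (auto simp: is_largest_component_def)
      then obtain u where u: "u \<in> {1..n}" "C1 n G = reach G {u}"
        unfolding components_eq_reach[OF sG] by auto
      have Dq: "?D / q \<ge> 0" using q by simp
      have upper: "real (card (C1 n G)) < ?D / q + \<delta> * scale n"
      proof (cases "reach G {u} \<inter> B = {}")
        case True
        then have "real (card (C1 n G)) < \<delta> * scale n" using not u G by (auto simp: L_def)
        then show ?thesis using Dq by linarith
      next
        case False
        then obtain z where z: "z \<in> reach G {u}" "z \<in> B" by auto
        have zn: "z \<in> {1..n}" using z(2) by (simp add: B_def)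
        have "real (card (reach G {z})) < d n z / q + \<delta> * scale n"
          using not z(2) by (intro large G zn) auto
        moreover have "d n z / q \<le> ?D / q" using degree_le_max[OF zn] q by (intro divide_right_mono) auto
        ultimately show ?thesis using reach_eq_of_mem[OF z(1)] u by simp
      qed
      have lower: "?D / q - \<delta> * scale n < real (card (C1 n G))"
      proof -
        have "G \<notin> H w" using not by auto
        then have "?D / q - \<delta> * scale n < comp_size K n w G" using G w by (auto simp: H_def q_def)
        also have "\<dots> \<le> real (card (reach G {w}))" by (simp add: comp_size_def)
        also have "\<dots> \<le> real (card (C1 n G))"
          using lc(2)[of "reach G {w}"] w(1) unfolding components_eq_reach[OF sG] by auto
        finally show ?thesis .
      qed
      have "\<bar>?D / (1 - nu n (d n)) - ?D / q\<bar> \<le> \<epsilon> / 2 * scale n" using elim(4) by (simp add: q_def)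
      moreover have "\<delta> * scale n \<le> \<epsilon> / 2 * scale n" using \<delta> N by (intro mult_right_mono) auto
      ultimately have "\<bar>real (card (C1 n G)) - ?D / (1 - nu n (d n))\<bar> \<le> \<epsilon> / 2 * scale n + \<epsilon> / 2 * scale n"
        using upper lower by (simp only: abs_le_iff abs_less_iff) linarith
      then show False using GX by (simp add: X_def)
    qed
    then have "card X \<le> card ((\<Union>v\<in>{1..n}. L v) \<union> (\<Union>v\<in>insert w B. H v))"
      using finLH finB by (intro card_mono) auto
    also have "\<dots> \<le> card (\<Union>v\<in>{1..n}. L v) + card (\<Union>v\<in>insert w B. H v)" by (rule card_Un_le)
    also have "\<dots> \<le> (\<Sum>v\<in>{1..n}. card (L v)) + (\<Sum>v\<in>insert w B. card (H v))"
      using finB by (intro add_mono card_UN_le) auto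
    finally have "real (card X) \<le> real ((\<Sum>v\<in>{1..n}. card (L v)) + (\<Sum>v\<in>insert w B. card (H v)))"
      by (rule of_nat_mono)
    also have "\<dots> = (\<Sum>v\<in>{1..n}. real (card (L v))) + (\<Sum>v\<in>insert w B. real (card (H v)))" by simp
    also have "\<dots> \<le> (\<Sum>v\<in>{1..n}. g / (real n)\<^sup>2) + (\<Sum>v\<in>insert w B. \<rho> * g)"
    proof (intro add_mono sum_mono)
      fix v assume "v \<in> {1..n}"
      then have "real (card (L v)) * (real n)\<^sup>2 \<le> g" using elim(2) by (simp add: L_def g_def B_def)
      then show "real (card (L v)) \<le> g / (real n)\<^sup>2" using n1 by (simp add: pos_le_divide_eq)
    next
      fix v assume "v \<in> insert w B"
      then have "v \<in> {1..n}" using w(1) by (auto simp: B_def)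
      then show "real (card (H v)) \<le> \<rho> * g" using elim(3) by (simp add: H_def g_def)
    qed
    also have "\<dots> = 1 / real n * g + real (card (insert w B)) * \<rho> * g"
      using n1 by (simp add: power2_eq_square)
    also have "\<dots> \<le> r / 2 * g + (b + 1) * \<rho> * g"
    proof (intro add_mono mult_right_mono)
      have "card (insert w B) \<le> card B + 1" using finB by (simp add: card_insert_if)
      then have "real (card (insert w B)) \<le> real (card B) + 1" by linarith
      also have "\<dots> \<le> b + 1" using card_heavy_le[OF n1 \<epsilon>0] by (simp add: B_def b_def)
      finally show "real (card (insert w B)) \<le> b + 1" .
    qed (use elim(1) \<rho> in \<open>auto simp: g_def\<close>)
    also have "\<dots> = r * g" using b by (simp add: \<rho>_def field_simps)
    finally show ?case by (simp add: X_def g_def)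
  qed
qed

end

theorem theorem1p3:
  fixes d :: "nat \<Rightarrow> nat \<Rightarrow> nat"
    and C1 :: "nat \<Rightarrow> nat set set \<Rightarrow> nat set"
    and mu_inf nu_inf \<gamma> :: real
  assumes realizable: "\<And>n. n \<ge> 1 \<Longrightarrow> graphs_with_degrees n (d n) \<noteq> {}"
    and largest: "\<And>n G. n \<ge> 1 \<Longrightarrow> G \<in> graphs_with_degrees n (d n) \<Longrightarrow>
                    is_largest_component {1..n} G (C1 n G)"
    and mu_lim: "(\<lambda>n. mean_degree n (d n)) \<longlonglongrightarrow> mu_inf"
    and nu_lim: "(\<lambda>n. nu n (d n)) \<longlonglongrightarrow> nu_inf"
    and mu_pos: "mu_inf > 0"
    and nu_less: "nu_inf < 1"
    and gamma: "\<gamma> > 3"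
    and tail: "\<exists>C::real. \<forall>n\<ge>1. \<forall>k\<ge>1.
                 measure_pmf.prob (degree_pmf n (d n)) {k..} \<le> C * real k powr (1 - \<gamma>)"
  shows "small_o_p (\<lambda>n. measure_pmf (random_graph n (d n)))
           (\<lambda>n G. real (card (C1 n G)) - real (max_degree n (d n)) / (1 - nu n (d n)))
           (\<lambda>n. real n powr (1 / (\<gamma> - 1)))"
proof -
  obtain C where C: "\<And>n k. n \<ge> 1 \<Longrightarrow> k \<ge> 1 \<Longrightarrow>
      measure_pmf.prob (degree_pmf n (d n)) {k..} \<le> C * real k powr (1 - \<gamma>)"
    using tail by auto
  interpret subcritical_degrees d \<gamma> C mu_inf nu_inf
    by unfold_locales (fact gamma C mu_lim nu_lim mu_pos nu_less)+
  show ?thesis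
    unfolding small_o_p_def
  proof (intro allI impI)
    fix \<epsilon> :: real assume \<epsilon>: "\<epsilon> > 0"
    define X where "X n = {G. \<epsilon> * scale n
      < \<bar>real (card (C1 n G)) - real (max_degree n (d n)) / (1 - nu n (d n))\<bar>}" for n
    have prob: "measure_pmf.prob (random_graph n (d n)) (X n) = card (graphs n \<inter> X n) / card (graphs n)"
      if "n \<ge> 1" for n
      using realizable[OF that] finite_degree_graphs[of "{1..n}" "d n"]
      by (simp add: random_graph_def graphs_with_degrees_eq measure_pmf_of_set)
    have "(\<lambda>n. measure_pmf.prob (random_graph n (d n)) (X n)) \<longlonglongrightarrow> 0"
    proof (rule order_tendstoI)
      fix r :: real assume "r < 0"
      then show "\<forall>\<^sub>F n in sequentially. r < measure_pmf.prob (random_graph n (d n)) (X n)"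
        by (intro always_eventually allI) (rule less_le_trans[OF _ measure_nonneg])
    next
      fix r :: real assume r: "0 < r"
      have "\<forall>\<^sub>F n in sequentially. real (card {G \<in> graphs n. \<epsilon> * scale n
          < \<bar>real (card (C1 n G)) - real (max_degree n (d n)) / (1 - nu n (d n))\<bar>}) \<le> r / 2 * card (graphs n)"
        using r by (intro eventually_largest_component \<epsilon> largest[unfolded graphs_with_degrees_eq]) simp_all
      then show "\<forall>\<^sub>F n in sequentially. measure_pmf.prob (random_graph n (d n)) (X n) < r"
        using eventually_ge_at_top[of 1]
      proof eventually_elim
        case (elim n)
        have pos: "real (card (graphs n)) > 0"
          using realizable[OF elim(2)] finite_degree_graphs[of "{1..n}" "d n"]
          by (simp add: graphs_with_degrees_eq card_gt_0_iff)
        have "graphs n \<inter> X n = {G \<in> graphs n. \<epsilon> * scale n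
          < \<bar>real (card (C1 n G)) - real (max_degree n (d n)) / (1 - nu n (d n))\<bar>}"
          by (auto simp: X_def)
        then have "measure_pmf.prob (random_graph n (d n)) (X n) \<le> r / 2"
          unfolding prob[OF elim(2)] using elim(1) pos by (simp add: pos_divide_le_eq)
        then show ?case using r by simp
      qed
    qed
    then show "(\<lambda>n. measure (measure_pmf (random_graph n (d n)))
        {\<omega> \<in> space (measure_pmf (random_graph n (d n))). \<bar>real (card (C1 n \<omega>)) -
          real (max_degree n (d n)) / (1 - nu n (d n))\<bar> > \<epsilon> * real n powr (1 / (\<gamma> - 1))}) \<longlonglongrightarrow> 0"
      by (simp add: X_def scale_def)
  qed
qed

end
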